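(* Let $N$ be a fixed positive odd integer and, for $\mathsf b>0$, let $$\chi^{(N)}_{4_1}(0)=\frac1{2\pi\mathsf b\sqrt N}\sum_{k\in\mathbb Z/N\mathbb Z}\int_{\mathbb R-id}\frac{D_{\mathsf b}\big(\tfrac{-x}{2\pi\mathsf b},-k\big)}{D_{\mathsf b}\big(\tfrac{x}{2\pi\mathsf b},k\big)}\,dx,\qquad 0<d<\tfrac{\pi}{\sqrt N}.$$ Let $h(x)=\mathrm{Li}_2(-e^{-\sqrt Nx})-\mathrm{Li}_2(-e^{\sqrt Nx})$ and $x_0=-\frac23\frac{\pi i}{\sqrt N}$. Then, as $\mathsf b\to0^+$, $$\chi^{(N)}_{4_1}(0)=e^{\frac{h(x_0)}{2\pi i\mathsf b^2N}}\;\frac{g_{4_1}(x_0)}{\sqrt{iN^{-1}h''(x_0)}}\,\big(1+\mathcal O(\mathsf b^2)\big),\qquad g_{4_1}(x)=\frac1{\sqrt N}\sum_{k=0}^{N-1}\phi_{-x}(k)\,\overline{\phi}_x(k),$$ where $\overline\phi_x(k):=\overline{\phi_{\bar x}(k)}$.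
   Context: $c_{\mathsf b}=i(\mathsf b+\mathsf b^{-1})/2$; Faddeev's quantum dilogarithm is $\Phi_{\mathsf b}(z)=\exp\int_{\mathbb R+i0}\frac{e^{-2izw}\,dw}{4\sinh(w\mathsf b)\sinh(w/\mathsf b)w}$ for $|\operatorname{Im}z|<|\operatorname{Im}c_{\mathsf b}|$ (the contour passes above $0$), continued meromorphically to $\mathbb C$. The level-$N$ quantum dilogarithm is $$D_{\mathsf b}(x,n)=\prod_{j=0}^{N-1}\Phi_{\mathsf b}\Big(\tfrac{x}{\sqrt N}+(1-\tfrac1N)c_{\mathsf b}-i\mathsf b^{-1}\tfrac jN-i\mathsf b\big\{\tfrac{j+n}N\big\}\Big),\quad n\in\mathbb Z/N\mathbb Z,$$ with $\{\cdot\}$ the fractional part. For $\mathsf b>0$ and real $x$, $1/D_{\mathsf b}(x,k)=\overline{D_{\mathsf b}(x,-k)}$. $\mathrm{Li}_2(z)=-\int_0^z\frac{\log(1-u)}u\,du$ on $\mathbb C\setminus[1,\infty)$. With $\omega=e^{2\pi i/N}$, $\overline\omega^{\,s}=e^{-2\pi is/N}$ and principal branches of the powers, $\phi_x:\mathbb Z/N\mathbb Z\to\mathbb C$ is defined by $$\phi_x(0)=(1+e^{x\sqrt N})^{-\frac{N-1}{2N}}\prod_{j=0}^{N-1}\big(1-e^{x/\sqrt N}\,\overline\omega^{\,j+\frac12}\big)^{j/N},\qquad \phi_x(n+1)=\phi_x(n)\,\frac{1-e^{x/\sqrt N}\,\overline\omega^{\,n+\frac12}}{(1+e^{x\sqrt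 N})^{1/N}}.$$ The integral $\chi^{(N)}_{4_1}(0)$ is the level-$N$ Teichmüller TQFT invariant attached to the figure-eight knot. *)

theory Defs
  imports "HOL-Complex_Analysis.Complex_Analysis"
begin

definition c_b :: "real \<Rightarrow> complex" where
  "c_b b = \<i> * of_real (b + 1 / b) / 2"

text \<open>The contour \<open>\<real> + \<i>0\<close> is the limit of the horizontal lines at height \<open>\<epsilon> \<down> 0\<close>; the integral
  does not depend on \<open>\<epsilon>\<close> as long as the line stays below the first nonzero pole.\<close>

definition faddeev_integral :: "real \<Rightarrow> complex \<Rightarrow> complex" where
  "faddeev_integral b z =
     Lim (at_right 0) (\<lambda>\<epsilon>::real. LBINT t.
       (let w = of_real t + \<i> * of_real \<epsilon>
        in exp (- 2 * \<i> * z * w) / (4 * sinh (w * of_real b) * sinh (w / of_real b) * w)))"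

text \<open>Outside the strip, the value is that of the meromorphic continuation; a nicely meromorphic
  function has removable singularities removed and takes the value 0 at its poles, which makes
  the continuation unique as a total function.\<close>

definition faddeev_dilog :: "real \<Rightarrow> complex \<Rightarrow> complex" where
  "faddeev_dilog b z =
     (if \<bar>Im z\<bar> < \<bar>Im (c_b b)\<bar> then exp (faddeev_integral b z)
      else (THE f. f nicely_meromorphic_on UNIV \<and>
                   (\<forall>u. \<bar>Im u\<bar> < \<bar>Im (c_b b)\<bar> \<longrightarrow> f u = exp (faddeev_integral b u))) z)"

text \<open>Elements of \<open>\<int>/N\<int>\<close> are represented by integers; the definition depends on \<open>n\<close> only modulo \<open>N\<close>.\<close>

definition level_dilog :: "nat \<Rightarrow> real \<Rightarrow> complex \<Rightarrow> int \<Rightarrow> complex" where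
  "level_dilog N b x n =
     (\<Prod>j<N. faddeev_dilog b
        (x / of_real (sqrt (real N)) + (1 - 1 / of_nat N) * c_b b
         - \<i> * of_real (1 / b) * (of_nat j / of_nat N)
         - \<i> * of_real b * of_real (frac (of_int (int j + n) / real N))))"

text \<open>The invariant \<open>\<chi>\<close> of the figure-eight knot at 0, with the integral taken along \<open>\<real> - \<i>d\<close>.\<close>

definition chi_4_1 :: "nat \<Rightarrow> real \<Rightarrow> real \<Rightarrow> complex" where
  "chi_4_1 N b d =
     1 / of_real (2 * pi * b * sqrt (real N)) *
     (\<Sum>k\<in>{0..<int N}. LBINT t.
        (let x = of_real t - \<i> * of_real d
         in level_dilog N b (- x / of_real (2 * pi * b)) (- k)
            / level_dilog N b (x / of_real (2 * pi * b)) k))"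

definition dilog :: "complex \<Rightarrow> complex" where
  "dilog z = - contour_integral (linepath 0 z) (\<lambda>u. Ln (1 - u) / u)"

definition omega_bar_pow :: "nat \<Rightarrow> real \<Rightarrow> complex" where
  "omega_bar_pow N s = exp (- 2 * of_real pi * \<i> * of_real s / of_nat N)"

text \<open>\<open>\<phi>\<^sub>x\<close> on \<open>\<int>/N\<int>\<close>, given on the representatives \<open>n \<ge> 0\<close>.\<close>

primrec phi :: "nat \<Rightarrow> complex \<Rightarrow> nat \<Rightarrow> complex" where
  "phi N x 0 =
     (1 + exp (x * of_real (sqrt (real N)))) powr (- (of_nat N - 1) / (2 * of_nat N)) *
     (\<Prod>j<N. (1 - exp (x / of_real (sqrt (real N))) * omega_bar_pow N (real j + 1 / 2))
               powr (of_nat j / of_nat N))"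
| "phi N x (Suc n) =
     phi N x n * ((1 - exp (x / of_real (sqrt (real N))) * omega_bar_pow N (real n + 1 / 2))
                  / (1 + exp (x * of_real (sqrt (real N)))) powr (1 / of_nat N))"

definition phi_bar :: "nat \<Rightarrow> complex \<Rightarrow> nat \<Rightarrow> complex" where
  "phi_bar N x k = cnj (phi N (cnj x) k)"

definition g_4_1 :: "nat \<Rightarrow> complex \<Rightarrow> complex" where
  "g_4_1 N x = 1 / of_real (sqrt (real N)) * (\<Sum>k<N. phi N (- x) k * phi_bar N x k)"

definition h_4_1 :: "nat \<Rightarrow> complex \<Rightarrow> complex" where
  "h_4_1 N x = dilog (- exp (- of_real (sqrt (real N)) * x)) - dilog (- exp (of_real (sqrt (real N)) * x))"

definition x_0 :: "nat \<Rightarrow> complex" where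
  "x_0 N = - (2 / 3) * (of_real pi * \<i> / of_real (sqrt (real N)))"

end

theory Submission
  imports Defs "HOL-Probability.Distributions" "HOL-Real_Asymp.Real_Asymp"
begin

text \<open>
  After the substitution \<open>w = b y\<close>, \<open>log \<Phi>\<^sub>b(z / (2 \<pi> b))\<close> is the integral of
  \<open>exp (- i z y / \<pi>) / (4 sinh (b\<^sup>2 y) sinh y y)\<close> along a horizontal line above the origin. Replacing
  \<open>sinh (b\<^sup>2 y)\<close> by \<open>b\<^sup>2 y\<close> gives \<open>Li\<^sub>2(- e\<^sup>z) / (2 \<pi> i b\<^sup>2)\<close>, with an error
  \<open>O(b\<^sup>2 (1 + |Re z|))\<close> on closed substrips of \<open>|Im z| < \<pi>\<close>; the Gaussian decay of the integrand absorbs the linear growth.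
  The \<open>N\<close> factors of \<open>D\<^sub>b\<close> combine by the distribution relation of \<open>Li\<^sub>2\<close> into the exponent \<open>h\<close>, and the shifts
  of order \<open>b\<^sup>2\<close> in their arguments produce the functions \<open>\<phi>\<close>. The inversion relation for \<open>\<Phi>\<^sub>b\<close> gives exponential decay
  of the integrand for every admissible \<open>d\<close>, so that the contour may be moved to the horizontal line through the saddle
  point \<open>x\<^sub>0\<close>. On that line \<open>Im h\<close> is concave with its maximum at \<open>x\<^sub>0\<close>, and Laplace's method applies. The leading
  coefficient does not vanish because \<open>x\<^sub>0\<close> is purely imaginary, which turns \<open>g(x\<^sub>0)\<close> into a sum of squares
  \<open>|\<phi>(k)|\<^sup>2\<close>.
\<close>

subsection \<open>Contour shifts and parameter integrals\<close>

text \<open>With X = sqrt N x the saddle equation h' = 0 forces (1 + e^X)(1 + e^(-X)) = 1, that is 2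
  cosh X = -1 and X = 2 pi i / 3 or -2 pi i / 3. The contour runs below the real axis, so the lower
  solution \<open>x_0\<close> is the one within reach. Two kinds of estimates are kept apart. For
  fixed b the inversion relation gives exponential decay with constants depending on b: enough to
  move the contour, useless for b -> 0. The estimates uniform in b hold on closed substrips and are
  applied on the saddle line alone. There h'' decays exponentially, so the real part of the phase
  falls only linearly at infinity; Laplace's method is therefore set up with t^2 / (1 + |t|) in
  place of t^2, which after division by b^2 still beats exp (C |t|). A shift i b^2 s of an argument
  changes Li_2(-e^z) / (2 pi i b^2) by -(s / 2 pi) log (1 + e^z) up to order b^2: these multiples of
  logarithms are the powers in phi. Identities between sums of logarithms come from differentiating
  identities for Li_2, which avoids any bookkeeping of branches.\<close>

lemma integrable_exp_neg_abs:
  fixes a :: real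
  assumes "a > 0"
  shows "integrable lborel (\<lambda>t. exp (- a * \<bar>t\<bar>))"
proof -
  have "((\<lambda>x::real. exp (-a*x)) has_integral exp (-a*0)/a) {0..}"
    by (rule has_integral_exp_minus_to_infinity[OF assms])
  hence "(\<lambda>x::real. exp (-a*x)) absolutely_integrable_on {0..}"
    by (intro nonnegative_absolutely_integrable_1) auto
  hence "integrable lebesgue (\<lambda>x. indicator {0..} x *\<^sub>R exp (-a*x))"
    by (simp add: set_integrable_def)
  hence 1: "integrable lborel (\<lambda>x. indicator {0..} x *\<^sub>R exp (-a*x))"
    by (subst (asm) integrable_completion) auto
  have 2: "integrable lborel (\<lambda>x. indicator {0..} (0 + (-1) * x) *\<^sub>R exp (-a*(0 + (-1) * x)))"
    using lborel_integrable_real_affine[OF 1, of "-1" 0] by simp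
  show ?thesis
  proof (rule Bochner_Integration.integrable_bound[OF Bochner_Integration.integrable_add[OF 1 2]])
    show "AE x in lborel. norm (exp (- a * \<bar>x\<bar>)) \<le> norm (indicator {0..} x *\<^sub>R exp (- a * x) +
         indicator {0..} (0 + - 1 * x) *\<^sub>R exp (- a * (0 + - 1 * x)))"
      by (rule AE_I2) (auto simp: indicator_def abs_if)
  qed measurable
qed

lemma integrable_exp_decay:
  fixes f :: "real \<Rightarrow> complex"
  assumes "a > 0" "f \<in> borel_measurable borel" "\<And>t. norm (f t) \<le> C * exp (- a * \<bar>t\<bar>)"
  shows "integrable lborel f"
proof (rule Bochner_Integration.integrable_bound)
  show "integrable lborel (\<lambda>t. C * exp (- a * \<bar>t\<bar>))"
    using integrable_exp_neg_abs[OF assms(1)] by simp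
  show "AE x in lborel. norm (f x) \<le> norm (C * exp (- a * \<bar>x\<bar>))"
    using assms(3) by (intro AE_I2) (smt (verit) real_norm_def)
qed (use assms(2) in auto)

text \<open>A bound that is uniform over a family of lines can fail near the poles between them; it
  is therefore asked only for |t| \<ge> 1, and continuity takes care of the compact rest.\<close>

lemma integrable_exp_decay_outside:
  fixes f :: "real \<Rightarrow> complex"
  assumes "a > 0" "continuous_on UNIV f" and le: "\<And>t. \<bar>t\<bar> \<ge> 1 \<Longrightarrow> norm (f t) \<le> C * exp (- a * \<bar>t\<bar>)"
  shows "integrable lborel f"
proof -
  have "bounded (f ` {-1..1})"
    using assms(2) by (intro compact_imp_bounded compact_continuous_image) (auto intro: continuous_on_subset)
  then obtain B where B: "\<And>t. t \<in> {-1..1} \<Longrightarrow> norm (f t) \<le> B"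
    unfolding bounded_iff by blast
  show ?thesis
  \<comment> \<open>On |t| < 1 the weight exp (- a |t|) is at least exp (- a); the factor
    \<open>exp a\<close> compensates for it.\<close>
  proof (rule integrable_exp_decay[OF assms(1), where C = "\<bar>C\<bar> + \<bar>B\<bar> * exp a"])
    show "f \<in> borel_measurable borel" using assms(2) by (rule borel_measurable_continuous_onI)
    fix t
    show "norm (f t) \<le> (\<bar>C\<bar> + \<bar>B\<bar> * exp a) * exp (- a * \<bar>t\<bar>)"
    proof (cases "\<bar>t\<bar> \<ge> 1")
      case True
      have "norm (f t) \<le> \<bar>C\<bar> * exp (- a * \<bar>t\<bar>)"
        using le[OF True] by (smt (verit) exp_gt_zero mult_right_mono)
      moreover have "0 \<le> \<bar>B\<bar> * exp a * exp (- a * \<bar>t\<bar>)" by simp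
      ultimately show ?thesis unfolding distrib_right by linarith
    next
      case False
      have "norm (f t) \<le> \<bar>B\<bar> * 1" using B[of t] False by (auto simp: abs_if split: if_splits)
      also have "\<dots> \<le> \<bar>B\<bar> * (exp a * exp (- a * \<bar>t\<bar>))"
        using False assms(1) by (intro mult_left_mono) (auto simp: exp_add[symmetric] mult_le_cancel_left1)
      finally show ?thesis by (smt (verit) exp_gt_zero mult.assoc distrib_right mult_nonneg_nonneg)
    qed
  qed
qed

text \<open>Links the two integrals in use: contour integrals over finite segments become
  \<open>integral {-T..T}\<close>, whereas the objects of study are Lebesgue integrals over the
  whole line.\<close>

lemma lborel_integral_interval_tendsto:
  fixes f :: "real \<Rightarrow> complex"
  assumes "integrable lborel f"
  shows "((\<lambda>T. integral {-T..T} f) \<longlongrightarrow> (LBINT t. f t)) at_top"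
proof -
  have [measurable]: "f \<in> borel_measurable borel" using assms by auto
  have "((\<lambda>T::real. LBINT t. indicator {-T..T} t *\<^sub>R f t) \<longlongrightarrow> (LBINT t. f t)) at_top"
  proof (rule integral_dominated_convergence_at_top[where w = "\<lambda>t. norm (f t)"])
    show "integrable lborel (\<lambda>t. norm (f t))" using assms by simp
    show "AE x in lborel. ((\<lambda>T. indicator {-T..T} x *\<^sub>R f x) \<longlongrightarrow> f x) at_top"
    proof (rule AE_I2)
      fix x :: real
      have "eventually (\<lambda>T. indicator {-T..T} x *\<^sub>R f x = f x) at_top"
        using eventually_ge_at_top[of "\<bar>x\<bar>"] by eventually_elim (auto simp: indicator_def)
      thus "((\<lambda>T. indicator {-T..T} x *\<^sub>R f x) \<longlongrightarrow> f x) at_top"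
        by (rule tendsto_eventually)
    qed
    show "\<forall>\<^sub>F T in at_top. AE x in lborel. norm (indicator {-T..T} x *\<^sub>R f x) \<le> norm (f x)"
      by (intro always_eventually allI AE_I2) (auto simp: indicator_def)
  qed auto
  moreover have "(LBINT t. indicator {-T..T} t *\<^sub>R f t) = integral {-T..T} f" for T
  proof -
    have "set_integrable lborel {-T..T} f"
      using assms by (simp add: set_integrable_def integrable_mult_indicator)
    thus ?thesis by (simp add: set_borel_integral_eq_integral(2)[symmetric] set_lebesgue_integral_def)
  qed
  ultimately show ?thesis by simp
qed

lemma contour_integral_horizontal:
  fixes f :: "complex \<Rightarrow> complex"
  assumes "T > 0"
  shows "contour_integral (linepath (Complex (-T) y) (Complex T y)) f = integral {-T..T} (\<lambda>t. f (Complex t y))"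
proof -
  have "contour_integral (linepath (Complex (-T) y) (Complex T y)) f =
        contour_integral (linepath (of_real (-T)) (of_real T)) (\<lambda>w. f (w + \<i> * of_real y))"
    by (simp add: contour_integral_integral linepath_def Complex_eq algebra_simps scaleR_conv_of_real)
  also have "\<dots> = integral {-T..T} (\<lambda>t. f (of_real t + \<i> * of_real y))"
    using assms by (subst contour_integral_linepath_Reals_eq) auto
  finally show ?thesis by (simp add: Complex_eq)
qed

text \<open>Residue theorem on rectangles of growing width. The margins \<open>A < a\<close> and
  \<open>b < B\<close> put the closed rectangle inside an open domain, and the exponential bound
  kills the vertical sides. The lower line carries the plus sign because the rectangle is traversed
  counterclockwise.\<close>

lemma strip_contour_shift:
  fixes f :: "complex \<Rightarrow> complex"
  assumes AB: "A < a" "a < b" "b < B" and kappa: "\<kappa> > 0" and P: "finite P" "\<And>p. p \<in> P \<Longrightarrow> a < Im p \<and> Im p < b"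
    and holo: "f holomorphic_on ({w. A < Im w \<and> Im w < B} - P)"
    and bound: "\<And>t y. a \<le> y \<Longrightarrow> y \<le> b \<Longrightarrow> \<bar>t\<bar> \<ge> 1 \<Longrightarrow> norm (f (Complex t y)) \<le> C * exp (- \<kappa> * \<bar>t\<bar>)"
  shows "integrable lborel (\<lambda>t. f (Complex t a))" "integrable lborel (\<lambda>t. f (Complex t b))"
    "(LBINT t. f (Complex t a)) - (LBINT t. f (Complex t b)) = 2 * pi * \<i> * (\<Sum>p\<in>P. residue f p)"
proof -
  have cont: "continuous_on ({w. A < Im w \<and> Im w < B} - P) f"
    using holo by (rule holomorphic_on_imp_continuous_on)
  have contl: "continuous_on UNIV (\<lambda>t. f (Complex t y))" if "y = a \<or> y = b" for y
    using that AB P(2)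
    by (intro continuous_on_compose2[OF cont]) (auto simp: Complex_eq intro!: continuous_intros dest: P(2))
  show int: "integrable lborel (\<lambda>t. f (Complex t a))" "integrable lborel (\<lambda>t. f (Complex t b))"
    by (rule integrable_exp_decay_outside[OF kappa contl bound]; use AB in simp)+
  have C: "C \<ge> 0"
    using order.trans[OF norm_ge_zero bound[of a 1]] AB by (simp add: zero_le_mult_iff)
  have "bounded P" using P(1) by (rule finite_imp_bounded)
  then obtain M where M: "\<And>p. p \<in> P \<Longrightarrow> norm p \<le> M" unfolding bounded_iff by blast
  have notP: "\<bar>Re x\<bar> \<le> M" if "x \<in> P" for x
    using M[OF that] abs_Re_le_cmod[of x] by simp
  define V where "V T = contour_integral (linepath (Complex T a) (Complex T b)) f" for T
  \<comment> \<open>The vertical sides must lie where the bound applies and beyond the real parts of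
    all poles, hence \<open>max 1 M\<close>.\<close>
  have vert: "norm (V T) \<le> C * exp (- \<kappa> * \<bar>T\<bar>) * (b - a)"
    if "\<bar>T\<bar> > max 1 M" for T
  proof -
    have "f contour_integrable_on linepath (Complex T a) (Complex T b)"
    proof (intro contour_integrable_continuous_linepath continuous_on_subset[OF cont])
      show "closed_segment (Complex T a) (Complex T b) \<subseteq> {w. A < Im w \<and> Im w < B} - P"
      proof
        fix x assume "x \<in> closed_segment (Complex T a) (Complex T b)"
        hence "Re x = T" "a \<le> Im x" "Im x \<le> b"
          using AB by (auto simp: closed_segment_same_Re closed_segment_eq_real_ivl)
        thus "x \<in> {w. A < Im w \<and> Im w < B} - P" using AB that notP[of x] by auto
      qed
    qed
    hence "norm (V T) \<le> C * exp (- \<kappa> * \<bar>T\<bar>) * norm (Complex T b - Complex T a)"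
      unfolding V_def
    proof (rule contour_integral_bound_linepath)
      fix x assume "x \<in> closed_segment (Complex T a) (Complex T b)"
      hence "Re x = T" "a \<le> Im x" "Im x \<le> b"
        using AB by (auto simp: closed_segment_same_Re closed_segment_eq_real_ivl)
      thus "norm (f x) \<le> C * exp (- \<kappa> * \<bar>T\<bar>)"
        using bound[of "Im x" T] that by (cases x) auto
    qed (use C in auto)
    also have "Complex T b - Complex T a = \<i> * of_real (b - a)" by (simp add: complex_eq_iff)
    finally show ?thesis using AB by (simp add: norm_mult del: of_real_diff)
  qed
  have eq: "integral {-T..T} (\<lambda>t. f (Complex t a)) + V T
      - integral {-T..T} (\<lambda>t. f (Complex t b)) - V (-T) = 2 * pi * \<i> * (\<Sum>p\<in>P. residue f p)"
    if T: "T > max 1 M" for T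
  proof -
    define g where "g = rectpath (Complex (-T) a) (Complex T b)"
    let ?S = "{w. A < Im w \<and> Im w < B}"
    have sub: "closed_segment (Complex (-T) a) (Complex T a) \<subseteq> ?S - P"
      "closed_segment (Complex T a) (Complex T b) \<subseteq> ?S - P"
      "closed_segment (Complex (-T) b) (Complex T b) \<subseteq> ?S - P"
      "closed_segment (Complex (-T) a) (Complex (-T) b) \<subseteq> ?S - P"
    proof -
      have *: "x \<in> ?S - P" if "a \<le> Im x" "Im x \<le> b" "Im x = a \<or> Im x = b \<or> \<bar>Re x\<bar> = T" for x
        using that AB notP[of x] T P(2)[of x] by auto
      show "closed_segment (Complex (-T) a) (Complex T a) \<subseteq> ?S - P"
        "closed_segment (Complex T a) (Complex T b) \<subseteq> ?S - P"
        "closed_segment (Complex (-T) b) (Complex T b) \<subseteq> ?S - P"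
        "closed_segment (Complex (-T) a) (Complex (-T) b) \<subseteq> ?S - P"
        using AB T
        by (intro subsetI *; simp add: closed_segment_same_Re closed_segment_same_Im closed_segment_eq_real_ivl; fail)+
    qed
    have ci: "f contour_integrable_on linepath (Complex (-T) a) (Complex T a)"
      "f contour_integrable_on linepath (Complex T a) (Complex T b)"
      "f contour_integrable_on linepath (Complex (-T) b) (Complex T b)"
      "f contour_integrable_on linepath (Complex (-T) a) (Complex (-T) b)"
      by (intro contour_integrable_continuous_linepath continuous_on_subset[OF cont] sub)+
    have img: "path_image g = closed_segment (Complex (-T) a) (Complex T a) \<union>
        (closed_segment (Complex T a) (Complex T b) \<union>
        (closed_segment (Complex (-T) b) (Complex T b) \<union> closed_segment (Complex (-T) a) (Complex (-T) b)))"
      by (simp add: g_def rectpath_def path_image_join closed_segment_commute Let_def)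
    have wn: "winding_number g p = 1" if "p \<in> P" for p
      unfolding g_def
    proof (rule winding_number_rectpath)
      show "p \<in> box (Complex (-T) a) (Complex T b)"
        using P(2)[OF that] M[OF that] abs_Re_le_cmod[of p] T by (auto simp: in_box_complex_iff)
    qed
    have "contour_integral g f = 2 * pi * \<i> * (\<Sum>p\<in>P. winding_number g p * residue f p)"
    proof (rule Residue_theorem[of ?S])
      show "open ?S" by (intro open_Collect_conj open_Collect_less continuous_intros)
      have "convex ?S"
      proof -
        have "?S = {w. A < Im w} \<inter> {w. Im w < B}" by auto
        thus ?thesis by (simp add: convex_Int convex_halfspace_Im_gt convex_halfspace_Im_lt)
      qed
      thus "connected ?S" by (rule convex_connected)
      show "path_image g \<subseteq> ?S - P" unfolding img using sub by blast
      show "\<forall>z. z \<notin> ?S \<longrightarrow> winding_number g z = 0"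
      proof (intro allI impI)
        fix z assume "z \<notin> ?S"
        thus "winding_number g z = 0" unfolding g_def using T AB
          by (intro winding_number_rectpath_outside) (auto simp: in_cbox_complex_iff)
      qed
    qed (use P holo in \<open>auto simp: g_def\<close>)
    also have "(\<Sum>p\<in>P. winding_number g p * residue f p) = (\<Sum>p\<in>P. residue f p)"
      by (rule sum.cong) (auto simp: wn)
    finally have "contour_integral g f = 2 * pi * \<i> * (\<Sum>p\<in>P. residue f p)" .
    moreover have "contour_integral g f = contour_integral (linepath (Complex (-T) a) (Complex T a)) f + V T
       - contour_integral (linepath (Complex (-T) b) (Complex T b)) f - V (-T)"
    proof -
      have "contour_integral g f = contour_integral (linepath (Complex (-T) a) (Complex T a)) f +
        (contour_integral (linepath (Complex T a) (Complex T b)) f +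
         (contour_integral (linepath (Complex T b) (Complex (-T) b)) f +
          contour_integral (linepath (Complex (-T) b) (Complex (-T) a)) f))"
        using ci contour_integrable_reversepath[OF _ ci(3)] contour_integrable_reversepath[OF _ ci(4)]
        unfolding g_def rectpath_def Let_def
        by (simp add: contour_integral_join)
      moreover have "contour_integral (linepath (Complex T b) (Complex (-T) b)) f =
          - contour_integral (linepath (Complex (-T) b) (Complex T b)) f"
        by (rule contour_integral_reverse_linepath) (rule continuous_on_subset[OF cont], use sub(3) in \<open>simp only: closed_segment_commute\<close>)
      moreover have "contour_integral (linepath (Complex (-T) b) (Complex (-T) a)) f =
          - contour_integral (linepath (Complex (-T) a) (Complex (-T) b)) f"
        by (rule contour_integral_reverse_linepath) (rule continuous_on_subset[OF cont], use sub(4) in \<open>simp only: closed_segment_commute\<close>)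
      ultimately show ?thesis by (simp add: V_def)
    qed
    ultimately show ?thesis using T by (simp add: contour_integral_horizontal)
  qed
  have V0: "(V \<longlongrightarrow> 0) at_top" "((\<lambda>T. V (-T)) \<longlongrightarrow> 0) at_top"
  proof -
    have "((\<lambda>T. exp (- \<kappa> * T)) \<longlongrightarrow> 0) at_top"
      using kappa by real_asymp
    hence lim: "((\<lambda>T. C * exp (- \<kappa> * T) * (b - a)) \<longlongrightarrow> 0) at_top"
      by (rule tendsto_mult_left_zero[OF tendsto_mult_right_zero])
    have "eventually (\<lambda>T. norm (V T) \<le> C * exp (- \<kappa> * T) * (b - a)) at_top"
    proof (rule eventually_mono[OF eventually_gt_at_top[of "max 1 M"]])
      fix T assume "max 1 M < T"
      thus "norm (V T) \<le> C * exp (- \<kappa> * T) * (b - a)" using vert[of T] by simp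
    qed
    moreover have "eventually (\<lambda>T. norm (V (-T)) \<le> C * exp (- \<kappa> * T) * (b - a)) at_top"
    proof (rule eventually_mono[OF eventually_gt_at_top[of "max 1 M"]])
      fix T assume "max 1 M < T"
      thus "norm (V (-T)) \<le> C * exp (- \<kappa> * T) * (b - a)" using vert[of "-T"] by simp
    qed
    ultimately
    show "(V \<longlongrightarrow> 0) at_top" "((\<lambda>T. V (-T)) \<longlongrightarrow> 0) at_top"
      by (auto intro: Lim_null_comparison[OF _ lim])
  qed
  have "((\<lambda>T. integral {-T..T} (\<lambda>t. f (Complex t a)) + V T
      - integral {-T..T} (\<lambda>t. f (Complex t b)) - V (-T)) \<longlongrightarrow>
      (LBINT t. f (Complex t a)) + 0 - (LBINT t. f (Complex t b)) - 0) at_top"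
    by (intro tendsto_intros lborel_integral_interval_tendsto int V0)
  moreover have "((\<lambda>T. integral {-T..T} (\<lambda>t. f (Complex t a)) + V T
      - integral {-T..T} (\<lambda>t. f (Complex t b)) - V (-T)) \<longlongrightarrow>
      2 * pi * \<i> * (\<Sum>p\<in>P. residue f p)) at_top"
    by (rule tendsto_eventually) (use eventually_gt_at_top[of "max 1 M"] eq in \<open>auto elim!: eventually_mono\<close>)
  ultimately show "(LBINT t. f (Complex t a)) - (LBINT t. f (Complex t b)) = 2 * pi * \<i> * (\<Sum>p\<in>P. residue f p)"
    using tendsto_unique[OF trivial_limit_at_top_linorder] by fastforce
qed

text \<open>Domination of the functions themselves is enough: Cauchy's inequality on discs of radius
  r bounds the derivatives by g / r, and this dominates the difference quotients.\<close>

lemma has_field_derivative_lborel_integral: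
  fixes f :: "complex \<Rightarrow> real \<Rightarrow> complex"
  assumes "open S" "z \<in> S"
    and holo: "\<And>t. (\<lambda>w. f w t) holomorphic_on S"
    and meas: "\<And>w. w \<in> S \<Longrightarrow> f w \<in> borel_measurable borel"
    and g: "integrable lborel g" and le: "\<And>w t. w \<in> S \<Longrightarrow> norm (f w t) \<le> g t"
  shows "((\<lambda>w. LBINT t. f w t) has_field_derivative (LBINT t. deriv (\<lambda>w. f w t) z)) (at z)"
proof -
  \<comment> \<open>The radius is halved so that every disc of radius r about a point of
    \<open>cball z r\<close> remains in S.\<close>
  obtain r where r: "r > 0" "cball z (2*r) \<subseteq> S"
  proof -
    obtain r where "r > 0" "cball z r \<subseteq> S"
      using assms(1,2) by (meson open_contains_cball)
    thus ?thesis by (intro that[of "r/2"]) auto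
  qed
  have int: "integrable lborel (f w)" if "w \<in> S" for w
  proof (rule Bochner_Integration.integrable_bound[OF g])
    show "AE x in lborel. norm (f w x) \<le> norm (g x)"
      using le[OF that] by (intro AE_I2) (smt (verit) real_norm_def)
  qed (use meas[OF that] in auto)
  have lip: "norm (f w t - f z t) \<le> g t / r * norm (w - z)" if "w \<in> cball z r" for w t
  proof -
    have "norm (f w t - f z t) \<le> (g t / r) * norm (w - z)"
    proof (rule field_differentiable_bound[where S = "cball z r"])
      fix u assume u: "u \<in> cball z r"
      hence sub: "cball u r \<subseteq> S" using r
        by (intro order.trans[OF _ r(2)]) (auto simp: subset_iff, smt (verit) dist_triangle)
      have uS: "u \<in> S" using sub r by auto
      show "((\<lambda>w. f w t) has_field_derivative deriv (\<lambda>w. f w t) u) (at u within cball z r)"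
        by (rule has_field_derivative_at_within) (rule holomorphic_derivI[OF holo[of t] assms(1) uS])
      have "norm ((deriv ^^ 1) (\<lambda>w. f w t) u) \<le> fact 1 * g t / r ^ 1"
      proof (rule Cauchy_inequality)
        show "(\<lambda>w. f w t) holomorphic_on ball u r"
          using holo sub ball_subset_cball by (meson holomorphic_on_subset order_trans)
        show "continuous_on (cball u r) (\<lambda>w. f w t)"
          using holo sub holomorphic_on_imp_continuous_on holomorphic_on_subset by blast
        fix x assume "norm (u - x) = r"
        thus "norm (f x t) \<le> g t" using sub by (intro le) (auto simp: dist_norm)
      qed (use r in auto)
      thus "norm (deriv (\<lambda>w. f w t) u) \<le> g t / r" by simp
    qed (use that r in auto)
    thus ?thesis .
  qed
  have "((\<lambda>w. ((LBINT t. f w t) - (LBINT t. f z t)) / (w - z)) \<longlongrightarrow> (LBINT t. deriv (\<lambda>w. f w t) z)) (at z)"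
    unfolding tendsto_at_iff_sequentially
  proof (intro allI impI)
    fix X :: "nat \<Rightarrow> complex"
    assume X: "\<forall>i. X i \<in> UNIV - {z}" "X \<longlonglongrightarrow> z"
    then obtain n0 where n0: "\<And>n. n \<ge> n0 \<Longrightarrow> X n \<in> cball z r"
      using r(1) unfolding lim_sequentially by (metis dist_commute less_imp_le mem_cball)
    \<comment> \<open>The first n0 terms are dropped because the domination holds only inside the
      disc; \<open>LIMSEQ_offset\<close> restores them.\<close>
    define Y where "Y n = X (n + n0)" for n
    have Y: "Y \<longlonglongrightarrow> z" "\<And>n. Y n \<in> cball z r" "\<And>n. Y n \<noteq> z"
      using X n0 LIMSEQ_ignore_initial_segment[OF X(2), of n0] by (auto simp: Y_def[abs_def])
    have YS: "Y n \<in> S" for n using Y(2)[of n] r by auto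
    have "(\<lambda>n. LBINT t. (f (Y n) t - f z t) / (Y n - z)) \<longlonglongrightarrow> (LBINT t. deriv (\<lambda>w. f w t) z)"
    proof (rule integral_dominated_convergence[where w = "\<lambda>t. g t / r"])
      have pt: "(\<lambda>n. (f (Y n) t - f z t) / (Y n - z)) \<longlonglongrightarrow> deriv (\<lambda>w. f w t) z" for t
      proof -
        have "((\<lambda>w. (f w t - f z t) / (w - z)) \<longlongrightarrow> deriv (\<lambda>w. f w t) z) (at z)"
          using holomorphic_derivI[OF holo assms(1,2), of t] by (simp add: has_field_derivative_iff)
        thus ?thesis using Y unfolding tendsto_at_iff_sequentially by (auto simp: o_def)
      qed
      thus "AE t in lborel. (\<lambda>n. (f (Y n) t - f z t) / (Y n - z)) \<longlonglongrightarrow> deriv (\<lambda>w. f w t) z" by simp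
      show m: "(\<lambda>t. (f (Y n) t - f z t) / (Y n - z)) \<in> borel_measurable lborel" for n
        using meas[OF YS[of n]] meas[OF assms(2)] by simp
      show "(\<lambda>t. deriv (\<lambda>w. f w t) z) \<in> borel_measurable lborel"
        by (rule borel_measurable_LIMSEQ_metric[OF m pt])
      show "integrable lborel (\<lambda>t. g t / r)" using g by simp
      show "AE t in lborel. norm ((f (Y n) t - f z t) / (Y n - z)) \<le> g t / r" for n
        using lip[OF Y(2)[of n]] Y(3)[of n] by (intro AE_I2) (simp add: norm_divide field_simps)
    qed
    moreover have "(LBINT t. (f (Y n) t - f z t) / (Y n - z)) = ((LBINT t. f (Y n) t) - (LBINT t. f z t)) / (Y n - z)" for n

      by (subst integral_divide_zero, subst Bochner_Integration.integral_diff[OF int[OF YS[of n]] int[OF assms(2)]]) (rule refl)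
    ultimately have "(\<lambda>n. ((\<lambda>w. ((LBINT t. f w t) - (LBINT t. f z t)) / (w - z)) \<circ> X) (n + n0)) \<longlonglongrightarrow> (LBINT t. deriv (\<lambda>w. f w t) z)"
      by (simp only: Y_def o_def)
    thus "((\<lambda>w. ((LBINT t. f w t) - (LBINT t. f z t)) / (w - z)) \<circ> X) \<longlonglongrightarrow> (LBINT t. deriv (\<lambda>w. f w t) z)"
      by (rule LIMSEQ_offset)
  qed
  thus ?thesis by (simp add: has_field_derivative_iff)
qed

subsection \<open>Laplace's method\<close>

lemma power_le_fact_exp:
  fixes x :: real
  assumes "x \<ge> 0"
  shows "x ^ n \<le> fact n * exp x"
proof -
  have "x ^ n /\<^sub>R fact n \<le> (\<Sum>k. x ^ k /\<^sub>R fact k)"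
    using sum_le_suminf[OF summable_exp_generic[of x], of "{n}"] assms by auto
  thus ?thesis by (simp add: exp_def field_simps)
qed

text \<open>Combines (1 + u)^n \<le> n! exp (1 + u) with the completed square 3 u \<le> c u^2 + 9 /
  (4 c); of the 3, one unit pays for the exponential and two remain as decay rate.\<close>

lemma power_mult_gaussian_le:
  fixes c :: real
  assumes "c > 0" "u \<ge> 0"
  shows "(1 + u) ^ n * exp (- c * u\<^sup>2) \<le> fact n * exp (1 + 9 / (4 * c)) * exp (- 2 * u)"
proof -
  have "0 \<le> (2 * c * u - 3)\<^sup>2" by simp
  hence "12 * c * u \<le> 4 * c\<^sup>2 * u\<^sup>2 + 9" by (simp add: power2_eq_square algebra_simps)
  hence *: "(1 + u) - c * u\<^sup>2 \<le> 1 + 9 / (4 * c) - 2 * u"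
    using assms(1) by (simp add: field_simps power2_eq_square)
  have "(1 + u) ^ n * exp (- c * u\<^sup>2) \<le> (fact n * exp (1 + u)) * exp (- c * u\<^sup>2)"
    using power_le_fact_exp[of "1 + u" n] assms by (intro mult_right_mono) auto
  also have "\<dots> = fact n * exp ((1 + u) - c * u\<^sup>2)" by (simp add: exp_add[symmetric] exp_diff exp_minus field_simps)
  also have "\<dots> \<le> fact n * exp (1 + 9 / (4 * c) - 2 * u)" using * by simp
  also have "\<dots> = fact n * exp (1 + 9 / (4 * c)) * exp (- 2 * u)" by (simp add: exp_add[symmetric] exp_diff exp_minus field_simps)
  finally show ?thesis .
qed

lemma lborel_integral_odd:
  fixes f :: "real \<Rightarrow> complex"
  assumes "\<And>x. f (-x) = - f x"
  shows "(LBINT x. f x) = 0"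
proof -
  have "(LBINT x. f x) = (LBINT x. f (0 + (-1) * x))"
    using lborel_integral_real_affine[of "-1" f 0] by simp
  also have "\<dots> = - (LBINT x. f x)" by (simp add: assms)
  finally show ?thesis by simp
qed

lemma lborel_gaussian_integral:
  fixes c :: real
  assumes "c > 0"
  shows "integrable lborel (\<lambda>x. exp (- c * x\<^sup>2))" "(LBINT x. exp (- c * x\<^sup>2)) = sqrt (pi / c)"
proof -
  have 0: "has_bochner_integral lborel (\<lambda>x::real. exp (-x\<^sup>2)) (sqrt pi)"
    using has_bochner_integral_even_function[OF gaussian_moment_0] by simp
  have i: "integrable lborel (\<lambda>x::real. exp (-x\<^sup>2))" using 0 by (simp add: has_bochner_integral_iff)
  have eq: "- (0 + sqrt c * x)\<^sup>2 = - c * x\<^sup>2" for x using assms by (simp add: power_mult_distrib)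
  show "integrable lborel (\<lambda>x. exp (- c * x\<^sup>2))"
    using lborel_integrable_real_affine[OF i, of "sqrt c" 0] assms unfolding eq by simp
  have "sqrt pi = sqrt c * (LBINT x. exp (- c * x\<^sup>2))"
    using lborel_integral_real_affine[of "sqrt c" "\<lambda>x. exp (-x\<^sup>2)" 0] assms 0
    unfolding eq by (simp add: has_bochner_integral_iff)
  thus "(LBINT x. exp (- c * x\<^sup>2)) = sqrt (pi / c)" using assms by (simp add: real_sqrt_divide field_simps)
qed

lemma norm_exp_minus_one_le:
  fixes z :: complex
  shows "norm (exp z - 1) \<le> norm z * exp (norm z)"
  using Taylor_exp_field[of z 0] by (simp add: mult.commute)

text \<open>Put \<open>t = b s\<close> and compare the integrand with \<open>exp (- c s\<^sup>2) (q0 + b (q1 s + q0 \<beta> s\<^sup>3))\<close>: the error is of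
  order \<open>b\<^sup>2\<close>, and the term of order \<open>b\<close> is odd and integrates to zero.\<close>

lemma laplace_asymptotics:
  fixes p q :: "real \<Rightarrow> complex" and r :: "real \<Rightarrow> real \<Rightarrow> complex"
  assumes c: "c > 0" and kappa: "\<kappa> > 0" and eta0: "0 < \<eta>\<^sub>0" and C: "C \<ge> 0" and b0: "b\<^sub>0 > 0"
    and p_Taylor: "\<And>t. \<bar>t\<bar> \<le> \<eta>\<^sub>0 \<Longrightarrow> norm (p t + of_real (c * t\<^sup>2) - \<beta> * of_real (t ^ 3)) \<le> C * t ^ 4"
    and p_Re: "\<And>t. Re (p t) \<le> - \<kappa> * t\<^sup>2 / (1 + \<bar>t\<bar>)"
    and q_Taylor: "\<And>t. \<bar>t\<bar> \<le> \<eta>\<^sub>0 \<Longrightarrow> norm (q t - q0 - q1 * of_real t) \<le> C * t\<^sup>2"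
    and q_bound: "\<And>t. norm (q t) \<le> C * exp (C * \<bar>t\<bar>)"
    and r_approx: "\<And>b t. 0 < b \<Longrightarrow> b < b\<^sub>0 \<Longrightarrow> norm (r b t - q t) \<le> C * b\<^sup>2 * exp (C * \<bar>t\<bar>)"
    and meas: "\<And>b. 0 < b \<Longrightarrow> b < b\<^sub>0 \<Longrightarrow> (\<lambda>t. exp (p t / of_real (b\<^sup>2)) * r b t) \<in> borel_measurable borel"
  shows "\<exists>K b\<^sub>1. 0 < b\<^sub>1 \<and> (\<forall>b. 0 < b \<and> b < b\<^sub>1 \<longrightarrow>
           norm ((LBINT t. exp (p t / of_real (b\<^sup>2)) * r b t) - of_real (b * sqrt (pi / c)) * q0) \<le> K * b ^ 3)"
proof -
  define D where "D = norm \<beta> + C"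
  have D0: "D \<ge> 0" "norm \<beta> \<le> D" "C \<le> D" using C by (auto simp: D_def)
  \<comment> \<open>With \<open>D * \<eta> \<le> c / 2\<close>, for |t| \<le> \<eta> the deviation
    of p t / b^2 from - c s^2 costs at most half of the Gaussian.\<close>
  define \<eta> where "\<eta> = min 1 (min \<eta>\<^sub>0 (c / (2 * (D + 1))))"
  have eta: "0 < \<eta>" "\<eta> \<le> 1" "\<eta> \<le> \<eta>\<^sub>0" "D * \<eta> \<le> c / 2"
  proof -
    show "0 < \<eta>" "\<eta> \<le> 1" "\<eta> \<le> \<eta>\<^sub>0" using eta0 c D0 by (auto simp: \<eta>_def)
    have "D * \<eta> \<le> D * (c / (2 * (D + 1)))" using D0 by (intro mult_left_mono) (auto simp: \<eta>_def)
    also have "\<dots> \<le> c / 2" using c D0 by (simp add: field_simps)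
    finally show "D * \<eta> \<le> c / 2" .
  qed
  \<comment> \<open>Where b u > 1 the damping is linear with rate \<kappa> / (2 b). For small b this
    rate is at least 2 + C, which absorbs the growth exp (C b u) and leaves exp (- 2 u).\<close>
  define b\<^sub>1 where "b\<^sub>1 = min (min 1 b\<^sub>0) (\<kappa> / (2 * (2 + C)))"
  have b1: "0 < b\<^sub>1" using b0 kappa C by (auto simp: b\<^sub>1_def)
  have b1': "b < 1" "b < b\<^sub>0" "(2 + C) \<le> \<kappa> / (2 * b)" if "0 < b" "b < b\<^sub>1" for b
  proof -
    show "b < 1" "b < b\<^sub>0" using that by (auto simp: b\<^sub>1_def)
    have "b \<le> \<kappa> / (2 * (2 + C))" using that by (auto simp: b\<^sub>1_def)
    thus "(2 + C) \<le> \<kappa> / (2 * b)" using that C by (simp add: field_simps)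
  qed
  define A where "A = exp (C + 2 / \<kappa>)"
  \<comment> \<open>Two regimes: for b u \<le> 1 the denominator is at most 2 and the damping is
    Gaussian; for b u > 1 it is at most 2 b u and the damping is linear.\<close>
  have damp: "exp (- \<kappa> * u\<^sup>2 / (1 + b * u)) * exp (C * (b * u)) \<le> A * exp (- 2 * u)"
    if b: "0 < b" "b < b\<^sub>1" and u: "u \<ge> 0" for b u :: real
  proof -
    have "- \<kappa> * u\<^sup>2 / (1 + b * u) + C * (b * u) \<le> (C + 2 / \<kappa>) - 2 * u"
    proof (cases "b * u \<le> 1")
      case True
      have "C * (b * u) \<le> C * 1" using True C by (intro mult_left_mono) auto
      moreover have "\<kappa> * u\<^sup>2 / 2 \<le> \<kappa> * u\<^sup>2 / (1 + b * u)"
        using True kappa mult_nonneg_nonneg[of b u] b u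
        by (intro divide_left_mono) (auto intro!: mult_pos_pos add_pos_nonneg)
      moreover have "2 * u - 2 / \<kappa> \<le> \<kappa> * u\<^sup>2 / 2"
      proof -
        have "0 \<le> (\<kappa> * u - 2)\<^sup>2" by simp
        thus ?thesis using kappa by (simp add: field_simps power2_eq_square)
      qed
      ultimately show ?thesis by simp
    next
      case False
      hence u0: "u > 0" using u by (cases "u = 0") auto
      have "(2 + C) * u \<le> \<kappa> / (2 * b) * u" using b1'(3)[OF b] u by (intro mult_right_mono) auto
      also have "\<dots> = \<kappa> * u\<^sup>2 / (2 * (b * u))" using u0 b by (simp add: power2_eq_square)
      also have "\<dots> \<le> \<kappa> * u\<^sup>2 / (1 + b * u)" using False kappa b u0
        by (intro divide_left_mono) (auto intro!: mult_pos_pos add_pos_pos)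
      finally have "(2 + C) * u \<le> \<kappa> * u\<^sup>2 / (1 + b * u)" .
      moreover have "C * (b * u) \<le> C * (1 * u)"
        using C u b1'(1)[OF b] by (intro mult_left_mono mult_right_mono) auto
      moreover have "0 \<le> C + 2 / \<kappa>" using C kappa by simp
      ultimately show ?thesis by (simp add: algebra_simps)
    qed
    hence "exp (- \<kappa> * u\<^sup>2 / (1 + b * u) + C * (b * u)) \<le> exp ((C + 2 / \<kappa>) - 2 * u)" by simp
    thus ?thesis unfolding A_def exp_add exp_diff by (simp add: exp_minus exp_add field_simps)
  qed
  have A0: "A > 0" by (simp add: A_def)
  \<comment> \<open>The power 8 exceeds every degree in u that occurs below. The rate is c / 2
    because the other half of the Gaussian pays for exp U.\<close>
  define E where "E = (fact 8 * exp (1 + 9 / (4 * (c / 2))) :: real)"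
  have E0: "E > 0" by (simp add: E_def)
  have poly: "(1 + u) ^ 8 * exp (- (c / 2) * u\<^sup>2) \<le> E * exp (- 2 * u)" if "u \<ge> 0" for u :: real
    unfolding E_def using c that by (intro power_mult_gaussian_le) auto
  define G where "G b s = of_real (exp (- c * s\<^sup>2)) * (q0 + of_real b * (q1 * of_real s + q0 * \<beta> * of_real (s ^ 3)))" for b s :: real
  \<comment> \<open>M controls the comparison function G, K1 collects the four summands of W near
    the saddle, and K2 belongs to the tail.\<close>
  define M where "M = norm q0 + norm q1 + norm q0 * norm \<beta>"
  define K1 where "K1 = D\<^sup>2 * (C * exp C) + D * (norm q1 + C) + norm q0 * C + C"
  define K2 where "K2 = C * A + M * E"
  define K where "K = C * A + K1 * E + 2 / \<eta>\<^sup>2 * K2"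
  have nonneg: "M \<ge> 0" "K1 \<ge> 0" "K2 \<ge> 0"
    using C D0 A0 E0 by (auto simp: M_def K1_def K2_def)
  have G_bound: "norm (G b s) \<le> M * E * exp (- 2 * \<bar>s\<bar>)" if "0 < b" "b < b\<^sub>1" for b s
  proof -
    let ?u = "\<bar>s\<bar>"
    have pw: "?u ^ k \<le> (1 + ?u) ^ 8" if "k \<le> 8" for k
      using that by (intro order.trans[OF power_mono[of ?u "1 + ?u"] power_increasing[of _ 8 "1 + ?u"]]) auto
    have p8: "1 \<le> (1 + ?u) ^ 8" "?u ^ 1 \<le> (1 + ?u) ^ 8" "?u ^ 3 \<le> (1 + ?u) ^ 8"
      using pw[of 0] pw[of 1] pw[of 3] by auto
    have "norm (q0 + of_real b * (q1 * of_real s + q0 * \<beta> * of_real (s ^ 3)))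
        \<le> norm q0 + norm (of_real b * (q1 * of_real s + q0 * \<beta> * of_real (s ^ 3)))"
      by (rule norm_triangle_ineq)
    also have "\<dots> \<le> norm q0 + 1 * norm (q1 * of_real s + q0 * \<beta> * of_real (s ^ 3))"
      using b1'(1)[OF that] that unfolding norm_mult[of "of_real b"] by (intro add_left_mono mult_right_mono) auto
    also have "\<dots> \<le> norm q0 + (norm (q1 * of_real s) + norm (q0 * \<beta> * of_real (s ^ 3)))"
      by (simp add: norm_triangle_ineq)
    also have "\<dots> = norm q0 * 1 + norm q1 * ?u ^ 1 + norm q0 * norm \<beta> * ?u ^ 3"
      by (simp add: norm_mult norm_power power_abs)
    also have "\<dots> \<le> norm q0 * (1 + ?u) ^ 8 + norm q1 * (1 + ?u) ^ 8 + norm q0 * norm \<beta> * (1 + ?u) ^ 8"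
      using p8 by (intro add_mono mult_left_mono) auto
    also have "\<dots> = M * (1 + ?u) ^ 8" by (simp add: M_def algebra_simps)
    finally have *: "norm (q0 + of_real b * (q1 * of_real s + q0 * \<beta> * of_real (s ^ 3))) \<le> M * (1 + ?u) ^ 8" .
    have "exp (- c * s\<^sup>2) \<le> exp (- (c / 2) * ?u\<^sup>2)" using c by (simp add: field_simps)
    hence "norm (G b s) \<le> exp (- (c / 2) * ?u\<^sup>2) * (M * (1 + ?u) ^ 8)"
      unfolding G_def norm_mult norm_of_real abs_exp_cancel using * by (intro mult_mono) auto
    also have "\<dots> = M * ((1 + ?u) ^ 8 * exp (- (c / 2) * ?u\<^sup>2))" by (simp add: mult_ac)
    also have "\<dots> \<le> M * (E * exp (- 2 * ?u))" by (intro mult_left_mono poly nonneg) auto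
    finally show ?thesis by (simp add: mult_ac)
  qed
  have exp_p: "norm (exp (p (b * s) / of_real (b\<^sup>2))) \<le> exp (- \<kappa> * \<bar>s\<bar>\<^sup>2 / (1 + b * \<bar>s\<bar>))"
    if "0 < b" for b s
  proof -
    have "Re (p (b * s) / of_real (b\<^sup>2)) = Re (p (b * s)) / b\<^sup>2" by (simp add: Re_divide_of_real del: of_real_power)
    also have "\<dots> \<le> (- \<kappa> * (b * s)\<^sup>2 / (1 + \<bar>b * s\<bar>)) / b\<^sup>2"
      using p_Re[of "b * s"] by (intro divide_right_mono) auto
    also have "\<dots> = - \<kappa> * \<bar>s\<bar>\<^sup>2 / (1 + b * \<bar>s\<bar>)" using that by (simp add: power_mult_distrib abs_mult)
    finally show ?thesis by simp
  qed
  define F where "F b s = exp (p (b * s) / of_real (b\<^sup>2)) * r b (b * s)" for b s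
  define F0 where "F0 b s = exp (p (b * s) / of_real (b\<^sup>2)) * q (b * s)" for b s
  have F_F0: "norm (F b s - F0 b s) \<le> C * A * b\<^sup>2 * exp (- \<bar>s\<bar>)" if b: "0 < b" "b < b\<^sub>1" for b s
  proof -
    have "norm (F b s - F0 b s) = norm (exp (p (b * s) / of_real (b\<^sup>2))) * norm (r b (b * s) - q (b * s))"
      by (simp only: F_def F0_def norm_mult[symmetric] right_diff_distrib)
    also have "\<dots> \<le> exp (- \<kappa> * \<bar>s\<bar>\<^sup>2 / (1 + b * \<bar>s\<bar>)) * (C * b\<^sup>2 * exp (C * \<bar>b * s\<bar>))"
      using exp_p[OF b(1)] r_approx[OF b(1) b1'(2)[OF b]] by (intro mult_mono) auto
    also have "\<dots> = C * b\<^sup>2 * (exp (- \<kappa> * \<bar>s\<bar>\<^sup>2 / (1 + b * \<bar>s\<bar>)) * exp (C * (b * \<bar>s\<bar>)))"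
      using b by (simp add: abs_mult)
    also have "\<dots> \<le> C * b\<^sup>2 * (A * exp (- 2 * \<bar>s\<bar>))" using C by (intro mult_left_mono damp b) auto
    also have "\<dots> \<le> C * b\<^sup>2 * (A * exp (- \<bar>s\<bar>))" using C A0 by (intro mult_left_mono) auto
    finally show ?thesis by (simp add: mult_ac)
  qed
  have F0_G: "norm (F0 b s - G b s) \<le> (K1 * E + 2 / \<eta>\<^sup>2 * K2) * b\<^sup>2 * exp (- \<bar>s\<bar>)"
    if b: "0 < b" "b < b\<^sub>1" for b s
  proof (cases "\<bar>b * s\<bar> \<le> \<eta>")
    case True
    define u where "u = \<bar>s\<bar>"
    define t where "t = b * s"
    have u0: "u \<ge> 0" and t: "\<bar>t\<bar> = b * u" "t\<^sup>2 = b\<^sup>2 * u\<^sup>2" "t ^ 4 = b ^ 4 * u ^ 4" "b * u \<le> \<eta>"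
      using b True by (auto simp: u_def t_def abs_mult power_mult_distrib)
    have bu1: "b * u \<le> 1" using t eta by simp
    have tr: "\<bar>t\<bar> \<le> \<eta>\<^sub>0" using t eta by simp
    define U where "U = p t / of_real (b\<^sup>2) + of_real (c * s\<^sup>2)"
    define V where "V = U - of_real b * \<beta> * of_real (s ^ 3)"
    have V: "norm V \<le> C * b\<^sup>2 * u ^ 4"
    proof -
      have "V = (p t + of_real (c * t\<^sup>2) - \<beta> * of_real (t ^ 3)) / of_real (b\<^sup>2)"
        using b by (simp add: V_def U_def t_def field_simps power2_eq_square power3_eq_cube)
      hence "norm V = norm (p t + of_real (c * t\<^sup>2) - \<beta> * of_real (t ^ 3)) / b\<^sup>2"
        by (simp only: norm_divide norm_of_real) simp
      also have "\<dots> \<le> (C * t ^ 4) / b\<^sup>2" by (intro divide_right_mono p_Taylor tr) auto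
      also have "\<dots> = C * b\<^sup>2 * u ^ 4" using b unfolding t by (simp add: field_simps eval_nat_numeral)
      finally show ?thesis .
    qed
    have U1: "norm U \<le> D * (b * u ^ 3)"
    proof -
      have "norm U \<le> norm V + norm (of_real b * \<beta> * of_real (s ^ 3))"
        unfolding V_def by (metis norm_triangle_sub add.commute)
      also have "norm (of_real b * \<beta> * of_real (s ^ 3)) = norm \<beta> * (b * u ^ 3)"
        using b by (simp add: norm_mult norm_power u_def power_abs)
      also have "norm V \<le> C * (b * u) * (b * u ^ 3)" using V by (simp add: eval_nat_numeral mult_ac)
      also have "\<dots> \<le> C * 1 * (b * u ^ 3)" using bu1 C b u0 by (intro mult_right_mono mult_left_mono) auto
      finally show ?thesis by (simp add: D_def algebra_simps)
    qed
    have U2: "norm U \<le> c / 2 * u\<^sup>2"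
    proof -
      have "norm U \<le> (D * (b * u)) * u\<^sup>2" using U1 by (simp add: eval_nat_numeral mult_ac)
      also have "\<dots> \<le> (D * \<eta>) * u\<^sup>2" using t D0 by (intro mult_right_mono mult_left_mono) auto
      also have "\<dots> \<le> c / 2 * u\<^sup>2" using eta by (intro mult_right_mono) auto
      finally show ?thesis .
    qed
    define Q where "Q = q t - q0 - q1 * of_real t"
    have Q: "norm Q \<le> C * (b\<^sup>2 * u\<^sup>2)" using q_Taylor[OF tr] by (simp add: Q_def t)
    have q: "norm (q t) \<le> C * exp C"
    proof -
      have "norm (q t) \<le> C * exp (C * \<bar>t\<bar>)" by (rule q_bound)
      also have "\<dots> \<le> C * exp (C * 1)" using C bu1 t
        by (intro mult_left_mono) (simp_all only: exp_le_cancel_iff mult_left_mono)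
      finally show ?thesis by simp
    qed
    have q': "norm (q t - q0) \<le> (norm q1 + C) * (b * u)"
    proof -
      have "norm (q t - q0) \<le> norm (q1 * of_real t) + norm Q"
        unfolding Q_def using norm_triangle_sub[of "q t - q0" "q1 * of_real t"] by simp
      also have "\<dots> \<le> norm q1 * (b * u) + C * ((b * u) * (b * u))"
        using Q t by (intro add_mono) (auto simp: norm_mult power2_eq_square mult_ac)
      also have "\<dots> \<le> norm q1 * (b * u) + C * (1 * (b * u))"
        using bu1 C b u0 by (intro add_mono mult_left_mono mult_right_mono) auto
      finally show ?thesis by (simp add: algebra_simps)
    qed
    have expU: "norm (exp U - 1 - U) \<le> exp (c / 2 * u\<^sup>2) * (D\<^sup>2 * (b\<^sup>2 * u ^ 6))"
    proof -
      have "norm (exp U - 1 - U) \<le> exp (norm U) * (norm U)\<^sup>2"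
        using Taylor_exp_field[of U 1] by (simp add: diff_diff_eq power2_eq_square)
      also have "\<dots> \<le> exp (c / 2 * u\<^sup>2) * (D * (b * u ^ 3))\<^sup>2"
        using U1 U2 by (intro mult_mono power_mono) auto
      finally show ?thesis by (simp add: power_mult_distrib flip: power_mult)
    qed
    \<comment> \<open>The grouping makes every summand of order b^2: U and q t - q0 are of order b,
      and V and Q are what remains of U and q t after their terms up to first order.\<close>
    define W where "W = (exp U - 1 - U) * q t + U * (q t - q0) + q0 * V + Q"
    have "F0 b s - G b s = of_real (exp (- c * s\<^sup>2)) * W"
    proof -
      have "exp (p t / of_real (b\<^sup>2)) = of_real (exp (- c * s\<^sup>2)) * exp U"
        by (simp add: U_def exp_of_real[symmetric] exp_add[symmetric])
      thus ?thesis unfolding F0_def G_def W_def V_def Q_def t_def[symmetric]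
        by (simp add: algebra_simps t_def)
    qed
    hence "norm (F0 b s - G b s) = exp (- c * u\<^sup>2) * norm W" by (simp add: norm_mult u_def)
    also have "norm W \<le> K1 * b\<^sup>2 * ((1 + u) ^ 8 * exp (c / 2 * u\<^sup>2))"
    proof -
      let ?P = "(1 + u) ^ 8 * exp (c / 2 * u\<^sup>2)"
      have e1: "1 \<le> exp (c / 2 * u\<^sup>2)" using c by simp
      have pw: "u ^ k \<le> (1 + u) ^ 8" if "k \<le> 8" for k
        using u0 that by (intro order.trans[OF power_mono[of u "1 + u"] power_increasing[of _ 8 "1 + u"]]) auto
      have pw': "u ^ k \<le> ?P" if "k \<le> 8" for k
        using mult_mono[OF pw[OF that] e1] u0 by simp
      have "norm W \<le> norm (exp U - 1 - U) * norm (q t) + norm U * norm (q t - q0) + norm q0 * norm V + norm Q"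
        unfolding W_def by (intro order.trans[OF norm_triangle_ineq] add_mono) (auto simp: norm_mult)
      also have "\<dots> \<le> (exp (c / 2 * u\<^sup>2) * (D\<^sup>2 * (b\<^sup>2 * u ^ 6))) * (C * exp C)
          + (D * (b * u ^ 3)) * ((norm q1 + C) * (b * u)) + norm q0 * (C * b\<^sup>2 * u ^ 4) + C * (b\<^sup>2 * u\<^sup>2)"
        using expU q U1 q' V Q C D0 b u0 by (intro add_mono mult_mono) auto
      also have "\<dots> = (D\<^sup>2 * (C * exp C)) * b\<^sup>2 * (u ^ 6 * exp (c / 2 * u\<^sup>2))
          + (D * (norm q1 + C)) * b\<^sup>2 * u ^ 4 + (norm q0 * C) * b\<^sup>2 * u ^ 4 + C * b\<^sup>2 * u ^ 2"
        by (simp add: eval_nat_numeral mult_ac)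
      also have "\<dots> \<le> (D\<^sup>2 * (C * exp C)) * b\<^sup>2 * ?P
          + (D * (norm q1 + C)) * b\<^sup>2 * ?P + (norm q0 * C) * b\<^sup>2 * ?P + C * b\<^sup>2 * ?P"
        using pw pw' C D0 by (intro add_mono mult_left_mono mult_right_mono) auto
      also have "\<dots> = K1 * b\<^sup>2 * ?P" by (simp add: K1_def algebra_simps)
      finally show ?thesis .
    qed
    also have "exp (- c * u\<^sup>2) * (K1 * b\<^sup>2 * ((1 + u) ^ 8 * exp (c / 2 * u\<^sup>2)))
        = K1 * b\<^sup>2 * ((1 + u) ^ 8 * exp (- (c / 2) * u\<^sup>2))"
      by (simp add: exp_add[symmetric] mult_ac exp_minus field_simps)
    also have "\<dots> \<le> K1 * b\<^sup>2 * (E * exp (- 2 * u))" using nonneg u0 by (intro mult_left_mono poly) auto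
    also have "\<dots> \<le> K1 * b\<^sup>2 * (E * exp (- u))" using nonneg u0 E0 by (intro mult_left_mono) auto
    also have "\<dots> \<le> (K1 * E + 2 / \<eta>\<^sup>2 * K2) * b\<^sup>2 * exp (- u)"
      using nonneg by (simp add: algebra_simps)
    finally show ?thesis by (simp add: u_def)
  next
    case False
    define u where "u = \<bar>s\<bar>"
    have u: "u \<ge> 0" "\<eta> < b * u" using False b by (auto simp: u_def abs_mult)
    have "norm (F0 b s) \<le> exp (- \<kappa> * u\<^sup>2 / (1 + b * u)) * (C * exp (C * \<bar>b * s\<bar>))"
      unfolding F0_def norm_mult u_def using exp_p[OF b(1)] q_bound by (intro mult_mono) auto
    also have "\<dots> = C * (exp (- \<kappa> * u\<^sup>2 / (1 + b * u)) * exp (C * (b * u)))"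
      using b by (simp add: abs_mult u_def)
    also have "\<dots> \<le> C * (A * exp (- 2 * u))" using C by (intro mult_left_mono damp b u) auto
    finally have "norm (F0 b s - G b s) \<le> C * (A * exp (- 2 * u)) + M * E * exp (- 2 * u)"
      using G_bound[OF b, of s] norm_triangle_ineq4[of "F0 b s" "G b s"] by (simp add: u_def)
    also have "\<dots> = K2 * (exp (- 2 * u) * 1)" by (simp add: K2_def algebra_simps)
    \<comment> \<open>In the tail b u > \<eta>, so the factor (b u)^2 / \<eta>^2 \<ge> 1 may be
      inserted to produce b^2; half of the decay then pays for u^2.\<close>
    also have "\<dots> \<le> K2 * (exp (- 2 * u) * ((b * u)\<^sup>2 / \<eta>\<^sup>2))"
      using nonneg u eta power_mono[of \<eta> "b * u" 2] by (intro mult_left_mono) auto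
    also have "\<dots> = K2 / \<eta>\<^sup>2 * b\<^sup>2 * (exp (- 2 * u) * u\<^sup>2)" by (simp add: power_mult_distrib)
    also have "\<dots> \<le> K2 / \<eta>\<^sup>2 * b\<^sup>2 * (exp (- 2 * u) * (fact 2 * exp u))"
      using nonneg u by (intro mult_left_mono power_le_fact_exp) auto
    also have "\<dots> = 2 / \<eta>\<^sup>2 * K2 * b\<^sup>2 * exp (- u)"
    proof -
      have "exp (- 2 * u) * exp u = exp (- u)" by (subst exp_add[symmetric]) simp
      thus ?thesis by (simp add: mult_ac)
    qed
    also have "\<dots> \<le> (K1 * E + 2 / \<eta>\<^sup>2 * K2) * b\<^sup>2 * exp (- u)"
      using nonneg E0 by (intro mult_right_mono) auto
    finally show ?thesis by (simp add: u_def)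
  qed
  have F_G: "norm (F b s - G b s) \<le> K * b\<^sup>2 * exp (- 1 * \<bar>s\<bar>)" if b: "0 < b" "b < b\<^sub>1" for b s
  proof -
    have "norm (F b s - G b s) \<le> norm (F b s - F0 b s) + norm (F0 b s - G b s)"
      using norm_triangle_ineq[of "F b s - F0 b s" "F0 b s - G b s"] by simp
    also have "\<dots> \<le> C * A * b\<^sup>2 * exp (- \<bar>s\<bar>) + (K1 * E + 2 / \<eta>\<^sup>2 * K2) * b\<^sup>2 * exp (- \<bar>s\<bar>)"
      by (intro add_mono F_F0 F0_G b)
    also have "\<dots> = K * b\<^sup>2 * exp (- 1 * \<bar>s\<bar>)" by (simp add: K_def algebra_simps)
    finally show ?thesis .
  qed
  have G_meas: "G b \<in> borel_measurable borel" for b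
    unfolding G_def by (intro borel_measurable_continuous_onI continuous_intros)
  have G_int: "integrable lborel (G b)" if "0 < b" "b < b\<^sub>1" for b
    by (rule integrable_exp_decay[OF _ G_meas G_bound[OF that]]) auto
  have G_integral: "(LBINT s. G b s) = of_real (sqrt (pi / c)) * q0" if b: "0 < b" "b < b\<^sub>1" for b
  proof -
    \<comment> \<open>G1 is the even part of G; the difference is the odd term of order b.\<close>
    define G1 where "G1 s = of_real (exp (- c * s\<^sup>2)) * q0" for s :: real
    have i1: "integrable lborel G1" unfolding G1_def
      by (intro integrable_mult_left integrable_of_real lborel_gaussian_integral c)
    have i2: "integrable lborel (\<lambda>s. G b s - G1 s)"
      by (intro Bochner_Integration.integrable_diff G_int b i1)
    have "(LBINT s. G b s - G1 s) = 0"
      by (rule lborel_integral_odd) (simp add: G_def G1_def algebra_simps)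
    hence "(LBINT s. G b s) = (LBINT s. G1 s)"
      using Bochner_Integration.integral_diff[OF G_int[OF b] i1] by simp
    also have "\<dots> = of_real (LBINT s. exp (- c * s\<^sup>2)) * q0"
      unfolding G1_def by (subst integral_mult_left_zero) (simp only: integral_complex_of_real)
    finally show ?thesis using lborel_gaussian_integral(2)[OF c] by simp
  qed
  define I where "I = (LBINT s. exp (- 1 * \<bar>s::real\<bar>))"
  show ?thesis
  proof (rule exI[of _ "K * I"], rule exI[of _ b\<^sub>1], intro conjI allI impI b1)
    fix b assume "0 < b \<and> b < b\<^sub>1"
    hence b: "0 < b" "b < b\<^sub>1" by auto
    have F_meas: "F b \<in> borel_measurable borel"
      unfolding F_def using measurable_compose[OF _ meas[OF b(1) b1'(2)[OF b]], of "\<lambda>s. b * s" borel] by simp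
    have d: "integrable lborel (\<lambda>s. F b s - G b s)"
      by (rule integrable_exp_decay[OF _ _ F_G[OF b]]) (use F_meas G_meas in auto)
    \<comment> \<open>F inherits its integrability from G, through the decay of the
      difference.\<close>
    have "integrable lborel (\<lambda>s. (F b s - G b s) + G b s)"
      by (intro Bochner_Integration.integrable_add d G_int b)
    hence F_int: "integrable lborel (F b)" by simp
    have "(LBINT t. exp (p t / of_real (b\<^sup>2)) * r b t) = b *\<^sub>R (LBINT s. F b s)"
      unfolding F_def using lborel_integral_real_affine[of b _ 0] b by simp
    hence eq: "(LBINT t. exp (p t / of_real (b\<^sup>2)) * r b t) - of_real (b * sqrt (pi / c)) * q0
        = of_real b * (LBINT s. F b s - G b s)"
      using F_int G_int[OF b] G_integral[OF b] by (simp add: scaleR_conv_of_real algebra_simps)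
    have "norm (LBINT s. F b s - G b s) \<le> (LBINT s. K * b\<^sup>2 * exp (- 1 * \<bar>s\<bar>))"
    proof -
      have "integrable lborel (\<lambda>s. K * b\<^sup>2 * exp (- 1 * \<bar>s\<bar>))"
        by (intro integrable_mult_right integrable_exp_neg_abs) simp
      hence "(LBINT s. norm (F b s - G b s)) \<le> (LBINT s. K * b\<^sup>2 * exp (- 1 * \<bar>s\<bar>))"
        using d F_G[OF b] by (intro integral_mono) auto
      thus ?thesis using integral_norm_bound[of lborel "\<lambda>s. F b s - G b s"] by linarith
    qed
    also have "(LBINT s. K * b\<^sup>2 * exp (- 1 * \<bar>s\<bar>)) = K * b\<^sup>2 * I"
      unfolding I_def by (rule integral_mult_right_zero)
    finally have "b * norm (LBINT s. F b s - G b s) \<le> b * (K * b\<^sup>2 * I)"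
      using b by (intro mult_left_mono) auto
    thus "norm ((LBINT t. exp (p t / of_real (b\<^sup>2)) * r b t) - of_real (b * sqrt (pi / c)) * q0) \<le> K * I * b ^ 3"
      using b unfolding eq norm_mult by (simp add: eval_nat_numeral mult_ac)
  qed
qed

subsection \<open>Bounds for the hyperbolic sine\<close>

lemma sinh_Complex: "sinh (Complex t y) = Complex (sinh t * cos y) (cosh t * sin y)"
  by (simp add: sinh_field_def cosh_field_def complex_eq_iff Re_exp Im_exp diff_divide_distrib add_divide_distrib algebra_simps)

lemma norm_sinh_ge:
  fixes w :: complex
  shows "norm (sinh w) \<ge> exp \<bar>Re w\<bar> / 2 * \<bar>sin (Im w)\<bar>"
proof -
  have "exp \<bar>Re w\<bar> / 2 \<le> cosh (Re w)" by (auto simp: cosh_field_def abs_if)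
  hence "exp \<bar>Re w\<bar> / 2 * \<bar>sin (Im w)\<bar> \<le> \<bar>cosh (Re w) * sin (Im w)\<bar>"
    using mult_right_mono[of "exp \<bar>Re w\<bar> / 2" "cosh (Re w)" "\<bar>sin (Im w)\<bar>"] by (simp add: abs_mult)
  also have "\<dots> = \<bar>Im (sinh w)\<bar>" using sinh_Complex[of "Re w" "Im w"] by simp
  also have "\<dots> \<le> norm (sinh w)" by (rule abs_Im_le_cmod)
  finally show ?thesis .
qed

text \<open>Comparing |e^w| with |e^(-w)| asks for distance from the imaginary axis instead of the
  real one. The bound thus serves on rectangles meeting the real axis or the line Im w = pi, where
  \<open>norm_sinh_ge\<close> is void.\<close>

lemma norm_sinh_ge':
  fixes w :: complex
  assumes "r \<le> \<bar>Re w\<bar>"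
  shows "norm (sinh w) \<ge> exp \<bar>Re w\<bar> * ((1 - exp (- 2 * r)) / 2)"
proof -
  have "exp \<bar>Re w\<bar> * (1 - exp (- 2 * r)) \<le> exp \<bar>Re w\<bar> * (1 - exp (- 2 * \<bar>Re w\<bar>))"
    using assms by (intro mult_left_mono) auto
  also have "\<dots> = exp \<bar>Re w\<bar> - exp (- \<bar>Re w\<bar>)"
    by (simp add: right_diff_distrib exp_add[symmetric])
  also have "\<dots> = \<bar>norm (exp w) - norm (exp (-w))\<bar>" by (auto simp: abs_if)
  also have "\<dots> \<le> norm (exp w - exp (-w))" by (rule norm_triangle_ineq3)
  also have "\<dots> = 2 * norm (sinh w)" by (simp add: sinh_field_def norm_divide)
  finally show ?thesis by simp
qed

lemma sinh_nonzero:
  fixes w :: complex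
  assumes "\<bar>Im w\<bar> < pi" "w \<noteq> 0"
  shows "sinh w \<noteq> 0"
proof (cases "Re w = 0")
  case True
  hence "Im w \<noteq> 0" using assms by (auto simp: complex_eq_iff)
  hence "sin \<bar>Im w\<bar> > 0" using assms by (intro sin_gt_zero) auto
  hence "\<bar>sin (Im w)\<bar> > 0" by (auto simp: abs_if split: if_splits)
  hence "0 < exp \<bar>Re w\<bar> / 2 * \<bar>sin (Im w)\<bar>" by (intro mult_pos_pos) auto
  also have "\<dots> \<le> norm (sinh w)" by (rule norm_sinh_ge)
  finally show ?thesis by auto
next
  case False
  have "0 < exp \<bar>Re w\<bar> * ((1 - exp (- 2 * \<bar>Re w\<bar>)) / 2)" using False by simp
  also have "\<dots> \<le> norm (sinh w)" by (rule norm_sinh_ge') simp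
  finally show ?thesis by auto
qed

section \<open>The entire function sinh w / w\<close>

lemma holomorphic_on_sinh [holomorphic_intros]:
  "f holomorphic_on A \<Longrightarrow> (\<lambda>w. sinh (f w :: complex)) holomorphic_on A"
  unfolding sinh_field_def by (intro holomorphic_intros) auto

text \<open>Filling the removable singularity exhibits the kernel as a zero-free holomorphic
  function divided by a power of the variable, which makes its residue at the origin
  accessible.\<close>

definition sinhc :: "complex \<Rightarrow> complex" where
  "sinhc w = (if w = 0 then 1 else sinh w / w)"

lemma sinhc_holomorphic [holomorphic_intros]:
  assumes "f holomorphic_on A"
  shows "(\<lambda>w. sinhc (f w)) holomorphic_on A"
proof -
  have "deriv sinh (0::complex) = 1" by (rule DERIV_imp_deriv) (auto intro!: derivative_eq_intros)
  hence "sinhc = (\<lambda>z. if z = 0 then deriv sinh 0 else (sinh z - sinh 0) / (z - 0))"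
    by (auto simp: sinhc_def fun_eq_iff)
  moreover have "\<dots> holomorphic_on UNIV"
    by (rule pole_lemma_open) (auto intro!: holomorphic_intros)
  ultimately have "sinhc holomorphic_on UNIV" by simp
  from holomorphic_on_compose_gen[OF assms this] show ?thesis by (simp add: o_def)
qed

lemma sinhc_minus [simp]: "sinhc (- w) = sinhc w" by (simp add: sinhc_def)

lemma sinhc_nonzero: "\<bar>Im w\<bar> < pi \<Longrightarrow> sinhc w \<noteq> 0"
  using sinh_nonzero[of w] by (auto simp: sinhc_def)

lemma sinh_eq_sinhc: "sinh w = w * sinhc w" by (simp add: sinhc_def)

subsection \<open>Fourier-type integrals along horizontal lines\<close>

text \<open>M may blow up as \<epsilon> tends to 0, since the kernels are singular at the origin.
  Height 2 stays below the poles at i pi, and heights up to 1 leave a margin for contour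
  shifts.\<close>

definition strip_decay :: "(complex \<Rightarrow> complex) \<Rightarrow> real \<Rightarrow> bool" where
  "strip_decay k \<rho> \<longleftrightarrow> k holomorphic_on {w. 0 < Im w \<and> Im w < 2} \<and>
     (\<forall>\<epsilon>>0. \<exists>M. \<forall>t y. \<epsilon> \<le> y \<and> y \<le> 1 \<longrightarrow> norm (k (Complex t y)) \<le> M * exp (- \<rho> * \<bar>t\<bar>))"

text \<open>Height 1 is a normalisation; \<open>line_transform_height\<close> admits every height in
  (0, 1].\<close>

definition line_transform :: "(complex \<Rightarrow> complex) \<Rightarrow> complex \<Rightarrow> complex" where
  "line_transform k z = (LBINT t. exp (- \<i> * z * Complex t 1 / of_real pi) * k (Complex t 1))"

lemma norm_kernel_exp: "norm (exp (- \<i> * z * Complex t y / of_real pi)) = exp ((Re z * y + Im z * t) / pi)"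
proof -
  have "Re (- \<i> * z * Complex t y / of_real pi) = (Re z * y + Im z * t) / pi"
    by (subst Re_divide_of_real) (simp add: algebra_simps)
  thus ?thesis by simp
qed

lemma kernel_exp_le:
  assumes "norm a \<le> M * exp (- \<rho> * \<bar>t\<bar>)" "\<bar>Im z\<bar> \<le> v" "Re z * y \<le> u"
  shows "norm (exp (- \<i> * z * Complex t y / of_real pi) * a) \<le> M * exp (u / pi) * exp (- (\<rho> - v / pi) * \<bar>t\<bar>)"
proof -
  have "Im z * t \<le> v * \<bar>t\<bar>"
    using abs_ge_self[of "Im z * t"] mult_right_mono[OF assms(2), of "\<bar>t\<bar>"] by (simp add: abs_mult)
  hence "norm (exp (- \<i> * z * Complex t y / of_real pi)) \<le> exp ((u + v * \<bar>t\<bar>) / pi)"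
    unfolding norm_kernel_exp using assms by (simp add: divide_right_mono)
  hence "norm (exp (- \<i> * z * Complex t y / of_real pi) * a) \<le> exp ((u + v * \<bar>t\<bar>) / pi) * (M * exp (- \<rho> * \<bar>t\<bar>))"
    unfolding norm_mult using assms by (intro mult_mono) auto
  also have "\<dots> = M * (exp ((u + v * \<bar>t\<bar>) / pi) * exp (- \<rho> * \<bar>t\<bar>))" by simp
  also have "exp ((u + v * \<bar>t\<bar>) / pi) * exp (- \<rho> * \<bar>t\<bar>) = exp (u / pi) * exp (- (\<rho> - v / pi) * \<bar>t\<bar>)"
    unfolding exp_add[symmetric] by (rule arg_cong[where f = exp]) (simp add: field_simps)
  finally show ?thesis by (simp only: mult.assoc)
qed

text \<open>No singularity lies between the heights. Both y and 1 are compared with y / 2, because a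
  contour shift wants two different heights and y = 1 is allowed.\<close>

lemma line_transform_height:
  assumes k: "strip_decay k \<rho>" and z: "\<bar>Im z\<bar> < pi * \<rho>" and y: "0 < y" "y \<le> 1"
  shows "integrable lborel (\<lambda>t. exp (- \<i> * z * Complex t y / of_real pi) * k (Complex t y))"
    and "(LBINT t. exp (- \<i> * z * Complex t y / of_real pi) * k (Complex t y)) = line_transform k z"
proof -
  define f where "f w = exp (- \<i> * z * w / of_real pi) * k w" for w
  have hk: "k holomorphic_on {w. 0 < Im w \<and> Im w < 2}" using k by (simp add: strip_decay_def)
  obtain M where M: "\<And>t y'. y / 2 \<le> y' \<Longrightarrow> y' \<le> 1 \<Longrightarrow> norm (k (Complex t y')) \<le> M * exp (- \<rho> * \<bar>t\<bar>)"
    using k y unfolding strip_decay_def by (metis half_gt_zero)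
  have bd: "norm (f (Complex t y')) \<le> M * exp (\<bar>Re z\<bar> / pi) * exp (- (\<rho> - \<bar>Im z\<bar> / pi) * \<bar>t\<bar>)"
    if "y / 2 \<le> y'" "y' \<le> 1" for t y'
  proof -
    have "Re z * y' \<le> \<bar>Re z\<bar> * y'" using that y by (intro mult_right_mono) auto
    also have "\<dots> \<le> \<bar>Re z\<bar> * 1" using that by (intro mult_left_mono) auto
    finally show ?thesis unfolding f_def using M[OF that] by (intro kernel_exp_le) auto
  qed
  have kap: "0 < \<rho> - \<bar>Im z\<bar> / pi" using z by (simp add: field_simps)
  have hf: "f holomorphic_on ({w. 0 < Im w \<and> Im w < 2} - {})"
    unfolding f_def using hk by (auto intro!: holomorphic_intros)
  have 1: "integrable lborel (\<lambda>t. f (Complex t (y/2)))" "integrable lborel (\<lambda>t. f (Complex t 1))"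
     "(LBINT t. f (Complex t (y/2))) = (LBINT t. f (Complex t 1))"
    using strip_contour_shift[of 0 "y/2" 1 2, OF _ _ _ kap _ _ hf bd] y by simp_all
  show "integrable lborel (\<lambda>t. exp (- \<i> * z * Complex t y / of_real pi) * k (Complex t y))"
    using strip_contour_shift(2)[of 0 "y/2" y 2, OF _ _ _ kap _ _ hf bd] y by (simp add: f_def)
  have "(LBINT t. f (Complex t (y/2))) = (LBINT t. f (Complex t y))"
    using strip_contour_shift(3)[of 0 "y/2" y 2, OF _ _ _ kap _ _ hf bd] y by simp
  thus "(LBINT t. exp (- \<i> * z * Complex t y / of_real pi) * k (Complex t y)) = line_transform k z"
    using 1 by (simp add: f_def line_transform_def)
qed

text \<open>The factor exp (Re z / pi) makes this a decay estimate for negative Re z. On the right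
  it grows, and for \<open>faddeev_log\<close> the inversion relation takes over.\<close>

lemma line_transform_bound:
  assumes k: "strip_decay k \<rho>" and v: "v < pi * \<rho>"
  shows "\<exists>B\<ge>0. \<forall>z. \<bar>Im z\<bar> \<le> v \<longrightarrow> norm (line_transform k z) \<le> B * exp (Re z / pi)"
proof -
  obtain M where M: "\<And>t. norm (k (Complex t 1)) \<le> M * exp (- \<rho> * \<bar>t\<bar>)"
    using k unfolding strip_decay_def by (metis order_refl zero_less_one)
  have M0: "M \<ge> 0" using order.trans[OF norm_ge_zero M[of 0]] by simp
  define \<kappa> where "\<kappa> = \<rho> - v / pi"
  have kap: "\<kappa> > 0" using v by (simp add: \<kappa>_def field_simps)
  define I where "I = (LBINT t. exp (- \<kappa> * \<bar>t::real\<bar>))"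
  have I: "I \<ge> 0" unfolding I_def by (rule Bochner_Integration.integral_nonneg) simp
  show ?thesis
  proof (intro exI[of _ "M * I"] conjI allI impI)
    show "0 \<le> M * I" using M0 I by simp
    fix z assume z: "\<bar>Im z\<bar> \<le> v"
    hence z': "\<bar>Im z\<bar> < pi * \<rho>" using v by simp
    let ?f = "\<lambda>t. exp (- \<i> * z * Complex t 1 / of_real pi) * k (Complex t 1)"
    have "norm (line_transform k z) \<le> (LBINT t. norm (?f t))"
      unfolding line_transform_def by (rule integral_norm_bound)
    also have "\<dots> \<le> (LBINT t. M * exp (Re z / pi) * exp (- \<kappa> * \<bar>t\<bar>))"
    proof (rule integral_mono)
      show "integrable lborel (\<lambda>t. norm (?f t))"
        using line_transform_height(1)[OF k z', of 1] by simp
      show "integrable lborel (\<lambda>t. M * exp (Re z / pi) * exp (- \<kappa> * \<bar>t\<bar>))"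
        by (intro integrable_mult_right integrable_exp_neg_abs kap)
      show "norm (?f t) \<le> M * exp (Re z / pi) * exp (- \<kappa> * \<bar>t\<bar>)" for t
        unfolding \<kappa>_def by (rule kernel_exp_le[OF M z]) simp
    qed
    also have "\<dots> = M * exp (Re z / pi) * I" unfolding I_def by (rule integral_mult_right_zero)
    finally show "norm (line_transform k z) \<le> M * I * exp (Re z / pi)" by (simp add: mult_ac)
  qed
qed

lemma line_transform_derivative:
  assumes k: "strip_decay k \<rho>" and z: "\<bar>Im z\<bar> < pi * \<rho>"
  shows "(line_transform k has_field_derivative line_transform (\<lambda>w. - \<i> * w / of_real pi * k w) z) (at z)"
proof -
  obtain M where M: "\<And>t. norm (k (Complex t 1)) \<le> M * exp (- \<rho> * \<bar>t\<bar>)"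
    using k unfolding strip_decay_def by (metis order_refl zero_less_one)
  have hk: "k holomorphic_on {w. 0 < Im w \<and> Im w < 2}" using k by (simp add: strip_decay_def)
  define v where "v = (\<bar>Im z\<bar> + pi * \<rho>) / 2"
  have v: "\<bar>Im z\<bar> < v" "v < pi * \<rho>" using z by (auto simp: v_def)
  have kap: "0 < \<rho> - v / pi" using v by (simp add: field_simps)
  \<comment> \<open>The cut at Re z + 1 keeps exp (Re w / pi) bounded on S, as the dominating
    function requires.\<close>
  define S where "S = {w. \<bar>Im w\<bar> < v \<and> Re w < Re z + 1}"
  have "((\<lambda>w. LBINT t. exp (- \<i> * w * Complex t 1 / of_real pi) * k (Complex t 1)) has_field_derivative
     (LBINT t. deriv (\<lambda>w. exp (- \<i> * w * Complex t 1 / of_real pi) * k (Complex t 1)) z)) (at z)"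
  proof (rule has_field_derivative_lborel_integral[where S = S])
    show "open S" unfolding S_def by (intro open_Collect_conj open_Collect_less continuous_intros)
    show "z \<in> S" using v by (auto simp: S_def)
    show "(\<lambda>w. exp (- \<i> * w * Complex t 1 / of_real pi) * k (Complex t 1)) holomorphic_on S" for t
      by (intro holomorphic_intros) auto
    have "continuous_on UNIV (\<lambda>t. k (Complex t 1))"
      by (rule continuous_on_compose2[OF holomorphic_on_imp_continuous_on[OF hk]])
         (auto simp: Complex_eq intro!: continuous_intros)
    thus "(\<lambda>t. exp (- \<i> * w * Complex t 1 / of_real pi) * k (Complex t 1)) \<in> borel_measurable borel" for w
      by (intro borel_measurable_continuous_onI) (auto simp: Complex_eq intro!: continuous_intros)
    show "integrable lborel (\<lambda>t. M * exp ((Re z + 1) / pi) * exp (- (\<rho> - v / pi) * \<bar>t\<bar>))"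
      by (intro integrable_mult_right integrable_exp_neg_abs kap)
    fix w t assume "w \<in> S"
    thus "norm (exp (- \<i> * w * Complex t 1 / of_real pi) * k (Complex t 1))
        \<le> M * exp ((Re z + 1) / pi) * exp (- (\<rho> - v / pi) * \<bar>t\<bar>)"
      by (intro kernel_exp_le[OF M]) (auto simp: S_def)
  qed
  moreover have "deriv (\<lambda>w. exp (- \<i> * w * Complex t 1 / of_real pi) * k (Complex t 1)) z =
      exp (- \<i> * z * Complex t 1 / of_real pi) * (- \<i> * Complex t 1 / of_real pi * k (Complex t 1))" for t
    by (rule DERIV_imp_deriv) (auto intro!: derivative_eq_intros)
  ultimately show ?thesis by (simp add: line_transform_def[abs_def])
qed

lemma line_transform_holomorphic:
  assumes "strip_decay k \<rho>"
  shows "line_transform k holomorphic_on {z. \<bar>Im z\<bar> < pi * \<rho>}"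
proof -
  have "open {z. \<bar>Im z\<bar> < pi * \<rho>}"
    by (intro open_Collect_less continuous_intros)
  thus ?thesis using line_transform_derivative[OF assms] by (auto simp: holomorphic_on_open)
qed

subsection \<open>The logarithm of the quantum dilogarithm\<close>

definition faddeev_kernel :: "real \<Rightarrow> complex \<Rightarrow> complex" where
  "faddeev_kernel b y = 1 / (4 * sinh (of_real (b\<^sup>2) * y) * sinh y * y)"

definition faddeev_log :: "real \<Rightarrow> complex \<Rightarrow> complex" where
  "faddeev_log b = line_transform (faddeev_kernel b)"

lemma faddeev_kernel_minus: "faddeev_kernel b (- y) = - faddeev_kernel b y"
  by (simp add: faddeev_kernel_def)

lemma norm_faddeev_kernel_le:
  assumes "norm (sinh (of_real (b\<^sup>2) * w)) \<ge> exp (b\<^sup>2 * \<bar>Re w\<bar>) * p" "norm (sinh w) \<ge> exp \<bar>Re w\<bar> * q"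
     "norm w \<ge> r" "p > 0" "q > 0" "r > 0"
  shows "norm (faddeev_kernel b w) \<le> 1 / (4 * p * q * r) * exp (- (1 + b\<^sup>2) * \<bar>Re w\<bar>)"
proof -
  have pos: "norm (sinh (of_real (b\<^sup>2) * w)) > 0" "norm (sinh w) > 0" "norm w > 0"
    using less_le_trans[OF mult_pos_pos[OF exp_gt_zero assms(4)] assms(1)]
      less_le_trans[OF mult_pos_pos[OF exp_gt_zero assms(5)] assms(2)] less_le_trans[OF assms(6,3)] by auto
  have "norm (faddeev_kernel b w) = 1 / (4 * norm (sinh (of_real (b\<^sup>2) * w)) * norm (sinh w) * norm w)"
    by (simp add: faddeev_kernel_def norm_divide norm_mult)
  also have "\<dots> \<le> 1 / (4 * (exp (b\<^sup>2 * \<bar>Re w\<bar>) * p) * (exp \<bar>Re w\<bar> * q) * r)"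
    using assms pos by (intro divide_left_mono mult_mono mult_pos_pos) (auto simp del: of_real_power zero_less_norm_iff)
  also have "\<dots> = 1 / (4 * p * q * r) * (1 / (exp (b\<^sup>2 * \<bar>Re w\<bar>) * exp \<bar>Re w\<bar>))" by simp
  also have "1 / (exp (b\<^sup>2 * \<bar>Re w\<bar>) * exp \<bar>Re w\<bar>) = exp (- (1 + b\<^sup>2) * \<bar>Re w\<bar>)"
    unfolding exp_add[symmetric] inverse_eq_divide[symmetric] exp_minus[symmetric] by (simp add: algebra_simps)
  finally show ?thesis .
qed

text \<open>Serves both factors of the kernel, a = b^2 and a = 1; the product a Im w stays in
  [0, 1], where the sine increases.\<close>

lemma norm_sinh_scaled_ge:
  fixes w :: complex and a :: real
  assumes "0 < a" "a \<le> 1" "0 < \<epsilon>" "\<epsilon> \<le> Im w" "Im w \<le> 1"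
  shows "norm (sinh (of_real a * w)) \<ge> exp (a * \<bar>Re w\<bar>) * (sin (a * \<epsilon>) / 2)" "sin (a * \<epsilon>) > 0"
proof -
  have le: "a * \<epsilon> \<le> a * Im w" "a * Im w \<le> 1" "0 < a * \<epsilon>"
    using assms mult_mono[of a 1 "Im w" 1] by (auto intro: mult_left_mono)
  have "sin (a * \<epsilon>) \<le> sin (a * Im w)"
    using le pi_gt3 by (intro sin_monotone_2pi_le) auto
  moreover show "sin (a * \<epsilon>) > 0" using le pi_gt3 by (intro sin_gt_zero) auto
  ultimately have "exp (a * \<bar>Re w\<bar>) * (sin (a * \<epsilon>) / 2) \<le> exp \<bar>Re (of_real a * w)\<bar> / 2 * \<bar>sin (Im (of_real a * w))\<bar>"
    using assms by (simp add: abs_mult)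
  also have "\<dots> \<le> norm (sinh (of_real a * w))" by (rule norm_sinh_ge)
  finally show "norm (sinh (of_real a * w)) \<ge> exp (a * \<bar>Re w\<bar>) * (sin (a * \<epsilon>) / 2)" .
qed

lemma faddeev_kernel_holomorphic:
  assumes "0 < b" "b < 1" "A \<subseteq> {w. \<bar>Im w\<bar> < pi} - {0}"
  shows "faddeev_kernel b holomorphic_on A"
proof -
  have "sinh (of_real (b\<^sup>2) * w) \<noteq> 0" "sinh w \<noteq> 0" "w \<noteq> 0" if "w \<in> A" for w
  proof -
    have w: "\<bar>Im w\<bar> < pi" "w \<noteq> 0" using assms that by auto
    have "b\<^sup>2 * \<bar>Im w\<bar> \<le> 1 * \<bar>Im w\<bar>"
      using assms by (intro mult_right_mono) (auto simp: power_le_one)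
    thus "sinh (of_real (b\<^sup>2) * w) \<noteq> 0"
      using w assms by (intro sinh_nonzero) (auto simp: abs_mult simp del: of_real_power)
    show "sinh w \<noteq> 0" "w \<noteq> 0" using w sinh_nonzero[OF w] by auto
  qed
  thus ?thesis unfolding faddeev_kernel_def by (intro holomorphic_intros) auto
qed

text \<open>The rates 1 and b^2 of the two hyperbolic sines add up. Since pi (1 + b^2) is 2 pi b
  times |Im c_b|, the strip of the transform is exactly that of the integral formula for
  Phi_b.\<close>

lemma strip_decay_faddeev_kernel:
  assumes b: "0 < b" "b < 1"
  shows "strip_decay (faddeev_kernel b) (1 + b\<^sup>2)"
  unfolding strip_decay_def
proof (intro conjI allI impI)
  show "faddeev_kernel b holomorphic_on {w. 0 < Im w \<and> Im w < 2}"
    using pi_gt3 by (intro faddeev_kernel_holomorphic b) auto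
  fix \<epsilon> :: real assume e: "\<epsilon> > 0"
  have b2: "0 < b\<^sup>2" "b\<^sup>2 \<le> 1" using b by (auto simp: power_le_one)
  show "\<exists>M. \<forall>t y. \<epsilon> \<le> y \<and> y \<le> 1 \<longrightarrow> norm (faddeev_kernel b (Complex t y)) \<le> M * exp (- (1 + b\<^sup>2) * \<bar>t\<bar>)"
  proof (intro exI allI impI, elim conjE)
    fix t y assume y: "\<epsilon> \<le> y" "y \<le> 1"
    have "norm (faddeev_kernel b (Complex t y)) \<le> 1 / (4 * (sin (b\<^sup>2 * \<epsilon>) / 2) * (sin (1 * \<epsilon>) / 2) * \<epsilon>)
          * exp (- (1 + b\<^sup>2) * \<bar>Re (Complex t y)\<bar>)"
    proof (rule norm_faddeev_kernel_le)
      show "\<epsilon> \<le> norm (Complex t y)" using abs_Im_le_cmod[of "Complex t y"] y by simp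
    qed (use norm_sinh_scaled_ge[OF b2 e, of "Complex t y"] norm_sinh_scaled_ge[of 1 \<epsilon> "Complex t y"] e y in auto)
    thus "norm (faddeev_kernel b (Complex t y)) \<le> 1 / (4 * (sin (b\<^sup>2 * \<epsilon>) / 2) * (sin (1 * \<epsilon>) / 2) * \<epsilon>)
          * exp (- (1 + b\<^sup>2) * \<bar>t\<bar>)" by simp
  qed
qed

text \<open>After w = b y the height \<epsilon> becomes \<epsilon> / b, which is below 1 for
  \<epsilon> < b; there the integral does not depend on \<epsilon>, and the limit is that of an
  eventually constant function.\<close>

lemma faddeev_integral_eq:
  assumes b: "0 < b" "b < 1" and z: "\<bar>Im z\<bar> < pi * (1 + b\<^sup>2)"
  shows "faddeev_integral b (z / of_real (2 * pi * b)) = faddeev_log b z"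
proof -
  define f where "f \<epsilon> t = (let w = of_real t + \<i> * of_real \<epsilon>
        in exp (- 2 * \<i> * (z / of_real (2 * pi * b)) * w) / (4 * sinh (w * of_real b) * sinh (w / of_real b) * w))" for \<epsilon> t :: real
  have eq: "(LBINT t. f \<epsilon> t) = faddeev_log b z" if e: "0 < \<epsilon>" "\<epsilon> < b" for \<epsilon>
  proof -
    have "b *\<^sub>R f \<epsilon> (b * s) = exp (- \<i> * z * Complex s (\<epsilon> / b) / of_real pi) * faddeev_kernel b (Complex s (\<epsilon> / b))" for s
    proof -
      define y where "y = Complex s (\<epsilon> / b)"
      have w: "of_real (b * s) + \<i> * of_real \<epsilon> = of_real b * y"
        using b by (simp add: y_def Complex_eq algebra_simps)
      have y0: "y \<noteq> 0" using e b by (auto simp: y_def complex_eq_iff)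
      show ?thesis
        using b y0 unfolding f_def w Let_def y_def[symmetric] faddeev_kernel_def
        by (simp add: scaleR_conv_of_real power2_eq_square mult_ac)
    qed
    hence "b *\<^sub>R (LBINT s. f \<epsilon> (b * s)) =
       (LBINT s. exp (- \<i> * z * Complex s (\<epsilon> / b) / of_real pi) * faddeev_kernel b (Complex s (\<epsilon> / b)))"
      by (simp flip: integral_scaleR_right)
    also have "\<dots> = faddeev_log b z"
      unfolding faddeev_log_def using e b z
      by (intro line_transform_height(2)[OF strip_decay_faddeev_kernel[OF b]]) auto
    finally show ?thesis
      using lborel_integral_real_affine[of b "f \<epsilon>" 0] b by simp
  qed
  have "((\<lambda>\<epsilon>. LBINT t. f \<epsilon> t) \<longlongrightarrow> faddeev_log b z) (at_right 0)"
    by (rule tendsto_eventually) (use eq b in \<open>auto simp: eventually_at_right_field\<close>)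
  thus ?thesis unfolding faddeev_integral_def f_def[symmetric]
    by (intro tendsto_Lim) auto
qed

lemma faddeev_dilog_eq:
  assumes b: "0 < b" "b < 1" and z: "\<bar>Im z\<bar> < pi * (1 + b\<^sup>2)"
  shows "faddeev_dilog b (z / of_real (2 * pi * b)) = exp (faddeev_log b z)"
proof -
  have "\<bar>Im (z / of_real (2 * pi * b))\<bar> = \<bar>Im z\<bar> / (2 * pi * b)"
    using b by (subst Im_divide_of_real) (simp add: abs_mult)
  also have "\<dots> < pi * (1 + b\<^sup>2) / (2 * pi * b)" using z b by (intro divide_strict_right_mono) auto
  also have "\<dots> = \<bar>Im (c_b b)\<bar>" using b by (simp add: c_b_def field_simps power2_eq_square)
  finally show ?thesis using faddeev_integral_eq[OF assms] by (simp add: faddeev_dilog_def)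
qed

lemma faddeev_log_holomorphic:
  assumes "0 < b" "b < 1"
  shows "faddeev_log b holomorphic_on {z. \<bar>Im z\<bar> < pi * (1 + b\<^sup>2)}"
  unfolding faddeev_log_def by (rule line_transform_holomorphic[OF strip_decay_faddeev_kernel[OF assms]])

section \<open>Inversion relation and growth of the quantum dilogarithm\<close>

lemma deriv_even_0:
  fixes m :: "complex \<Rightarrow> complex"
  assumes "m field_differentiable at 0" "\<And>y. m (- y) = m y"
  shows "deriv m 0 = 0"
proof -
  have d: "(m has_field_derivative deriv m 0) (at 0)"
    using assms(1) by (simp add: field_differentiable_derivI)
  have "((\<lambda>y. m (- y)) has_field_derivative deriv m 0 * (- 1)) (at 0)"
    by (rule DERIV_chain2[where f = m]) (use d in \<open>auto intro!: derivative_eq_intros\<close>)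
  hence "(m has_field_derivative - deriv m 0) (at 0)" by (simp add: assms(2))
  from DERIV_unique[OF d this] show ?thesis by simp
qed

text \<open>Moving the contour across the triple pole at the origin turns \<open>\<real> + i\<close> into \<open>\<real> - i\<close>.\<close>

lemma faddeev_log_inversion:
  assumes b: "0 < b" "b < 1"
  shows "\<exists>c. \<forall>z. \<bar>Im z\<bar> < pi * (1 + b\<^sup>2) \<longrightarrow>
           faddeev_log b z + faddeev_log b (- z) = \<i> * z\<^sup>2 / of_real (4 * pi * b\<^sup>2) + c"
proof -
  have b2: "0 < b\<^sup>2" "b\<^sup>2 \<le> 1" using b by (auto simp: power_le_one)
  \<comment> \<open>m is y^3 times the kernel, even and holomorphic for |Im y| < pi. This makes the
    triple pole explicit, and m'(0) = 0 removes the term linear in z from the residue.\<close>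
  define m where "m y = 1 / (4 * of_real (b\<^sup>2) * sinhc (of_real (b\<^sup>2) * y) * sinhc y)" for y
  define U where "U = {w::complex. \<bar>Im w\<bar> < pi}"
  have U: "open U" "0 \<in> U" unfolding U_def by (intro open_Collect_less continuous_intros) auto
  have m_holo: "m holomorphic_on U"
    unfolding m_def
  proof (intro holomorphic_intros)
    fix w assume w: "w \<in> U"
    have "b\<^sup>2 * \<bar>Im w\<bar> \<le> 1 * \<bar>Im w\<bar>" using b2 by (intro mult_right_mono) auto
    hence "sinhc (of_real (b\<^sup>2) * w) \<noteq> 0"
      using w b by (intro sinhc_nonzero) (auto simp: U_def abs_mult simp del: of_real_power)
    moreover have "sinhc w \<noteq> 0" using w by (intro sinhc_nonzero) (auto simp: U_def)
    ultimately show "4 * of_real (b\<^sup>2) * sinhc (of_real (b\<^sup>2) * w) * sinhc w \<noteq> 0" using b by simp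
  qed
  have m'0: "deriv m 0 = 0"
    using U m_holo by (intro deriv_even_0) (auto simp: m_def holomorphic_on_imp_differentiable_at)
  have m0: "m 0 = 1 / of_real (4 * b\<^sup>2)" by (simp add: m_def sinhc_def)
  have km: "faddeev_kernel b y = m y / y ^ 3" for y
    unfolding faddeev_kernel_def m_def sinh_eq_sinhc[of y] sinh_eq_sinhc[of "of_real (b\<^sup>2) * y"]
    by (simp add: eval_nat_numeral mult_ac)
  \<comment> \<open>The part of the residue that stems from the second derivative of m; the growth
    estimate uses only that it does not depend on z.\<close>
  define c where "c = - \<i> * of_real pi * deriv (deriv m) 0"
  show ?thesis
  proof (intro exI[of _ c] allI impI)
    fix z assume z: "\<bar>Im z\<bar> < pi * (1 + b\<^sup>2)"
    define a where "a = - \<i> * z / of_real pi"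
    define f where "f y = exp (- \<i> * z * y / of_real pi) * faddeev_kernel b y" for y
    define g where "g y = exp (a * y) * m y" for y
    have g_holo: "g holomorphic_on U" unfolding g_def by (intro holomorphic_intros m_holo)
    have fg: "f y = g y / y ^ Suc 2" for y
      unfolding f_def g_def km by (simp add: a_def eval_nat_numeral)
    have mD: "(m has_field_derivative deriv m w) (at w)" if "w \<in> U" for w
      using m_holo U that by (intro holomorphic_derivI) auto
    have m'D: "(deriv m has_field_derivative deriv (deriv m) w) (at w)" if "w \<in> U" for w
      using holomorphic_deriv[OF m_holo U(1)] U that by (intro holomorphic_derivI) auto
    have g': "deriv g w = exp (a * w) * (a * m w + deriv m w)" if "w \<in> U" for w
      unfolding g_def by (rule DERIV_imp_deriv) (auto intro!: derivative_eq_intros mD that simp: algebra_simps)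
    have "deriv (deriv g) 0 = deriv (\<lambda>w. exp (a * w) * (a * m w + deriv m w)) 0"
      by (rule deriv_cong_ev) (use U g' in \<open>auto simp: eventually_nhds\<close>)
    also have "\<dots> = a\<^sup>2 * m 0 + deriv (deriv m) 0"
      by (rule DERIV_imp_deriv)
         (auto intro!: derivative_eq_intros mD m'D U simp: algebra_simps power2_eq_square m'0)
    finally have g'': "deriv (deriv g) 0 = a\<^sup>2 * m 0 + deriv (deriv m) 0" .
    have res: "residue f 0 = (a\<^sup>2 * m 0 + deriv (deriv m) 0) / 2"
      using residue_holomorphic_over_power'[OF U g_holo, of 2] g''
      unfolding fg[abs_def] by (simp add: eval_nat_numeral)
    define \<kappa> where "\<kappa> = (1 + b\<^sup>2) - \<bar>Im z\<bar> / pi"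
    have kap: "\<kappa> > 0" using z by (simp add: \<kappa>_def field_simps)
    define p q where "p = (1 - exp (- 2 * b\<^sup>2)) / 2" and "q = (1 - exp (- 2 * (1::real))) / 2"
    have pq: "p > 0" "q > 0" using b by (auto simp: p_def q_def)
    have bound: "norm (f (Complex t y)) \<le> (1 / (4 * p * q * 1) * exp (\<bar>Re z\<bar> / pi)) * exp (- \<kappa> * \<bar>t\<bar>)"
      if y: "-1 \<le> y" "y \<le> 1" and t: "\<bar>t\<bar> \<ge> 1" for t y
    proof -
      have "norm (faddeev_kernel b (Complex t y)) \<le> 1 / (4 * p * q * 1) * exp (- (1 + b\<^sup>2) * \<bar>Re (Complex t y)\<bar>)"
      proof (rule norm_faddeev_kernel_le)
        have "b\<^sup>2 * 1 \<le> b\<^sup>2 * \<bar>t\<bar>" using t by (intro mult_left_mono) auto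
        thus "exp (b\<^sup>2 * \<bar>Re (Complex t y)\<bar>) * p \<le> norm (sinh (of_real (b\<^sup>2) * Complex t y))"
          using norm_sinh_ge'[of "b\<^sup>2" "of_real (b\<^sup>2) * Complex t y"] unfolding p_def
          by (simp add: abs_mult del: of_real_power)
        show "exp \<bar>Re (Complex t y)\<bar> * q \<le> norm (sinh (Complex t y))"
          using norm_sinh_ge'[of 1 "Complex t y"] t unfolding q_def by simp
        show "1 \<le> norm (Complex t y)" using abs_Re_le_cmod[of "Complex t y"] t by simp
      qed (use pq in auto)
      hence "norm (faddeev_kernel b (Complex t y)) \<le> 1 / (4 * p * q * 1) * exp (- (1 + b\<^sup>2) * \<bar>t\<bar>)" by simp
      moreover have "Re z * y \<le> \<bar>Re z\<bar>"
      proof -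
        have "\<bar>Re z * y\<bar> \<le> \<bar>Re z\<bar> * 1" unfolding abs_mult using y by (intro mult_left_mono) auto
        thus ?thesis by simp
      qed
      ultimately show ?thesis unfolding f_def \<kappa>_def by (intro kernel_exp_le) auto
    qed
    have f_holo: "f holomorphic_on {w. -2 < Im w \<and> Im w < 2} - {0}"
      unfolding f_def using pi_gt3 by (intro holomorphic_intros faddeev_kernel_holomorphic b) auto
    have "(LBINT t. f (Complex t (-1))) - (LBINT t. f (Complex t 1)) = 2 * pi * \<i> * residue f 0"
      using strip_contour_shift(3)[of "-2" "-1" 1 2 \<kappa> "{0}" f, OF _ _ _ kap _ _ f_holo bound] by simp
    moreover have "(LBINT t. f (Complex t 1)) = faddeev_log b z"
      by (simp add: f_def faddeev_log_def line_transform_def)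
    moreover have "(LBINT t. f (Complex t (-1))) = - faddeev_log b (- z)"
    proof -
      \<comment> \<open>The reflection t -> - t maps the line at height -1 to minus the line at
        height 1; as the kernel is odd, the lower integral becomes
        \<open>- faddeev_log b (- z)\<close>.\<close>
      have c1: "Complex (- t) (- 1) = - Complex t 1" for t by (simp add: complex_eq_iff)
      have "(LBINT t. f (Complex t (-1))) = (LBINT t. f (Complex (- t) (-1)))"
        using lborel_integral_real_affine[of "-1" "\<lambda>t. f (Complex t (-1))" 0] by simp
      also have "\<dots> = (LBINT t. - (exp (- \<i> * (- z) * Complex t 1 / of_real pi) * faddeev_kernel b (Complex t 1)))"
        unfolding f_def c1 faddeev_kernel_minus by simp
      also have "\<dots> = - faddeev_log b (- z)" unfolding faddeev_log_def line_transform_def by simp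
      finally show ?thesis .
    qed
    ultimately have eq: "- faddeev_log b (- z) - faddeev_log b z = 2 * pi * \<i> * residue f 0" by simp
    have "faddeev_log b z + faddeev_log b (- z) = - (- faddeev_log b (- z) - faddeev_log b z)" by simp
    also have "\<dots> = - (2 * pi * \<i> * residue f 0)" unfolding eq ..
    also have "\<dots> = \<i> * z\<^sup>2 / of_real (4 * pi * b\<^sup>2) + c"
      unfolding res m0 a_def c_def using b by (simp add: field_simps power2_eq_square)
    finally show "faddeev_log b z + faddeev_log b (- z) = \<i> * z\<^sup>2 / of_real (4 * pi * b\<^sup>2) + c" .
  qed
qed

text \<open>For Re z \<le> 0 the transform is bounded. For Re z > 0 the inversion relation reflects
  to that case and contributes the real part - Re z Im z / (2 pi b^2) of its quadratic term;
  \<open>max (Re z) 0\<close> joins the two cases. The constant depends on b.\<close>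

lemma Re_faddeev_log_bound:
  assumes b: "0 < b" "b < 1" and v: "v < pi * (1 + b\<^sup>2)"
  shows "\<exists>C. \<forall>z. \<bar>Im z\<bar> \<le> v \<longrightarrow> \<bar>Re (faddeev_log b z) + max (Re z) 0 * Im z / (2 * pi * b\<^sup>2)\<bar> \<le> C"
proof -
  obtain B where B: "B \<ge> 0" "\<And>z. \<bar>Im z\<bar> \<le> v \<Longrightarrow> norm (faddeev_log b z) \<le> B * exp (Re z / pi)"
    using line_transform_bound[OF strip_decay_faddeev_kernel[OF b] v] unfolding faddeev_log_def by auto
  obtain c where c: "\<And>z. \<bar>Im z\<bar> < pi * (1 + b\<^sup>2) \<Longrightarrow>
       faddeev_log b z + faddeev_log b (- z) = \<i> * z\<^sup>2 / of_real (4 * pi * b\<^sup>2) + c"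
    using faddeev_log_inversion[OF b] by auto
  have neg: "\<bar>Re (faddeev_log b z)\<bar> \<le> B" if "\<bar>Im z\<bar> \<le> v" "Re z \<le> 0" for z
  proof -
    have "\<bar>Re (faddeev_log b z)\<bar> \<le> B * exp (Re z / pi)"
      using B(2)[OF that(1)] abs_Re_le_cmod[of "faddeev_log b z"] by linarith
    also have "\<dots> \<le> B * 1" using B that by (intro mult_left_mono) (auto simp: divide_le_0_iff)
    finally show ?thesis by simp
  qed
  show ?thesis
  proof (intro exI[of _ "B + norm c"] allI impI)
    fix z assume z: "\<bar>Im z\<bar> \<le> v"
    show "\<bar>Re (faddeev_log b z) + max (Re z) 0 * Im z / (2 * pi * b\<^sup>2)\<bar> \<le> B + norm c"
    proof (cases "Re z \<le> 0")
      case True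
      thus ?thesis using neg[OF z] by (simp add: max_def add_increasing2)
    next
      case False
      have "faddeev_log b z = \<i> * z\<^sup>2 / of_real (4 * pi * b\<^sup>2) + c - faddeev_log b (- z)"
        using c[of z] z v by (simp add: algebra_simps)
      moreover have "Re (\<i> * z\<^sup>2 / of_real (4 * pi * b\<^sup>2)) = - (Re z * Im z / (2 * pi * b\<^sup>2))"
        by (subst Re_divide_of_real) (simp add: power2_eq_square mult_ac)
      ultimately have "Re (faddeev_log b z) + max (Re z) 0 * Im z / (2 * pi * b\<^sup>2) = Re c - Re (faddeev_log b (- z))"
        using False by (simp add: max_def)
      thus ?thesis using neg[of "-z"] z False abs_Re_le_cmod[of c] by simp
    qed
  qed
qed

subsection \<open>The leading term\<close>

text \<open>For j = 2 this is b^2 times the kernel with sinh (b^2 y) replaced by b^2 y; smaller j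
  arise by differentiation in z.\<close>

definition pole_kernel :: "nat \<Rightarrow> complex \<Rightarrow> complex" where
  "pole_kernel j w = 1 / (4 * sinh w * w ^ j)"

lemma strip_decay_pole_kernel: "strip_decay (pole_kernel j) 1"
  unfolding strip_decay_def
proof (intro conjI allI impI)
  show "pole_kernel j holomorphic_on {w. 0 < Im w \<and> Im w < 2}"
    unfolding pole_kernel_def
  proof (intro holomorphic_intros)
    fix w :: complex assume "w \<in> {w. 0 < Im w \<and> Im w < 2}"
    thus "4 * sinh w * w ^ j \<noteq> 0" using pi_gt3 sinh_nonzero[of w] by (cases "w = 0") auto
  qed
  fix \<epsilon> :: real assume e: "\<epsilon> > 0"
  show "\<exists>M. \<forall>t y. \<epsilon> \<le> y \<and> y \<le> 1 \<longrightarrow> norm (pole_kernel j (Complex t y)) \<le> M * exp (- 1 * \<bar>t\<bar>)"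
  proof (intro exI allI impI, elim conjE)
    fix t y assume y: "\<epsilon> \<le> y" "y \<le> 1"
    define w where "w = Complex t y"
    have s: "norm (sinh w) \<ge> exp \<bar>t\<bar> * (sin \<epsilon> / 2)" "sin \<epsilon> > 0"
      using norm_sinh_scaled_ge[of 1 \<epsilon> w] e y by (auto simp: w_def)
    have w: "\<epsilon> \<le> norm w" using abs_Im_le_cmod[of w] y by (simp add: w_def)
    have pos: "norm (sinh w) > 0" "norm w > 0"
      using less_le_trans[OF mult_pos_pos[OF exp_gt_zero half_gt_zero[OF s(2)]] s(1)] w e by auto
    have "norm (pole_kernel j w) = 1 / (4 * norm (sinh w) * norm w ^ j)"
      by (simp add: pole_kernel_def norm_divide norm_mult norm_power)
    also have "\<dots> \<le> 1 / (4 * (exp \<bar>t\<bar> * (sin \<epsilon> / 2)) * \<epsilon> ^ j)"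
      using s w e pos by (intro divide_left_mono mult_mono mult_pos_pos power_mono zero_less_power) (auto simp del: zero_less_norm_iff)
    also have "\<dots> = 1 / (4 * (sin \<epsilon> / 2) * \<epsilon> ^ j) * exp (- 1 * \<bar>t\<bar>)" by (simp add: exp_minus field_simps)
    finally show "norm (pole_kernel j (Complex t y)) \<le> 1 / (4 * (sin \<epsilon> / 2) * \<epsilon> ^ j) * exp (- 1 * \<bar>t\<bar>)"
      by (simp add: w_def)
  qed
qed

definition strip_pi :: "complex set" where "strip_pi = {z. \<bar>Im z\<bar> < pi}"

lemma convex_strip_pi: "convex strip_pi"
proof -
  have "strip_pi = {z. Im z < pi} \<inter> {z. Im z > - pi}" by (auto simp: strip_pi_def)
  thus ?thesis by (metis convex_Int convex_halfspace_Im_gt convex_halfspace_Im_lt)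
qed

text \<open>A derivative in z brings down a factor w and cancels one power of the denominator, which
  leads from j = 2 to the elementary integral j = 0.\<close>

lemma line_transform_pole_kernel_derivative:
  assumes "z \<in> strip_pi"
  shows "(line_transform (pole_kernel (Suc j)) has_field_derivative
           - \<i> / of_real pi * line_transform (pole_kernel j) z) (at z)"
proof -
  have "(- \<i> * Complex t 1 / of_real pi * pole_kernel (Suc j) (Complex t 1)) = - \<i> / of_real pi * pole_kernel j (Complex t 1)" for t
  proof -
    have "Complex t 1 \<noteq> 0" by (simp add: complex_eq_iff)
    thus ?thesis by (simp add: pole_kernel_def mult_ac)
  qed
  hence "line_transform (\<lambda>w. - \<i> * w / of_real pi * pole_kernel (Suc j) w) z =
     (LBINT t. - \<i> / of_real pi * (exp (- \<i> * z * Complex t 1 / of_real pi) * pole_kernel j (Complex t 1)))"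
    unfolding line_transform_def by (simp add: mult_ac)
  also have "\<dots> = - \<i> / of_real pi * line_transform (pole_kernel j) z"
    unfolding line_transform_def by (rule integral_mult_right_zero)
  finally show ?thesis
    using line_transform_derivative[OF strip_decay_pole_kernel, of z "Suc j"] assms by (simp add: strip_pi_def)
qed

lemma one_plus_exp_nonzero: "z \<in> strip_pi \<Longrightarrow> 1 + exp z \<noteq> 0"
proof
  assume z: "z \<in> strip_pi" and "1 + exp z = 0"
  hence "exp z = -1" by (simp add: eq_neg_iff_add_eq_0 add.commute)
  hence e: "exp (Re z) * cos (Im z) = -1" "exp (Re z) * sin (Im z) = 0"
    by (auto simp: complex_eq_iff Re_exp Im_exp)
  hence "sin (Im z) = 0" by simp
  hence "Im z = 0" using z sin_gt_zero[of "Im z"] sin_gt_zero[of "- Im z"]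
    by (auto simp: strip_pi_def abs_less_iff) (metis less_numeral_extra(3) linorder_neqE_linordered_idom neg_0_less_iff_less)
  thus False using e(1) exp_gt_zero[of "Re z"] by simp
qed

text \<open>A shift by \<open>i\<pi>\<close> multiplies the integrand by \<open>- exp z\<close> and crosses the pole at \<open>i\<pi>\<close>.\<close>

lemma line_transform_pole_kernel_0:
  assumes z: "z \<in> strip_pi"
  shows "line_transform (pole_kernel 0) z = - (of_real pi * \<i> / 2) * (exp z / (1 + exp z))"
proof -
  define f where "f w = exp (- \<i> * z * w / of_real pi) / (4 * sinh w)" for w
  define \<kappa> where "\<kappa> = 1 - \<bar>Im z\<bar> / pi"
  have kap: "\<kappa> > 0" using z by (simp add: strip_pi_def \<kappa>_def field_simps)
  define p where "p = of_real pi * \<i>"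
  have exp_p: "exp p = -1" "exp (- p) = -1" by (simp_all add: p_def exp_minus)
  have sinh_shift: "sinh (w + p) = - sinh w" for w :: complex
    unfolding sinh_field_def minus_add_distrib exp_add exp_p by (simp add: diff_divide_distrib)
  have nz: "sinh w \<noteq> 0" if "0 < Im w" "Im w < 2 * pi" "w \<noteq> p" for w
  proof -
    have "sinh (w - p) \<noteq> 0" using that by (intro sinh_nonzero) (auto simp: p_def abs_less_iff)
    thus ?thesis using sinh_shift[of "w - p"] by simp
  qed
  have holo: "f holomorphic_on {w. 0 < Im w \<and> Im w < 2 * pi} - {p}"
    unfolding f_def using nz by (intro holomorphic_intros) auto
  have bound: "norm (f (Complex t y)) \<le> (1 / (4 * ((1 - exp (- 2 * 1)) / 2)) * exp (\<bar>Re z\<bar> * (1 + pi) / pi)) * exp (- \<kappa> * \<bar>t\<bar>)"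
    if y: "1 \<le> y" "y \<le> 1 + pi" and t: "\<bar>t\<bar> \<ge> 1" for t y
  proof -
    let ?q = "(1 - exp (- 2 * 1)) / 2 :: real"
    have q: "?q > 0" by simp
    have s: "exp \<bar>t\<bar> * ?q \<le> norm (sinh (Complex t y))"
      using norm_sinh_ge'[of 1 "Complex t y"] t by simp
    have "norm (1 / (4 * sinh (Complex t y))) = 1 / (4 * norm (sinh (Complex t y)))" by (simp add: norm_divide norm_mult)
    also have "\<dots> \<le> 1 / (4 * (exp \<bar>t\<bar> * ?q))"
      using s q less_le_trans[OF mult_pos_pos[OF exp_gt_zero q] s]
      by (intro divide_left_mono mult_left_mono mult_pos_pos) (auto simp del: zero_less_norm_iff)
    also have "\<dots> = 1 / (4 * ?q) * exp (- 1 * \<bar>t\<bar>)" using q by (simp add: exp_minus field_simps)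
    finally have "norm (1 / (4 * sinh (Complex t y))) \<le> 1 / (4 * ?q) * exp (- 1 * \<bar>t\<bar>)" .
    moreover have "Re z * y \<le> \<bar>Re z\<bar> * (1 + pi)"
    proof -
      have "\<bar>Re z * y\<bar> \<le> \<bar>Re z\<bar> * (1 + pi)" unfolding abs_mult using y by (intro mult_left_mono) auto
      thus ?thesis by simp
    qed
    ultimately have "norm (exp (- \<i> * z * Complex t y / of_real pi) * (1 / (4 * sinh (Complex t y))))
        \<le> 1 / (4 * ?q) * exp (\<bar>Re z\<bar> * (1 + pi) / pi) * exp (- (1 - \<bar>Im z\<bar> / pi) * \<bar>t\<bar>)"
      by (intro kernel_exp_le) auto
    thus ?thesis by (simp add: f_def \<kappa>_def)
  qed
  \<comment> \<open>Since 1 + pi < 2 pi, the point i pi is the only pole between the two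
    lines.\<close>
  have P: "1 < Im q \<and> Im q < 1 + pi" if "q \<in> {p}" for q using that pi_gt3 by (simp add: p_def)
  have "(LBINT t. f (Complex t 1)) - (LBINT t. f (Complex t (1 + pi))) = 2 * pi * \<i> * (\<Sum>q\<in>{p}. residue f q)"
    by (rule strip_contour_shift(3)[OF _ _ _ kap _ P holo bound]) (use pi_gt3 in auto)
  moreover have "(LBINT t. f (Complex t 1)) = line_transform (pole_kernel 0) z"
    by (simp add: line_transform_def f_def pole_kernel_def)
  moreover have "(LBINT t. f (Complex t (1 + pi))) = - exp z * line_transform (pole_kernel 0) z"
  proof -
    have "f (Complex t (1 + pi)) = - exp z * (exp (- \<i> * z * Complex t 1 / of_real pi) * pole_kernel 0 (Complex t 1))" for t
    proof -
      have w: "Complex t (1 + pi) = Complex t 1 + p" by (simp add: p_def complex_eq_iff)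
      have "- \<i> * z * (Complex t 1 + p) / of_real pi = z + - \<i> * z * Complex t 1 / of_real pi"
        by (simp add: p_def field_simps)
      hence "exp (- \<i> * z * (Complex t 1 + p) / of_real pi) = exp z * exp (- \<i> * z * Complex t 1 / of_real pi)"
        by (simp only: exp_add)
      thus ?thesis unfolding f_def w sinh_shift pole_kernel_def by simp
    qed
    thus ?thesis unfolding line_transform_def by (simp only: integral_mult_right_zero)
  qed
  moreover have "residue f p = - exp z / 4"
  proof -
    have g': "((\<lambda>w. 4 * sinh w) has_field_derivative 4 * cosh p) (at p)"
      by (auto intro!: derivative_eq_intros)
    have cp: "cosh p = -1" by (simp add: cosh_field_def exp_p)
    have sp: "sinh p = 0" by (simp add: sinh_field_def exp_p)
    have ep: "exp (- \<i> * z * p / of_real pi) = exp z"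
      by (rule arg_cong[where f = exp]) (simp add: p_def field_simps)
    have "residue (\<lambda>w. exp (- \<i> * z * w / of_real pi) / (4 * sinh w)) p = exp (- \<i> * z * p / of_real pi) / (4 * cosh p)"
      by (rule residue_simple_pole_deriv[where s = UNIV]) (use g' cp sp in \<open>auto intro!: holomorphic_intros\<close>)
    thus ?thesis unfolding f_def[abs_def] ep cp by simp
  qed
  \<comment> \<open>If T is the transform, the two lines give T and - exp z T, so the shift becomes
    the linear equation (1 + exp z) T = 2 pi i (- exp z / 4).\<close>
  ultimately have "line_transform (pole_kernel 0) z * (1 + exp z) = - (of_real pi * \<i> / 2) * exp z"
    by (simp add: algebra_simps)
  hence "line_transform (pole_kernel 0) z = - (of_real pi * \<i> / 2) * exp z / (1 + exp z)"
    by (rule iffD2[OF nonzero_eq_divide_eq[OF one_plus_exp_nonzero[OF z]]])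
  thus ?thesis by simp
qed

subsection \<open>The dilogarithm\<close>

definition slit_plane :: "complex set" where "slit_plane = {z. Im z = 0 \<longrightarrow> Re z < 1}"

lemma slit_plane_iff: "z \<in> slit_plane \<longleftrightarrow> 1 - z \<notin> \<real>\<^sub>\<le>\<^sub>0"
  by (auto simp: slit_plane_def complex_nonpos_Reals_iff)

lemma open_slit_plane: "open slit_plane"
proof -
  have "slit_plane = (\<lambda>z. 1 - z) -` (- \<real>\<^sub>\<le>\<^sub>0)" by (auto simp: slit_plane_iff)
  moreover have "open ((\<lambda>z::complex. 1 - z) -` (- \<real>\<^sub>\<le>\<^sub>0))"
    by (intro open_vimage open_Compl closed_nonpos_Reals_complex continuous_intros)
  ultimately show ?thesis by simp
qed

text \<open>The slit plane is star-shaped about 0, as suits the straight path in the definition of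
  \<open>dilog\<close>.\<close>

lemma closed_segment_subset_slit_plane:
  assumes "z \<in> slit_plane"
  shows "closed_segment 0 z \<subseteq> slit_plane"
proof
  fix w assume "w \<in> closed_segment 0 z"
  then obtain u where u: "0 \<le> u" "u \<le> 1" "w = u *\<^sub>R z" by (auto simp: in_segment)
  have "u * Re z < 1" if "Re z < 1"
  proof (cases "Re z \<ge> 0")
    case True
    thus ?thesis using that u mult_left_le_one_le[of "Re z" u] by linarith
  next
    case False
    thus ?thesis using mult_nonneg_nonpos[of u "Re z"] u by linarith
  qed
  thus "w \<in> slit_plane" using assms u by (auto simp: slit_plane_def)
qed

lemma starlike_slit_plane: "starlike slit_plane"
  unfolding starlike_def using closed_segment_subset_slit_plane
  by (intro bexI[of _ 0]) (auto simp: slit_plane_def)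

lemma dilog_has_field_derivative:
  assumes "z \<in> slit_plane"
  shows "(dilog has_field_derivative (if z = 0 then 1 else - Ln (1 - z) / z)) (at z)"
proof -
  \<comment> \<open>q takes its limit value -1 at the origin, whereas the integrand of
    \<open>dilog\<close> is 0 there by the convention for division by 0. A segment from 0 to a
    nonzero point meets the origin at a single parameter, so the integrals agree.\<close>
  define q where "q = (\<lambda>z. if z = 0 then -1 else Ln (1 - z) / z)"
  have holo: "(\<lambda>z. Ln (1 - z)) holomorphic_on slit_plane"
    by (intro holomorphic_intros) (auto simp: slit_plane_iff)
  have "deriv (\<lambda>z. Ln (1 - z)) 0 = -1"
    by (rule DERIV_imp_deriv) (auto intro!: derivative_eq_intros)
  hence "q = (\<lambda>z. if z = 0 then deriv (\<lambda>z. Ln (1 - z)) 0 else (Ln (1 - z) - Ln (1 - 0)) / (z - 0))"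
    by (auto simp: q_def fun_eq_iff)
  hence hq: "q holomorphic_on slit_plane"
    using pole_lemma_open[OF holo open_slit_plane, of 0] by simp
  obtain G where G: "\<And>z. z \<in> slit_plane \<Longrightarrow> (G has_field_derivative q z) (at z)"
    using holomorphic_starlike_primitive[OF holomorphic_on_imp_continuous_on[OF hq] starlike_slit_plane open_slit_plane, of "{}"]
      hq open_slit_plane by (auto simp: holomorphic_on_imp_differentiable_at)
  have eq: "dilog w = - (G w - G 0)" if w: "w \<in> slit_plane" for w
  proof -
    have "closed_segment 0 w \<subseteq> slit_plane" by (rule closed_segment_subset_slit_plane[OF w])
    hence "(q has_contour_integral (G w - G 0)) (linepath 0 w)"
      using contour_integral_primitive[of slit_plane G q "linepath 0 w", OF has_field_derivative_at_within[OF G]] by auto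
    hence "contour_integral (linepath 0 w) q = G w - G 0" by (rule contour_integral_unique)
    moreover have "contour_integral (linepath 0 w) q = contour_integral (linepath 0 w) (\<lambda>u. Ln (1 - u) / u)"
    proof (cases "w = 0")
      case False
      show ?thesis unfolding contour_integral_integral
        by (rule integral_spike[of "{0}"]) (use False in \<open>auto simp: q_def linepath_def\<close>)
    qed auto
    ultimately show ?thesis by (simp add: dilog_def)
  qed
  have "((\<lambda>w. - (G w - G 0)) has_field_derivative - q z) (at z)"
    by (auto intro!: derivative_eq_intros G assms)
  hence "(dilog has_field_derivative - q z) (at z)"
    by (rule has_field_derivative_transform_within_open[OF _ open_slit_plane assms]) (simp add: eq)
  thus ?thesis by (auto simp: q_def split: if_splits)
qed

lemma dilog_0: "dilog 0 = 0" by (simp add: dilog_def)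

definition dilog_exp :: "complex \<Rightarrow> complex" where "dilog_exp z = dilog (- exp z)"

lemma minus_exp_in_slit_plane: "z \<in> strip_pi \<Longrightarrow> - exp z \<in> slit_plane"
proof -
  assume z: "z \<in> strip_pi"
  have "- exp (Re z) * cos (Im z) < 1" if "sin (Im z) = 0"
  proof -
    have "Im z = 0" using z that sin_gt_zero[of "Im z"] sin_gt_zero[of "- Im z"]
      by (auto simp: strip_pi_def abs_less_iff) (metis less_numeral_extra(3) linorder_neqE_linordered_idom neg_0_less_iff_less)
    thus ?thesis by (simp add: less_trans[OF _ exp_gt_zero])
  qed
  thus ?thesis by (auto simp: slit_plane_def Re_exp Im_exp)
qed

lemma one_plus_exp_notin_nonpos: "z \<in> strip_pi \<Longrightarrow> 1 + exp z \<notin> \<real>\<^sub>\<le>\<^sub>0"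
  using minus_exp_in_slit_plane[of z] by (simp add: slit_plane_iff)

lemma dilog_exp_derivative:
  assumes "z \<in> strip_pi"
  shows "(dilog_exp has_field_derivative - Ln (1 + exp z)) (at z)"
proof -
  have "((\<lambda>z. dilog (- exp z)) has_field_derivative (- Ln (1 - (- exp z)) / (- exp z)) * (- exp z)) (at z)"
    by (rule DERIV_chain2[where f = dilog])
       (use dilog_has_field_derivative[OF minus_exp_in_slit_plane[OF assms]] in \<open>auto intro!: derivative_eq_intros\<close>)
  thus ?thesis by (simp add: dilog_exp_def[abs_def])
qed

lemma Ln_one_plus_exp_derivative:
  assumes "z \<in> strip_pi"
  shows "((\<lambda>z. Ln (1 + exp z)) has_field_derivative exp z / (1 + exp z)) (at z)"
  using one_plus_exp_notin_nonpos[OF assms] by (auto intro!: derivative_eq_intros simp: field_simps)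

text \<open>Both sides have the same second derivative, by the case j = 0, so they differ by A + B
  z. Both tend to 0 along the reals at minus infinity, which forces A = B = 0.\<close>

lemma line_transform_pole_kernel_2:
  assumes "z \<in> strip_pi"
  shows "line_transform (pole_kernel 2) z = dilog_exp z / (2 * of_real pi * \<i>)"
proof -
  define D where "D z = line_transform (pole_kernel 2) z - dilog_exp z / (2 * of_real pi * \<i>)" for z
  define D' where "D' z = - \<i> / of_real pi * line_transform (pole_kernel 1) z + Ln (1 + exp z) / (2 * of_real pi * \<i>)" for z
  have d: "(D has_field_derivative D' z) (at z)" if "z \<in> strip_pi" for z
    unfolding D_def D'_def using line_transform_pole_kernel_derivative[OF that, of 1] dilog_exp_derivative[OF that]
    by (auto intro!: derivative_eq_intros simp: numeral_2_eq_2)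
  have d': "(D' has_field_derivative 0) (at z)" if z: "z \<in> strip_pi" for z
  proof -
    have "(D' has_field_derivative (- \<i> / of_real pi * (- \<i> / of_real pi * line_transform (pole_kernel 0) z)
        + exp z / (1 + exp z) / (2 * of_real pi * \<i>))) (at z)"
      unfolding D'_def using line_transform_pole_kernel_derivative[OF z, of 0]
      by (intro DERIV_add[OF DERIV_cmult DERIV_cdivide[OF Ln_one_plus_exp_derivative[OF z]]]) simp
    moreover have "- \<i> / of_real pi * (- \<i> / of_real pi * line_transform (pole_kernel 0) z)
        + exp z / (1 + exp z) / (2 * of_real pi * \<i>) = 0"
    proof -
      have "X / (2 * of_real pi * \<i>) = - \<i> * X / (2 * of_real pi)"
        "- \<i> / of_real pi * (- \<i> / of_real pi * (- (of_real pi * \<i> / 2) * X)) = \<i> * X / (2 * of_real pi)" for X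
        by (simp_all add: field_simps)
      thus ?thesis unfolding line_transform_pole_kernel_0[OF z] by simp
    qed
    ultimately show ?thesis by simp
  qed
  obtain B where B: "\<And>z. z \<in> strip_pi \<Longrightarrow> D' z = B"
    using has_field_derivative_zero_constant[OF convex_strip_pi, of D'] d' has_field_derivative_at_within by metis
  have "((\<lambda>z. D z - B * z) has_field_derivative 0) (at z)" if "z \<in> strip_pi" for z
    using d[OF that] B[OF that] by (auto intro!: derivative_eq_intros)
  then obtain A where A: "\<And>z. z \<in> strip_pi \<Longrightarrow> D z - B * z = A"
    using has_field_derivative_zero_constant[OF convex_strip_pi, of "\<lambda>z. D z - B * z"] has_field_derivative_at_within by metis
  have D_eq: "D z = A + B * z" if "z \<in> strip_pi" for z using A[OF that] by (simp add: algebra_simps)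
  have real_in: "of_real x \<in> strip_pi" for x by (simp add: strip_pi_def)
  have lim: "((\<lambda>x::real. D (of_real x)) \<longlongrightarrow> 0) at_bot"
  proof -
    obtain C where C: "\<And>z. \<bar>Im z\<bar> \<le> 0 \<Longrightarrow> norm (line_transform (pole_kernel 2) z) \<le> C * exp (Re z / pi)"
      using line_transform_bound[OF strip_decay_pole_kernel, of 0 2] by auto
    have e: "((\<lambda>x::real. exp (x / pi)) \<longlongrightarrow> 0) at_bot" "((\<lambda>x::real. exp x) \<longlongrightarrow> 0) at_bot"
      by real_asymp+
    have "((\<lambda>x. line_transform (pole_kernel 2) (of_real x)) \<longlongrightarrow> 0) at_bot"
    proof (rule Lim_null_comparison)
      show "eventually (\<lambda>x. norm (line_transform (pole_kernel 2) (of_real x)) \<le> C * exp (x / pi)) at_bot"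
        using C[of "of_real _"] by (intro always_eventually allI) simp
      show "((\<lambda>x. C * exp (x / pi)) \<longlongrightarrow> 0) at_bot" by (rule tendsto_mult_right_zero[OF e(1)])
    qed
    moreover have "((\<lambda>x::real. dilog_exp (of_real x)) \<longlongrightarrow> 0) at_bot"
    proof -
      have "isCont dilog 0"
        using dilog_has_field_derivative[of 0] by (intro DERIV_isCont) (auto simp: slit_plane_def)
      moreover have "((\<lambda>x::real. - of_real (exp x) :: complex) \<longlongrightarrow> 0) at_bot"
        using tendsto_minus[OF tendsto_of_real[OF e(2)]] by simp
      ultimately have "((\<lambda>x::real. dilog (- of_real (exp x))) \<longlongrightarrow> dilog 0) at_bot"
        by (rule isCont_tendsto_compose)
      thus ?thesis by (simp add: dilog_exp_def exp_of_real dilog_0)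
    qed
    ultimately have "((\<lambda>x::real. line_transform (pole_kernel 2) (of_real x) - dilog_exp (of_real x) / (2 * of_real pi * \<i>)) \<longlongrightarrow> 0 - 0 / (2 * of_real pi * \<i>)) at_bot"
      by (intro tendsto_intros) auto
    thus ?thesis by (simp add: D_def)
  qed
  \<comment> \<open>The increment over a unit step isolates the slope B.\<close>
  have lim1: "((\<lambda>x::real. D (of_real (x - 1))) \<longlongrightarrow> 0) at_bot"
    by (rule filterlim_compose[OF lim]) real_asymp
  have "((\<lambda>x::real. D (of_real x) - D (of_real (x - 1))) \<longlongrightarrow> 0 - 0) at_bot"
    by (intro tendsto_diff lim lim1)
  moreover have "D (of_real x) - D (of_real (x - 1)) = B" for x :: real
    by (simp only: D_eq[OF real_in]) (simp add: algebra_simps)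
  ultimately have B0: "B = 0" by (simp add: tendsto_const_iff trivial_limit_at_bot_linorder)
  hence "A = 0" using lim by (simp add: D_eq[OF real_in] tendsto_const_iff trivial_limit_at_bot_linorder)
  hence "D z = 0" using D_eq[OF assms] B0 by simp
  thus ?thesis by (simp add: D_def)
qed

subsection \<open>The semiclassical remainder\<close>

text \<open>Since sinh w - w has order three, the difference of the reciprocals has order one at 0;
  for large |Re w| it is bounded, so a linear bound holds throughout. At w = b^2 y it supplies the
  factor b^2.\<close>

lemma inverse_sinh_minus_inverse_bound:
  "\<exists>C\<ge>0. \<forall>w. w \<noteq> 0 \<and> \<bar>Im w\<bar> \<le> 1 \<longrightarrow> norm (1 / sinh w - 1 / w) \<le> C * norm w"
proof -
  define K where "K = cbox (Complex (-1) (-1)) (Complex 1 1)"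
  have "continuous_on K (\<lambda>w. 1 / sinhc w)"
  proof (intro holomorphic_on_imp_continuous_on holomorphic_intros)
    fix w assume "w \<in> K"
    thus "sinhc w \<noteq> 0" using pi_gt3 by (intro sinhc_nonzero) (auto simp: K_def in_cbox_complex_iff)
  qed
  hence "bounded ((\<lambda>w. 1 / sinhc w) ` K)"
    by (intro compact_imp_bounded compact_continuous_image) (auto simp: K_def)
  then obtain B where B: "\<And>w. w \<in> K \<Longrightarrow> norm (1 / sinhc w) \<le> B"
    unfolding bounded_iff by blast
  define q where "q = (1 - exp (- 2 * (1::real))) / 2"
  have q: "q > 0" by (simp add: q_def)
  define C where "C = \<bar>B\<bar> * exp 2 + (1 / q + 1)"
  show ?thesis
  proof (intro exI[of _ C] conjI allI impI, goal_cases)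
    case 1 thus ?case using q by (auto simp: C_def)
  next
    case (2 w)
    hence w0: "w \<noteq> 0" and im: "\<bar>Im w\<bar> \<le> 1" by auto
    have sw: "sinh w \<noteq> 0" using w0 im pi_gt3 by (intro sinh_nonzero) auto
    show ?case
    proof (cases "\<bar>Re w\<bar> \<le> 1")
      case True
      hence "w \<in> K" using im by (auto simp: K_def in_cbox_complex_iff)
      hence B': "norm (1 / sinhc w) \<le> \<bar>B\<bar>" using B[of w] by simp
      have nw: "norm w \<le> 2" using cmod_le[of w] True im by simp
      have T: "norm (exp u - (1 + u + u\<^sup>2 / 2)) \<le> exp (norm u) * norm u ^ 3 / 2" for u :: complex
        using Taylor_exp_field[of u 2] by (simp add: eval_nat_numeral add_ac)
      have "sinh w - w = ((exp w - (1 + w + w\<^sup>2 / 2)) - (exp (- w) - (1 + (- w) + (- w)\<^sup>2 / 2))) / 2"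
        by (simp add: sinh_field_def field_simps)
      hence "norm (sinh w - w) = norm ((exp w - (1 + w + w\<^sup>2 / 2)) - (exp (- w) - (1 + (- w) + (- w)\<^sup>2 / 2))) / 2"
        by (simp only: norm_divide) simp
      also have "\<dots> \<le> (exp (norm w) * norm w ^ 3 / 2 + exp (norm w) * norm w ^ 3 / 2) / 2"
        using add_mono[OF T[of w] T[of "- w"]]
        by (intro divide_right_mono order.trans[OF norm_triangle_ineq4]) simp_all
      also have "\<dots> \<le> exp (norm w) * norm w ^ 3" by simp
      also have "\<dots> \<le> exp 2 * norm w ^ 3" using nw by (intro mult_right_mono) auto
      finally have num: "norm (sinh w - w) \<le> exp 2 * norm w ^ 3" .
      have "1 / sinh w - 1 / w = - ((sinh w - w) / w\<^sup>2) * (1 / sinhc w)"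
        using w0 sw by (simp add: sinhc_def field_simps power2_eq_square)
      hence "norm (1 / sinh w - 1 / w) = norm (sinh w - w) / norm w ^ 2 * norm (1 / sinhc w)"
        by (simp only: norm_mult norm_minus_cancel norm_divide norm_power)
      also have "\<dots> \<le> (exp 2 * norm w ^ 3) / norm w ^ 2 * \<bar>B\<bar>"
        using num B' by (intro mult_mono divide_right_mono) auto
      also have "\<dots> = \<bar>B\<bar> * exp 2 * norm w" using w0 by (simp add: eval_nat_numeral)
      also have "\<dots> \<le> C * norm w" unfolding C_def using q by (intro mult_right_mono) auto
      finally show ?thesis .
    next
      case False
      hence n1: "1 \<le> norm w" using abs_Re_le_cmod[of w] by simp
      have "1 * q \<le> exp \<bar>Re w\<bar> * q" using q by (intro mult_right_mono) auto
      also have "\<dots> \<le> norm (sinh w)" using norm_sinh_ge'[of 1 w] False by (simp add: q_def)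
      finally have "norm (1 / sinh w) \<le> 1 / q" using q by (simp add: norm_divide frac_le)
      hence "norm (1 / sinh w - 1 / w) \<le> 1 / q + 1"
        using n1 by (intro order.trans[OF norm_triangle_ineq4] add_mono) (auto simp: norm_divide divide_le_eq_1)
      also have "\<dots> \<le> C * 1" by (simp add: C_def)
      also have "\<dots> \<le> C * norm w" using n1 q by (intro mult_left_mono) (auto simp: C_def)
      finally show ?thesis .
    qed
  qed
qed

lemma sin_ge_half:
  assumes "0 \<le> x" "x \<le> 1"
  shows "sin x \<ge> x / (2::real)"
proof (cases "x = 0")
  case False
  hence "\<exists>z. 0 < z \<and> z < x \<and> sin x - sin 0 = (x - 0) * cos z"
    using assms by (intro MVT2) (auto intro!: derivative_eq_intros)
  then obtain z where z: "0 < z" "z < x" "sin x = x * cos z" by auto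
  have "cos (pi / 3) \<le> cos z" using z assms pi_gt3 by (intro cos_monotone_0_pi_le) auto
  hence "1 / 2 \<le> cos z" by (simp add: cos_60)
  hence "x * (1 / 2) \<le> x * cos z" using assms by (intro mult_left_mono) auto
  thus ?thesis using z by simp
qed auto

text \<open>Taking the height of the contour to be \<open>1 / (1 + \<bar>Re z\<bar>)\<close> keeps \<open>exp (Re z * y / pi)\<close> bounded
  at the price of a factor that is only linear in \<open>Re z\<close>.\<close>

lemma faddeev_log_semiclassical:
  assumes v: "v < pi"
  shows "\<exists>C\<ge>0. \<forall>b z. 0 < b \<and> b < 1 \<and> \<bar>Im z\<bar> \<le> v \<longrightarrow>
     norm (faddeev_log b z - dilog_exp z / (2 * of_real pi * \<i> * of_real (b\<^sup>2))) \<le> C * b\<^sup>2 * (1 + \<bar>Re z\<bar>)"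
proof -
  obtain C where C: "C \<ge> 0" "\<And>w. w \<noteq> 0 \<Longrightarrow> \<bar>Im w\<bar> \<le> 1 \<Longrightarrow> norm (1 / sinh w - 1 / w) \<le> C * norm w"
    using inverse_sinh_minus_inverse_bound by blast
  define \<kappa> where "\<kappa> = 1 - v / pi"
  have kap: "\<kappa> > 0" using v by (simp add: \<kappa>_def field_simps)
  define I where "I = (LBINT t. exp (- \<kappa> * \<bar>t::real\<bar>))"
  have I: "I \<ge> 0" unfolding I_def by (rule Bochner_Integration.integral_nonneg) simp
  show ?thesis
  proof (rule exI[of _ "C * exp (1 / pi) * I"], intro conjI allI impI)
    show "C * exp (1 / pi) * I \<ge> 0" using C I by simp
    fix b :: real and z assume "0 < b \<and> b < 1 \<and> \<bar>Im z\<bar> \<le> v"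
    hence b: "0 < b" "b < 1" and z: "\<bar>Im z\<bar> \<le> v" by auto
    have zpi: "z \<in> strip_pi" using z v by (simp add: strip_pi_def)
    have z1: "\<bar>Im z\<bar> < pi * 1" using z v by simp
    have "pi * 1 \<le> pi * (1 + b\<^sup>2)" by (intro mult_left_mono) auto
    hence zb: "\<bar>Im z\<bar> < pi * (1 + b\<^sup>2)" using z1 by linarith
    define \<epsilon> where "\<epsilon> = 1 / (1 + \<bar>Re z\<bar>)"
    have e: "0 < \<epsilon>" "\<epsilon> \<le> 1" by (auto simp: \<epsilon>_def)
    have se: "sin \<epsilon> \<ge> \<epsilon> / 2" "sin \<epsilon> > 0" using sin_ge_half[of \<epsilon>] e by auto
    let ?E = "\<lambda>t. exp (- \<i> * z * Complex t \<epsilon> / of_real pi)"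
    define f where "f t = ?E t * (faddeev_kernel b (Complex t \<epsilon>) - pole_kernel 2 (Complex t \<epsilon>) / of_real (b\<^sup>2))" for t
    have i1: "integrable lborel (\<lambda>t. ?E t * faddeev_kernel b (Complex t \<epsilon>))"
      by (rule line_transform_height(1)[OF strip_decay_faddeev_kernel[OF b] zb e])
    have i2: "integrable lborel (\<lambda>t. ?E t * pole_kernel 2 (Complex t \<epsilon>) / of_real (b\<^sup>2))"
      by (intro integrable_divide_zero) (use line_transform_height(1)[OF strip_decay_pole_kernel z1 e, of 2] in auto)
    have f_eq: "f t = ?E t * faddeev_kernel b (Complex t \<epsilon>) - ?E t * pole_kernel 2 (Complex t \<epsilon>) / of_real (b\<^sup>2)" for t
      by (simp add: f_def right_diff_distrib)
    have f_int: "integrable lborel f" unfolding f_eq[abs_def] by (intro Bochner_Integration.integrable_diff i1 i2)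
    have "(LBINT t. f t) = (LBINT t. ?E t * faddeev_kernel b (Complex t \<epsilon>)) - (LBINT t. ?E t * pole_kernel 2 (Complex t \<epsilon>) / of_real (b\<^sup>2))"
      unfolding f_eq by (rule Bochner_Integration.integral_diff[OF i1 i2])
    also have "\<dots> = faddeev_log b z - line_transform (pole_kernel 2) z / of_real (b\<^sup>2)"
      unfolding integral_divide_zero faddeev_log_def
      using line_transform_height(2)[OF strip_decay_faddeev_kernel[OF b] zb e] line_transform_height(2)[OF strip_decay_pole_kernel z1 e, of 2]
      by simp
    also have "\<dots> = faddeev_log b z - dilog_exp z / (2 * of_real pi * \<i> * of_real (b\<^sup>2))"
      unfolding line_transform_pole_kernel_2[OF zpi] by simp
    finally have eq: "faddeev_log b z - dilog_exp z / (2 * of_real pi * \<i> * of_real (b\<^sup>2)) = (LBINT t. f t)" ..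
    have kb: "norm (faddeev_kernel b (Complex t \<epsilon>) - pole_kernel 2 (Complex t \<epsilon>) / of_real (b\<^sup>2))
        \<le> C * b\<^sup>2 * (1 + \<bar>Re z\<bar>) * exp (- 1 * \<bar>t\<bar>)" for t
    proof -
      define y where "y = Complex t \<epsilon>"
      define w where "w = of_real (b\<^sup>2) * y"
      have y0: "y \<noteq> 0" using e by (auto simp: y_def complex_eq_iff)
      have sy: "sinh y \<noteq> 0" using y0 e pi_gt3 by (intro sinh_nonzero) (auto simp: y_def)
      have "b\<^sup>2 * \<epsilon> \<le> 1 * 1" using b e by (intro mult_mono) (auto simp: power_le_one)
      hence w: "w \<noteq> 0" "\<bar>Im w\<bar> \<le> 1" using b e y0 by (auto simp: w_def y_def abs_mult simp del: of_real_power)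
      have "faddeev_kernel b y - pole_kernel 2 y / of_real (b\<^sup>2) = 1 / (4 * sinh y * y) * (1 / sinh w - 1 / w)"
        using y0 b by (simp add: faddeev_kernel_def pole_kernel_def w_def right_diff_distrib power2_eq_square mult_ac)
      hence "norm (faddeev_kernel b y - pole_kernel 2 y / of_real (b\<^sup>2)) = 1 / (4 * norm (sinh y) * norm y) * norm (1 / sinh w - 1 / w)"
        by (simp only: norm_mult norm_divide norm_one norm_numeral)
      also have "\<dots> \<le> 1 / (4 * norm (sinh y) * norm y) * (C * norm w)"
        using C(2)[OF w] by (intro mult_left_mono) auto
      \<comment> \<open>|w| = b^2 |y| cancels the factor |y| of the denominator; the only remaining
        loss is one factor 1 / \<epsilon> = 1 + |Re z| from sinh y.\<close>
      also have "\<dots> = C * b\<^sup>2 / 4 * (1 / norm (sinh y))" using y0 by (simp add: w_def norm_mult norm_power)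
      also have "\<dots> \<le> C * b\<^sup>2 / 4 * (1 / (exp \<bar>t\<bar> * (\<epsilon> / 4)))"
      proof -
        have "exp \<bar>t\<bar> * (\<epsilon> / 4) \<le> exp \<bar>t\<bar> / 2 * \<bar>sin \<epsilon>\<bar>" using se by simp
        also have "\<dots> \<le> norm (sinh y)" using norm_sinh_ge[of y] by (simp add: y_def)
        finally have "exp \<bar>t\<bar> * (\<epsilon> / 4) \<le> norm (sinh y)" .
        thus ?thesis using e C sy by (intro mult_left_mono divide_left_mono mult_pos_pos) auto
      qed
      also have "\<dots> = C * b\<^sup>2 * (1 + \<bar>Re z\<bar>) * exp (- 1 * \<bar>t\<bar>)"
        by (simp add: \<epsilon>_def exp_minus field_simps)
      finally show ?thesis by (simp add: y_def)
    qed
    have fb: "norm (f t) \<le> C * b\<^sup>2 * (1 + \<bar>Re z\<bar>) * exp (1 / pi) * exp (- \<kappa> * \<bar>t\<bar>)" for t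
      unfolding f_def \<kappa>_def
    proof (rule kernel_exp_le[OF kb z])
      have "Re z * \<epsilon> \<le> \<bar>Re z\<bar> * \<epsilon>" using e by (intro mult_right_mono) auto
      also have "\<dots> \<le> 1" by (simp add: \<epsilon>_def)
      finally show "Re z * \<epsilon> \<le> 1" .
    qed
    have "norm (LBINT t. f t) \<le> (LBINT t. norm (f t))" by (rule integral_norm_bound)
    also have "\<dots> \<le> (LBINT t. C * b\<^sup>2 * (1 + \<bar>Re z\<bar>) * exp (1 / pi) * exp (- \<kappa> * \<bar>t\<bar>))"
    proof (rule integral_mono)
      show "integrable lborel (\<lambda>t. C * b\<^sup>2 * (1 + \<bar>Re z\<bar>) * exp (1 / pi) * exp (- \<kappa> * \<bar>t\<bar>))"
        by (intro integrable_mult_right integrable_exp_neg_abs kap)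
    qed (use f_int fb in auto)
    also have "\<dots> = C * b\<^sup>2 * (1 + \<bar>Re z\<bar>) * exp (1 / pi) * I" unfolding I_def by (rule integral_mult_right_zero)
    finally show "norm (faddeev_log b z - dilog_exp z / (2 * of_real pi * \<i> * of_real (b\<^sup>2)))
        \<le> C * exp (1 / pi) * I * b\<^sup>2 * (1 + \<bar>Re z\<bar>)" unfolding eq by (simp add: mult_ac)
  qed
qed

subsection \<open>The arguments of the level-\<open>N\<close> quantum dilogarithm\<close>

text \<open>Multiplied by 2 pi b, the argument of the j-th factor of D_b at x / (2 pi b) splits by
  powers of b: a part free of b, which is one of N points symmetric about x / sqrt N with spacing 2
  pi i / N, and i b^2 times the real number \<open>arg_shift\<close>.\<close>

definition base_arg :: "nat \<Rightarrow> complex \<Rightarrow> nat \<Rightarrow> complex" where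
  "base_arg N x j = x / of_real (sqrt (real N)) + \<i> * of_real (pi * (1 - (2 * real j + 1) / real N))"

definition arg_shift :: "nat \<Rightarrow> int \<Rightarrow> nat \<Rightarrow> real" where
  "arg_shift N n j = pi * (1 - 1 / real N) - 2 * pi * frac (of_int (int j + n) / real N)"

definition level_arg :: "nat \<Rightarrow> real \<Rightarrow> complex \<Rightarrow> int \<Rightarrow> nat \<Rightarrow> complex" where
  "level_arg N b x n j = base_arg N x j + \<i> * of_real (b\<^sup>2 * arg_shift N n j)"

lemma frac_of_int_divide:
  assumes "N > 0"
  shows "frac (of_int m / real N) = real_of_int (m mod int N) / real N"
proof -
  have "\<lfloor>of_int m / real N\<rfloor> = m div int N"
    using floor_divide_of_int_eq[of m "int N"] by simp
  moreover have "real_of_int m = real_of_int (m div int N) * real N + real_of_int (m mod int N)"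
    using div_mult_mod_eq[of m "int N"] by (metis of_int_add of_int_mult of_int_of_nat_eq)
  ultimately show ?thesis using assms by (simp add: frac_def field_simps)
qed

lemma arg_shift_eq:
  assumes "N > 0"
  shows "arg_shift N n j = pi * (real N - 1 - 2 * real_of_int ((int j + n) mod int N)) / real N"
  unfolding arg_shift_def frac_of_int_divide[OF assms] using assms by (simp add: field_simps del: of_int_add)

lemma abs_arg_shift_le:
  assumes "N > 0"
  shows "\<bar>arg_shift N n j\<bar> \<le> pi * (1 - 1 / real N)"
proof -
  have r: "0 \<le> (int j + n) mod int N" "(int j + n) mod int N \<le> int N - 1"
    using assms pos_mod_bound[of "int N" "int j + n"] by auto
  have "0 \<le> real_of_int ((int j + n) mod int N)" "real_of_int ((int j + n) mod int N) \<le> real_of_int (int N - 1)"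
    using r by (simp_all only: of_int_le_iff of_int_0_le_iff)
  hence "0 \<le> real_of_int ((int j + n) mod int N)" "real_of_int ((int j + n) mod int N) \<le> real N - 1" by simp_all
  hence "\<bar>real N - 1 - 2 * real_of_int ((int j + n) mod int N)\<bar> \<le> real N - 1" by linarith
  hence "pi * \<bar>real N - 1 - 2 * real_of_int ((int j + n) mod int N)\<bar> / real N \<le> pi * (real N - 1) / real N"
    by (intro divide_right_mono mult_left_mono) auto
  moreover have "\<bar>arg_shift N n j\<bar> = pi * \<bar>real N - 1 - 2 * real_of_int ((int j + n) mod int N)\<bar> / real N"
    unfolding arg_shift_eq[OF assms] by (simp add: abs_mult)
  moreover have "pi * (1 - 1 / real N) = pi * (real N - 1) / real N" using assms by (simp add: field_simps)
  ultimately show ?thesis by simp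
qed

text \<open>Adding n permutes the residues modulo N.\<close>

lemma sum_mod_shift:
  assumes "N > 0"
  shows "(\<Sum>j<N. (int j + n) mod int N) = (\<Sum>j<N. int j)"
proof -
  define f where "f j = nat ((int j + n) mod int N)" for j
  have inj: "inj_on f {..<N}"
  proof (rule inj_onI)
    fix i j assume ij: "i \<in> {..<N}" "j \<in> {..<N}" and "f i = f j"
    hence "(int i + n) mod int N = (int j + n) mod int N"
      using assms unfolding f_def by (metis of_nat_0_less_iff pos_mod_sign nat_eq_iff2 nat_0_le)
    hence "int N dvd (int i + n) - (int j + n)" by (simp add: mod_eq_dvd_iff)
    hence "int N dvd int i - int j" by simp
    show "i = j"
    proof (rule ccontr)
      assume "i \<noteq> j"
      hence "\<bar>int N\<bar> \<le> \<bar>int i - int j\<bar>" using \<open>int N dvd int i - int j\<close> by (intro dvd_imp_le_int) auto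
      thus False using ij by auto
    qed
  qed
  have "f ` {..<N} \<subseteq> {..<N}" using assms by (auto simp: f_def nat_less_iff)
  hence "bij_betw f {..<N} {..<N}" using inj by (auto simp: bij_betw_def endo_inj_surj)
  from sum.reindex_bij_betw[OF this, of int] show ?thesis using assms by (simp add: f_def)
qed

lemma sum_real_lessThan: "(\<Sum>j<N. real j) = real N * (real N - 1) / 2"
  by (induction N) (auto simp: field_simps)

text \<open>The residues run through 0, ..., N - 1, which are symmetric about (N - 1) / 2. The
  shifts therefore drop out of the sum of the arguments.\<close>

lemma sum_arg_shift:
  assumes "N > 0"
  shows "(\<Sum>j<N. arg_shift N n j) = 0"
proof -
  have "(\<Sum>j<N. real_of_int ((int j + n) mod int N)) = real_of_int (\<Sum>j<N. (int j + n) mod int N)" by simp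
  also have "\<dots> = (\<Sum>j<N. real j)" unfolding sum_mod_shift[OF assms] by simp
  also have "\<dots> = real N * (real N - 1) / 2" by (rule sum_real_lessThan)
  finally show ?thesis
    unfolding arg_shift_eq[OF assms] sum_divide_distrib[symmetric] sum_distrib_left[symmetric] sum_subtractf
    by (simp add: algebra_simps)
qed

lemma sum_base_arg_Im:
  assumes "N > 0"
  shows "(\<Sum>j<N. Im (base_arg N x j)) = sqrt (real N) * Im x"
proof -
  have "(\<Sum>j<N. Im (base_arg N x j)) = (\<Sum>j<N. Im x / sqrt (real N) + pi - pi / real N - 2 * pi / real N * real j)"
    by (rule sum.cong) (use assms in \<open>auto simp: base_arg_def Im_divide_of_real field_simps\<close>)
  also have "\<dots> = real N * (Im x / sqrt (real N) + pi - pi / real N) - 2 * pi / real N * (real N * (real N - 1) / 2)"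
    unfolding sum_subtractf sum_constant sum_distrib_left[symmetric] sum_real_lessThan by (simp add: algebra_simps)
  also have "\<dots> = real N / sqrt (real N) * Im x" using assms by (simp add: field_simps)
  also have "real N / sqrt (real N) = sqrt (real N)" by (simp add: real_div_sqrt)
  finally show ?thesis .
qed

lemma Re_base_arg: "Re (base_arg N x j) = Re x / sqrt (real N)"
  by (simp add: base_arg_def Re_divide_of_real)

lemma Re_level_arg: "Re (level_arg N b x n j) = Re x / sqrt (real N)"
  by (simp add: level_arg_def Re_base_arg)

text \<open>All arguments share one real part, so the growth of the product depends on the imaginary
  parts only through their sum, from which b and n have disappeared.\<close>

lemma sum_level_arg_Im:
  assumes "N > 0"
  shows "(\<Sum>j<N. Im (level_arg N b x n j)) = sqrt (real N) * Im x"
  using sum_base_arg_Im[OF assms] sum_arg_shift[OF assms, of n]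
  by (simp add: level_arg_def sum.distrib sum_distrib_left[symmetric])

lemma abs_Im_base_arg_le:
  assumes "j < N"
  shows "\<bar>Im (base_arg N x j)\<bar> \<le> \<bar>Im x\<bar> / sqrt (real N) + pi * (1 - 1 / real N)"
proof -
  have "\<bar>1 - (2 * real j + 1) / real N\<bar> \<le> 1 - 1 / real N"
    using assms by (auto simp: field_simps abs_le_iff)
  hence "\<bar>pi * (1 - (2 * real j + 1) / real N)\<bar> \<le> pi * (1 - 1 / real N)"
    unfolding abs_mult by (simp add: mult_left_mono)
  moreover have "Im (base_arg N x j) = Im x / sqrt (real N) + pi * (1 - (2 * real j + 1) / real N)"
    by (simp add: base_arg_def Im_divide_of_real)
  moreover have "\<bar>Im x / sqrt (real N)\<bar> = \<bar>Im x\<bar> / sqrt (real N)" by simp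
  ultimately show ?thesis by linarith
qed

lemma abs_Im_level_arg_le:
  assumes "j < N"
  shows "\<bar>Im (level_arg N b x n j)\<bar> \<le> \<bar>Im x\<bar> / sqrt (real N) + pi * (1 - 1 / real N) * (1 + b\<^sup>2)"
proof -
  have "\<bar>b\<^sup>2 * arg_shift N n j\<bar> \<le> b\<^sup>2 * (pi * (1 - 1 / real N))"
    using abs_arg_shift_le[of N n j] assms unfolding abs_mult by (simp add: mult_left_mono)
  moreover have "Im (level_arg N b x n j) = Im (base_arg N x j) + b\<^sup>2 * arg_shift N n j"
    by (simp add: level_arg_def)
  ultimately show ?thesis
    using abs_Im_base_arg_le[OF assms, of x] by (simp add: algebra_simps)
qed

definition level_strip :: "nat \<Rightarrow> complex set" where
  "level_strip N = {x. \<bar>Im x\<bar> < pi / sqrt (real N)}"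

lemma minus_level_strip [simp]: "- x \<in> level_strip N \<longleftrightarrow> x \<in> level_strip N"
  by (simp add: level_strip_def)

lemma cnj_level_strip [simp]: "cnj x \<in> level_strip N \<longleftrightarrow> x \<in> level_strip N"
  by (simp add: level_strip_def)

lemma open_level_strip: "open (level_strip N)"
  unfolding level_strip_def by (intro open_Collect_less continuous_intros)

lemma level_strip_bound:
  assumes "N > 0" "\<bar>y\<bar> < pi / sqrt (real N)"
  shows "\<bar>y\<bar> / sqrt (real N) < pi / real N"
proof -
  have "\<bar>y\<bar> / sqrt (real N) < (pi / sqrt (real N)) / sqrt (real N)"
    using assms by (intro divide_strict_right_mono) auto
  thus ?thesis using assms by simp
qed

text \<open>All arguments stay in the strip where \<open>\<Phi>\<^sub>b\<close> is given by the integral, so its continuation never matters.\<close>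

lemma level_arg_in_strip:
  assumes "j < N" "x \<in> level_strip N"
  shows "\<bar>Im (level_arg N b x n j)\<bar> < pi * (1 + b\<^sup>2)"
proof -
  have "\<bar>Im x\<bar> / sqrt (real N) < pi / real N"
    using assms by (intro level_strip_bound) (auto simp: level_strip_def)
  moreover have "pi / real N + pi * (1 - 1 / real N) * (1 + b\<^sup>2) = pi * (1 + b\<^sup>2) - pi / real N * b\<^sup>2"
    by (simp add: field_simps)
  moreover have "pi / real N * b\<^sup>2 \<ge> 0" by simp
  ultimately show ?thesis using abs_Im_level_arg_le[OF assms(1), of b x n] by linarith
qed

lemma base_arg_in_strip:
  assumes "j < N" "x \<in> level_strip N"
  shows "base_arg N x j \<in> strip_pi"
  using level_arg_in_strip[OF assms, of 0 0] by (simp add: level_arg_def strip_pi_def)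

lemma level_dilog_eq:
  assumes N: "N > 0" and b: "0 < b" "b < 1" and x: "x \<in> level_strip N"
  shows "level_dilog N b (x / of_real (2 * pi * b)) n = exp (\<Sum>j<N. faddeev_log b (level_arg N b x n j))"
proof -
  have "x / of_real (2 * pi * b) / of_real (sqrt (real N)) + (1 - 1 / of_nat N) * c_b b
         - \<i> * of_real (1 / b) * (of_nat j / of_nat N)
         - \<i> * of_real b * of_real (frac (of_int (int j + n) / real N)) = level_arg N b x n j / of_real (2 * pi * b)" for j
  proof -
    define X u B P F where "X = x / complex_of_real (sqrt (real N))" and "u = 1 / (of_nat N :: complex)"
      and "B = complex_of_real b" and "P = complex_of_real pi"
      and "F = complex_of_real (frac (of_int (int j + n) / real N))"
    have nz: "B \<noteq> 0" "P \<noteq> 0" using b by (auto simp: B_def P_def)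
    have "level_arg N b x n j = X + \<i> * P * (1 - (2 * of_nat j + 1) * u) + \<i> * B\<^sup>2 * (P * (1 - u) - 2 * P * F)"
      by (simp add: level_arg_def base_arg_def arg_shift_def X_def u_def B_def P_def F_def)
    moreover have "X / (2 * P * B) + (1 - u) * (\<i> * (B + 1 / B) / 2) - \<i> * (1 / B) * (of_nat j * u) - \<i> * B * F
       = (X + \<i> * P * (1 - (2 * of_nat j + 1) * u) + \<i> * B\<^sup>2 * (P * (1 - u) - 2 * P * F)) / (2 * P * B)"
      using nz by (simp add: field_simps power2_eq_square)
    ultimately show ?thesis
      by (simp add: c_b_def X_def u_def B_def P_def F_def mult_ac)
  qed
  hence "level_dilog N b (x / of_real (2 * pi * b)) n = (\<Prod>j<N. faddeev_dilog b (level_arg N b x n j / of_real (2 * pi * b)))"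
    unfolding level_dilog_def by (simp only:)
  also have "\<dots> = (\<Prod>j<N. exp (faddeev_log b (level_arg N b x n j)))"
    by (intro prod.cong refl faddeev_dilog_eq b level_arg_in_strip x) auto
  also have "\<dots> = exp (\<Sum>j<N. faddeev_log b (level_arg N b x n j))" by (simp add: exp_sum)
  finally show ?thesis .
qed

subsection \<open>The integrand\<close>

definition log_integrand :: "nat \<Rightarrow> real \<Rightarrow> int \<Rightarrow> complex \<Rightarrow> complex" where
  "log_integrand N b k x = (\<Sum>j<N. faddeev_log b (level_arg N b (- x) (- k) j)) - (\<Sum>j<N. faddeev_log b (level_arg N b x k j))"

lemma log_integrand_holomorphic:
  assumes b: "0 < b" "b < 1"
  shows "log_integrand N b k holomorphic_on level_strip N"
proof -
  have h: "(\<lambda>x. faddeev_log b (level_arg N b (f x) n j)) holomorphic_on level_strip N"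
    if "j < N" "f = (\<lambda>x. x) \<or> f = uminus" for f :: "complex \<Rightarrow> complex" and n j
  proof -
    have "(\<lambda>x. level_arg N b (f x) n j) holomorphic_on level_strip N"
      using that unfolding level_arg_def base_arg_def by (auto intro!: holomorphic_intros)
    moreover have "(\<lambda>x. level_arg N b (f x) n j) ` level_strip N \<subseteq> {z. \<bar>Im z\<bar> < pi * (1 + b\<^sup>2)}"
      using that by (auto intro!: level_arg_in_strip)
    ultimately show ?thesis
      using holomorphic_on_compose_gen[OF _ faddeev_log_holomorphic[OF b]] by (simp add: o_def)
  qed
  show ?thesis unfolding log_integrand_def
    using h[where f = "\<lambda>x. x"] h[where f = uminus] by (intro holomorphic_intros) auto
qed

text \<open>Up to bounded terms, the denominator contributes y max(t, 0) and the numerator y max(-t,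
  0) to the real part, each over 2 pi b^2; together this is y |t| with y < 0. The constant depends
  on b, so the estimate justifies contour shifts but no limit b -> 0.\<close>

lemma log_integrand_decay:
  assumes N: "N > 0" and b: "0 < b" "b < 1" and d: "0 < d1" "d2 < pi / sqrt (real N)"
  shows "\<exists>C. \<forall>t y. - d2 \<le> y \<and> y \<le> - d1 \<longrightarrow>
     norm (exp (log_integrand N b k (Complex t y))) \<le> C * exp (- (d1 / (2 * pi * b\<^sup>2)) * \<bar>t\<bar>)"
proof (cases "d1 \<le> d2")
  case True
  define v where "v = d2 / sqrt (real N) + pi * (1 - 1 / real N) * (1 + b\<^sup>2)"
  have v: "v < pi * (1 + b\<^sup>2)"
  proof -
    have "d2 / sqrt (real N) < pi / real N"
      using level_strip_bound[OF N, of d2] d True by auto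
    moreover have "pi / real N + pi * (1 - 1 / real N) * (1 + b\<^sup>2) = pi * (1 + b\<^sup>2) - pi / real N * b\<^sup>2"
      using N by (simp add: field_simps)
    moreover have "pi / real N * b\<^sup>2 \<ge> 0" by simp
    ultimately show ?thesis unfolding v_def by linarith
  qed
  obtain C where C: "\<And>z. \<bar>Im z\<bar> \<le> v \<Longrightarrow> \<bar>Re (faddeev_log b z) + max (Re z) 0 * Im z / (2 * pi * b\<^sup>2)\<bar> \<le> C"
    using Re_faddeev_log_bound[OF b v] by auto
  have key: "\<bar>(\<Sum>j<N. Re (faddeev_log b (level_arg N b x n j))) + max (Re x) 0 * Im x / (2 * pi * b\<^sup>2)\<bar> \<le> real N * C"
    if x: "\<bar>Im x\<bar> \<le> d2" for x n
  proof -
    have "(\<Sum>j<N. Re (faddeev_log b (level_arg N b x n j))) + max (Re x) 0 * Im x / (2 * pi * b\<^sup>2) =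
        (\<Sum>j<N. Re (faddeev_log b (level_arg N b x n j)) + max (Re (level_arg N b x n j)) 0 * Im (level_arg N b x n j) / (2 * pi * b\<^sup>2))"
    proof -
      have "(\<Sum>j<N. max (Re (level_arg N b x n j)) 0 * Im (level_arg N b x n j) / (2 * pi * b\<^sup>2))
          = max (Re x / sqrt (real N)) 0 / (2 * pi * b\<^sup>2) * (\<Sum>j<N. Im (level_arg N b x n j))"
        by (simp add: Re_level_arg sum_distrib_left)
      also have "\<dots> = (max (Re x / sqrt (real N)) 0 * sqrt (real N)) * Im x / (2 * pi * b\<^sup>2)"
        unfolding sum_level_arg_Im[OF N] by simp
      also have "max (Re x / sqrt (real N)) 0 * sqrt (real N) = max (Re x) 0"
        using N by (auto simp: max_def divide_le_0_iff zero_le_divide_iff)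
      finally show ?thesis by (simp add: sum.distrib)
    qed
    also have "\<bar>\<dots>\<bar> \<le> (\<Sum>j<N. C)"
    proof (intro order.trans[OF sum_abs] sum_mono C)
      fix j assume "j \<in> {..<N}"
      hence "\<bar>Im (level_arg N b x n j)\<bar> \<le> \<bar>Im x\<bar> / sqrt (real N) + pi * (1 - 1 / real N) * (1 + b\<^sup>2)"
        by (intro abs_Im_level_arg_le) auto
      also have "\<bar>Im x\<bar> / sqrt (real N) \<le> d2 / sqrt (real N)" using x by (intro divide_right_mono) auto
      finally show "\<bar>Im (level_arg N b x n j)\<bar> \<le> v" by (simp add: v_def)
    qed
    finally show ?thesis by simp
  qed
  show ?thesis
  proof (intro exI[of _ "exp (2 * (real N * C))"] allI impI, elim conjE)
    fix t y assume y: "- d2 \<le> y" "y \<le> - d1"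
    define x where "x = Complex t y"
    have "\<bar>Im x\<bar> \<le> d2" "\<bar>Im (- x)\<bar> \<le> d2" using y d by (auto simp: x_def)
    from key[OF this(1), of k] key[OF this(2), of "- k"]
    have "Re (log_integrand N b k x) \<le> 2 * (real N * C) + max t 0 * y / (2 * pi * b\<^sup>2) - max (- t) 0 * (- y) / (2 * pi * b\<^sup>2)"
      by (simp add: log_integrand_def x_def)
    also have "\<dots> = 2 * (real N * C) + y * \<bar>t\<bar> / (2 * pi * b\<^sup>2)" by (auto simp: max_def abs_if)
    also have "y * \<bar>t\<bar> / (2 * pi * b\<^sup>2) \<le> (- d1) * \<bar>t\<bar> / (2 * pi * b\<^sup>2)"
      using y by (intro divide_right_mono mult_right_mono) auto
    finally have "Re (log_integrand N b k x) \<le> 2 * (real N * C) + - (d1 / (2 * pi * b\<^sup>2)) * \<bar>t\<bar>" by simp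
    hence "exp (Re (log_integrand N b k x)) \<le> exp (2 * (real N * C) + - (d1 / (2 * pi * b\<^sup>2)) * \<bar>t\<bar>)" by simp
    thus "norm (exp (log_integrand N b k (Complex t y))) \<le> exp (2 * (real N * C)) * exp (- (d1 / (2 * pi * b\<^sup>2)) * \<bar>t\<bar>)"
      by (simp only: x_def norm_exp_eq_Re exp_add)
  qed
qed auto

lemma log_integrand_shift:
  assumes N: "N > 0" and b: "0 < b" "b < 1" and d: "0 < d1" "d1 < d2" "d2 < pi / sqrt (real N)"
  shows "(LBINT t. exp (log_integrand N b k (Complex t (- d2)))) = (LBINT t. exp (log_integrand N b k (Complex t (- d1))))"
proof -
  obtain C where C: "\<And>t y. - d2 \<le> y \<Longrightarrow> y \<le> - d1 \<Longrightarrow>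
     norm (exp (log_integrand N b k (Complex t y))) \<le> C * exp (- (d1 / (2 * pi * b\<^sup>2)) * \<bar>t\<bar>)"
    using log_integrand_decay[OF N b d(1,3)] by blast
  have kap: "0 < d1 / (2 * pi * b\<^sup>2)" using d b by simp
  have sub: "{w. - (pi / sqrt (real N)) < Im w \<and> Im w < 0} - {} \<subseteq> level_strip N"
    by (auto simp: level_strip_def abs_less_iff intro: less_trans[of _ 0])
  have holo: "(\<lambda>x. exp (log_integrand N b k x)) holomorphic_on {w. - (pi / sqrt (real N)) < Im w \<and> Im w < 0} - {}"
    by (intro holomorphic_intros holomorphic_on_subset[OF log_integrand_holomorphic[OF b] sub])
  show ?thesis
    using strip_contour_shift(3)[OF _ _ _ kap _ _ holo C] d by simp
qed

text \<open>The second height d' is free, so that it can be the saddle height whatever d is.\<close>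

lemma chi_4_1_eq:
  assumes N: "N > 0" and b: "0 < b" "b < 1"
    and d: "0 < d" "d < pi / sqrt (real N)" and d': "0 < d'" "d' < pi / sqrt (real N)"
  shows "chi_4_1 N b d = 1 / of_real (2 * pi * b * sqrt (real N)) *
     (\<Sum>k<N. LBINT t. exp (log_integrand N b (int k) (Complex t (- d'))))"
proof -
  have *: "(let x = of_real t - \<i> * of_real d
         in level_dilog N b (- x / of_real (2 * pi * b)) (- k) / level_dilog N b (x / of_real (2 * pi * b)) k)
       = exp (log_integrand N b k (Complex t (- d)))" for t k
  proof -
    have x: "of_real t - \<i> * of_real d = Complex t (- d)" by (simp add: complex_eq_iff)
    have xs: "Complex t (- d) \<in> level_strip N" "- Complex t (- d) \<in> level_strip N"
      using d unfolding minus_level_strip by (simp_all add: level_strip_def)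
    show ?thesis unfolding x Let_def level_dilog_eq[OF N b xs(1)] level_dilog_eq[OF N b xs(2)]
      by (simp add: log_integrand_def exp_diff)
  qed
  have "(LBINT t. exp (log_integrand N b k (Complex t (- d)))) = (LBINT t. exp (log_integrand N b k (Complex t (- d'))))" for k
    using log_integrand_shift[OF N b, of d d'] log_integrand_shift[OF N b, of d' d] d d'
    by (cases d d' rule: linorder_cases) auto
  moreover have "{0..<int N} = int ` {..<N}"
    by (auto simp: image_iff intro!: bexI[of _ "nat _"])
  ultimately show ?thesis
    unfolding chi_4_1_def * by (simp add: sum.reindex)
qed

subsection \<open>The distribution relation\<close>

text \<open>Multiplication by \<open>sinh (y / of_nat N)\<close> makes the symmetric geometric sum
  telescope.\<close>

lemma sinh_sum_exp:
  fixes y :: complex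
  assumes "N > 0"
  shows "sinh (y / of_nat N) * (\<Sum>j<N. exp (y * of_real (1 - (2 * real j + 1) / real N))) = sinh y"
proof -
  have "sinh (y / of_nat N) * exp (y * of_real (1 - (2 * real j + 1) / real N)) =
      (exp (y * of_real (1 - 2 * real j / real N)) - exp (y * of_real (1 - 2 * real (Suc j) / real N))) / 2" for j
  proof -
    have e: "y / of_nat N + y * of_real (1 - (2 * real j + 1) / real N) = y * of_real (1 - 2 * real j / real N)"
      "- (y / of_nat N) + y * of_real (1 - (2 * real j + 1) / real N) = y * of_real (1 - 2 * real (Suc j) / real N)"
      using assms by (simp_all add: field_simps)
    show ?thesis unfolding sinh_field_def times_divide_eq_left left_diff_distrib exp_add[symmetric] e ..
  qed
  hence "sinh (y / of_nat N) * (\<Sum>j<N. exp (y * of_real (1 - (2 * real j + 1) / real N))) =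
      (\<Sum>j<N. (exp (y * of_real (1 - 2 * real j / real N)) - exp (y * of_real (1 - 2 * real (Suc j) / real N)))) / 2"
    unfolding sum_distrib_left sum_divide_distrib by (intro sum.cong refl)
  also have "(\<Sum>j<N. (exp (y * of_real (1 - 2 * real j / real N)) - exp (y * of_real (1 - 2 * real (Suc j) / real N))))
      = exp y - exp (- y)"
    using sum_lessThan_telescope'[of "\<lambda>j. exp (y * of_real (1 - 2 * real j / real N))" N] assms by simp
  finally show ?thesis by (simp add: sinh_field_def)
qed

lemma scaled_arg_in_strip:
  assumes "N > 0" "x \<in> level_strip N"
  shows "of_real (sqrt (real N)) * x \<in> strip_pi"
  using assms by (simp add: level_strip_def strip_pi_def abs_mult field_simps)

text \<open>Summed over the residues, the exponentials in the integral representation form a geometric series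
  with sum \<open>sinh y / sinh (y / N)\<close>.\<close>

lemma dilog_exp_distribution:
  assumes N: "N > 0" and x: "x \<in> level_strip N"
  shows "(\<Sum>j<N. dilog_exp (base_arg N x j)) = dilog_exp (of_real (sqrt (real N)) * x) / of_nat N"
proof -
  let ?r = "of_real (sqrt (real N)) :: complex"
  define k where "k z w = exp (- \<i> * z * w / of_real pi) * pole_kernel 2 w" for z w
  have r2: "?r * ?r = of_nat N"
    by (metis of_real_mult of_real_of_nat_eq of_nat_0_le_iff real_sqrt_mult_self abs_of_nonneg)
  have r0: "?r \<noteq> 0" using N by simp
  have int: "integrable lborel (\<lambda>t. k (base_arg N x j) (Complex t 1))" if "j < N" for j
    using line_transform_height(1)[OF strip_decay_pole_kernel, of "base_arg N x j" 1 2] base_arg_in_strip[OF that x]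
    by (simp add: k_def strip_pi_def)
  have sum_k: "(\<Sum>j<N. k (base_arg N x j) w) = k (?r * x) (w / of_nat N) / of_nat N ^ 2" if w: "\<bar>Im w\<bar> < pi" "w \<noteq> 0" for w
  proof -
    have "k (base_arg N x j) w = exp (- \<i> * x * w / (?r * of_real pi)) * pole_kernel 2 w * exp (w * of_real (1 - (2 * real j + 1) / real N))" for j
    proof -
      have "- \<i> * base_arg N x j * w / of_real pi = - \<i> * x * w / (?r * of_real pi) + w * of_real (1 - (2 * real j + 1) / real N)"
        using r0 by (simp add: base_arg_def field_simps)
      thus ?thesis unfolding k_def by (simp only: exp_add mult_ac)
    qed
    hence "(\<Sum>j<N. k (base_arg N x j) w) = exp (- \<i> * x * w / (?r * of_real pi)) * pole_kernel 2 w *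
        (\<Sum>j<N. exp (w * of_real (1 - (2 * real j + 1) / real N)))"
      by (simp only: sum_distrib_left)
    also have "(\<Sum>j<N. exp (w * of_real (1 - (2 * real j + 1) / real N))) = sinh w / sinh (w / of_nat N)"
    proof -
      have "\<bar>Im w\<bar> / real N \<le> \<bar>Im w\<bar>" using N by (simp add: divide_le_eq mult_le_cancel_left1)
      hence "sinh (w / of_nat N) \<noteq> 0"
        using w N by (intro sinh_nonzero) (auto simp: Im_divide_of_nat)
      thus ?thesis using sinh_sum_exp[OF N, of w] by (simp add: field_simps)
    qed
    also have "exp (- \<i> * x * w / (?r * of_real pi)) = exp (- \<i> * (?r * x) * (w / of_nat N) / of_real pi)"
      by (rule arg_cong[where f = exp]) (use r0 r2[symmetric] N in \<open>simp add: field_simps\<close>)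
    finally show ?thesis
      using w sinh_nonzero[of w] N by (simp add: k_def pole_kernel_def field_simps)
  qed
  have c: "Complex (real N * s) 1 / of_nat N = Complex s (1 / real N)" for s
    using N by (simp add: complex_eq_iff Re_divide_of_nat Im_divide_of_nat)
  have "(\<Sum>j<N. line_transform (pole_kernel 2) (base_arg N x j)) = (\<Sum>j<N. LBINT t. k (base_arg N x j) (Complex t 1))"
    by (simp add: line_transform_def k_def)
  also have "\<dots> = (LBINT t. \<Sum>j<N. k (base_arg N x j) (Complex t 1))"
    by (rule Bochner_Integration.integral_sum[symmetric]) (use int in auto)
  also have "\<dots> = (LBINT t. k (?r * x) (Complex t 1 / of_nat N) / of_nat N ^ 2)"
    using pi_gt3 by (subst sum_k) (auto simp: complex_eq_iff)
  \<comment> \<open>Substituting t = N s lowers the contour to height 1 / N, which does not change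
    the transform. The Jacobian N against the factor N^2 leaves 1 / N.\<close>
  also have "\<dots> = real N *\<^sub>R (LBINT s. k (?r * x) (Complex (real N * s) 1 / of_nat N) / of_nat N ^ 2)"
    using lborel_integral_real_affine[of "real N" "\<lambda>t. k (?r * x) (Complex t 1 / of_nat N) / of_nat N ^ 2" 0] N by simp
  also have "\<dots> = real N *\<^sub>R ((LBINT s. k (?r * x) (Complex s (1 / real N))) / of_nat N ^ 2)"
    unfolding c by simp
  also have "(LBINT s. k (?r * x) (Complex s (1 / real N))) = line_transform (pole_kernel 2) (?r * x)"
    unfolding k_def using N scaled_arg_in_strip[OF N x]
    by (intro line_transform_height(2)[OF strip_decay_pole_kernel]) (auto simp: strip_pi_def)
  finally have "(\<Sum>j<N. line_transform (pole_kernel 2) (base_arg N x j)) = line_transform (pole_kernel 2) (?r * x) / of_nat N"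
    using N by (simp add: scaleR_conv_of_real power2_eq_square)
  moreover have "(\<Sum>j<N. line_transform (pole_kernel 2) (base_arg N x j)) = (\<Sum>j<N. dilog_exp (base_arg N x j)) / (2 * of_real pi * \<i>)"
    unfolding sum_divide_distrib
    by (intro sum.cong refl line_transform_pole_kernel_2 base_arg_in_strip x) auto
  ultimately show ?thesis
    using line_transform_pole_kernel_2[OF scaled_arg_in_strip[OF N x]] N
    by (simp add: field_simps del: of_nat_eq_0_iff)
qed

definition log_term :: "nat \<Rightarrow> complex \<Rightarrow> nat \<Rightarrow> complex" where
  "log_term N x j = Ln (1 + exp (base_arg N x j))"

lemma base_arg_derivative: "N > 0 \<Longrightarrow> ((\<lambda>x. base_arg N x j) has_field_derivative 1 / of_real (sqrt (real N))) (at x)"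
  unfolding base_arg_def by (auto intro!: derivative_eq_intros)

text \<open>Obtained by differentiating the distribution relation. Taking logarithms of the
  factorisation of 1 + exp (sqrt N x) would determine the sum only up to a multiple of 2 pi
  i.\<close>

lemma sum_log_term:
  assumes N: "N > 0" and x: "x \<in> level_strip N"
  shows "(\<Sum>j<N. log_term N x j) = Ln (1 + exp (of_real (sqrt (real N)) * x))"
proof -
  let ?r = "of_real (sqrt (real N)) :: complex"
  have r2: "?r * ?r = of_nat N"
    by (metis of_real_mult of_real_of_nat_eq of_nat_0_le_iff real_sqrt_mult_self abs_of_nonneg)
  have r0: "?r \<noteq> 0" using N by simp
  have "((\<lambda>x. \<Sum>j<N. dilog_exp (base_arg N x j)) has_field_derivative (\<Sum>j<N. - log_term N x j * (1 / ?r))) (at x)"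
    unfolding log_term_def
    by (intro DERIV_sum DERIV_chain2[OF dilog_exp_derivative base_arg_derivative[OF N]] base_arg_in_strip x) auto
  moreover have "((\<lambda>x. dilog_exp (?r * x) / of_nat N) has_field_derivative (- Ln (1 + exp (?r * x)) * ?r) / of_nat N) (at x)"
    by (intro DERIV_cdivide DERIV_chain2[where f = dilog_exp and g = "\<lambda>x. ?r * x", OF dilog_exp_derivative[OF scaled_arg_in_strip[OF N x]]])
       (auto intro!: derivative_eq_intros)
  hence "((\<lambda>x. \<Sum>j<N. dilog_exp (base_arg N x j)) has_field_derivative (- Ln (1 + exp (?r * x)) * ?r) / of_nat N) (at x)"
    by (rule has_field_derivative_transform_within_open[OF _ open_level_strip x]) (simp add: dilog_exp_distribution[OF N])
  ultimately have "(\<Sum>j<N. - log_term N x j * (1 / ?r)) = (- Ln (1 + exp (?r * x)) * ?r) / of_nat N"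
    by (rule DERIV_unique)
  hence "- (\<Sum>j<N. log_term N x j) / ?r = - Ln (1 + exp (?r * x)) / ?r"
    unfolding r2[symmetric] using r0 by (simp add: sum_divide_distrib sum_negf)
  thus ?thesis using r0 by simp
qed

subsection \<open>The functions \<open>\<phi>\<close>\<close>

text \<open>Each residue drops by one, except at j = n, where it wraps from 0 to N - 1; this
  exceptional index is the factor that \<open>phi\<close> gains in its recursion.\<close>

lemma mod_diff_Suc:
  fixes j n N :: nat
  assumes "j < N" "Suc n < N"
  shows "(int j + - int (Suc n)) mod int N = (int j + - int n) mod int N - 1 + (if j = n then int N else 0)"
proof -
  have a: "(int j - int m) mod int N = (if m \<le> j then int j - int m else int j - int m + int N)" if "m < N" for m
  proof (cases "m \<le> j")
    case True thus ?thesis using assms by (simp add: mod_pos_pos_trivial)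
  next
    case False
    have "(int j - int m) mod int N = (int j - int m + int N) mod int N" by simp
    also have "\<dots> = int j - int m + int N" using False assms that by (intro mod_pos_pos_trivial) auto
    finally show ?thesis using False by simp
  qed
  show ?thesis unfolding add_uminus_conv_diff using a[of n] a[of "Suc n"] assms by auto
qed

lemma one_minus_exp_omega:
  assumes "N > 0"
  shows "1 - exp (x / of_real (sqrt (real N))) * omega_bar_pow N (real j + 1 / 2) = 1 + exp (base_arg N x j)"
proof -
  have "base_arg N x j = \<i> * of_real pi + (x / of_real (sqrt (real N)) + - 2 * of_real pi * \<i> * of_real (real j + 1 / 2) / of_nat N)"
    using assms by (simp add: base_arg_def field_simps)
  hence "exp (base_arg N x j) = exp (\<i> * of_real pi) * (exp (x / of_real (sqrt (real N))) * omega_bar_pow N (real j + 1 / 2))"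
    unfolding omega_bar_pow_def by (simp only: exp_add)
  thus ?thesis by simp
qed

text \<open>\<open>sum_log_term\<close> spreads every power of 1 + exp (sqrt N x) evenly over the N
  logarithms. For n = 0 the j-th one then has the coefficient j / N - (N - 1) / (2 N); a step of the
  recursion subtracts 1 / N from all coefficients and adds 1 at j = n, just as the residue in
  \<open>arg_shift\<close> moves.\<close>

lemma phi_eq:
  assumes N: "N > 0" and x: "x \<in> level_strip N" and n: "n < N"
  shows "phi N x n = exp (- (\<Sum>j<N. of_real (arg_shift N (- int n) j / (2 * pi)) * log_term N x j))"
  using n
proof (induction n)
  case 0
  let ?X = "of_real (sqrt (real N)) * x"
  have nz: "1 + exp ?X \<noteq> 0" by (rule one_plus_exp_nonzero[OF scaled_arg_in_strip[OF N x]])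
  have "(\<Prod>j<N. (1 - exp (x / of_real (sqrt (real N))) * omega_bar_pow N (real j + 1 / 2)) powr (of_nat j / of_nat N))
      = (\<Prod>j<N. exp (of_nat j / of_nat N * log_term N x j))"
    unfolding one_minus_exp_omega[OF N]
    by (intro prod.cong refl) (use one_plus_exp_nonzero base_arg_in_strip x in \<open>auto simp: powr_def log_term_def\<close>)
  also have "\<dots> = exp (\<Sum>j<N. of_nat j / of_nat N * log_term N x j)" by (simp add: exp_sum)
  moreover have "(1 + exp (x * of_real (sqrt (real N)))) powr (- (of_nat N - 1) / (2 * of_nat N))
      = exp (- (of_nat N - 1) / (2 * of_nat N) * (\<Sum>j<N. log_term N x j))"
    using nz by (simp add: powr_def sum_log_term[OF N x] mult.commute)
  ultimately have "phi N x 0 = exp (- (of_nat N - 1) / (2 * of_nat N) * (\<Sum>j<N. log_term N x j) + (\<Sum>j<N. of_nat j / of_nat N * log_term N x j))"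
    by (simp add: exp_add)
  also have "- (of_nat N - 1) / (2 * of_nat N) * (\<Sum>j<N. log_term N x j) + (\<Sum>j<N. of_nat j / of_nat N * log_term N x j)
      = (\<Sum>j<N. (- (of_nat N - 1) / (2 * of_nat N) + of_nat j / of_nat N) * log_term N x j)"
    by (simp only: sum_distrib_left sum.distrib distrib_right)
  also have "\<dots> = (\<Sum>j<N. - (of_real (arg_shift N (- int 0) j / (2 * pi)) * log_term N x j))"
  proof (rule sum.cong[OF refl])
    fix j assume "j \<in> {..<N}"
    hence "(int j + - int 0) mod int N = int j" by (simp add: mod_pos_pos_trivial)
    hence "arg_shift N (- int 0) j / (2 * pi) = (real N - 1) / (2 * real N) - real j / real N"
      unfolding arg_shift_eq[OF N] using N by (simp add: field_simps)
    hence "complex_of_real (arg_shift N (- int 0) j / (2 * pi)) = (of_nat N - 1) / (2 * of_nat N) - of_nat j / of_nat N"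
      by (simp only:) simp
    thus "(- (of_nat N - 1) / (2 * of_nat N) + of_nat j / of_nat N) * log_term N x j =
        - (of_real (arg_shift N (- int 0) j / (2 * pi)) * log_term N x j)"
      by (simp only:) (simp add: ring_distribs diff_divide_distrib)
  qed
  finally show ?case by (simp add: sum_negf)
next
  case (Suc n)
  let ?X = "of_real (sqrt (real N)) * x"
  have nz: "1 + exp ?X \<noteq> 0" by (rule one_plus_exp_nonzero[OF scaled_arg_in_strip[OF N x]])
  have "(1 + exp (x * of_real (sqrt (real N)))) powr (1 / of_nat N) = exp (1 / of_nat N * (\<Sum>j<N. log_term N x j))"
    using nz by (simp add: powr_def sum_log_term[OF N x] mult.commute)
  moreover have "1 + exp (base_arg N x n) = exp (log_term N x n)"
    using one_plus_exp_nonzero[OF base_arg_in_strip[OF _ x], of n] Suc.prems by (simp add: log_term_def)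
  ultimately have "phi N x (Suc n) = phi N x n * (exp (log_term N x n) / exp (1 / of_nat N * (\<Sum>j<N. log_term N x j)))"
    by (simp only: phi.simps one_minus_exp_omega[OF N])
  also have "\<dots> = exp (- (\<Sum>j<N. of_real (arg_shift N (- int n) j / (2 * pi)) * log_term N x j)
      + (log_term N x n - 1 / of_nat N * (\<Sum>j<N. log_term N x j)))"
    using Suc by (simp only: Suc_lessD exp_add exp_diff)
  also have "- (\<Sum>j<N. of_real (arg_shift N (- int n) j / (2 * pi)) * log_term N x j)
      + (log_term N x n - 1 / of_nat N * (\<Sum>j<N. log_term N x j)) =
      (\<Sum>j<N. - of_real (arg_shift N (- int n) j / (2 * pi)) * log_term N x j + ((if j = n then log_term N x j else 0) - 1 / of_nat N * log_term N x j))"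
    using Suc.prems by (simp add: sum.distrib sum_subtractf sum_negf sum_distrib_left)
  also have "\<dots> = (\<Sum>j<N. - (of_real (arg_shift N (- int (Suc n)) j / (2 * pi)) * log_term N x j))"
  proof (rule sum.cong[OF refl])
    fix j assume "j \<in> {..<N}"
    have "arg_shift N (- int (Suc n)) j / (2 * pi) = arg_shift N (- int n) j / (2 * pi) + 1 / real N - (if j = n then 1 else 0)"
    proof -
      define m where "m = real_of_int ((int j + - int n) mod int N)"
      have "real_of_int ((int j + - int (Suc n)) mod int N) = m - 1 + (if j = n then real N else 0)"
        unfolding m_def using mod_diff_Suc[of j N n] Suc.prems \<open>j \<in> {..<N}\<close>
        by (cases "j = n") (simp_all only: lessThan_iff of_int_add of_int_diff of_int_1 of_int_of_nat_eq if_True if_False of_int_0 simp_thms)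
      thus ?thesis unfolding arg_shift_eq[OF N] m_def[symmetric] using N by (simp only:) (simp add: field_simps)
    qed
    hence "complex_of_real (arg_shift N (- int (Suc n)) j / (2 * pi)) =
        of_real (arg_shift N (- int n) j / (2 * pi)) + 1 / of_nat N - (if j = n then 1 else 0)"
      by (simp only:) simp
    thus "- of_real (arg_shift N (- int n) j / (2 * pi)) * log_term N x j + ((if j = n then log_term N x j else 0) - 1 / of_nat N * log_term N x j)
        = - (of_real (arg_shift N (- int (Suc n)) j / (2 * pi)) * log_term N x j)"
      by (simp only:) (simp add: ring_distribs)
  qed
  finally show ?case by (simp add: sum_negf)
qed

lemma arg_shift_reflect:
  assumes "j < N"
  shows "arg_shift N (- k) (N - Suc j) = - arg_shift N k j"
proof -
  have N: "N > 0" using assms by simp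
  have "(int (N - Suc j) + - k) mod int N = int N - 1 - (int j + k) mod int N"
  proof -
    have "(int (N - Suc j) + - k) mod int N = (int N - 1 - (int j + k)) mod int N"
      using assms by (simp add: of_nat_diff algebra_simps)
    also have "\<dots> = (int N - 1 - (int j + k) mod int N) mod int N" by (rule mod_diff_right_eq[symmetric])
    also have "\<dots> = int N - 1 - (int j + k) mod int N"
      using N pos_mod_bound[of "int N" "int j + k"] pos_mod_sign[of "int N" "int j + k"]
      by (intro mod_pos_pos_trivial) linarith+
    finally show ?thesis .
  qed
  hence "real_of_int ((int (N - Suc j) + - k) mod int N) = real N - 1 - real_of_int ((int j + k) mod int N)"
    by (simp only: of_int_diff of_int_1 of_int_of_nat_eq)
  moreover have "pi * (real N - 1 - 2 * (real N - 1 - m)) = - (pi * (real N - 1 - 2 * m))" for m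
    by (simp add: algebra_simps)
  ultimately show ?thesis unfolding arg_shift_eq[OF N] by (simp only: minus_divide_left)
qed

lemma cnj_log_term:
  assumes "j < N" "x \<in> level_strip N"
  shows "cnj (log_term N (cnj x) j) = log_term N x (N - Suc j)"
proof -
  have "cnj (base_arg N (cnj x) j) = base_arg N x (N - Suc j)"
    using assms by (simp add: base_arg_def of_nat_diff complex_eq_iff field_simps)
  moreover have "cnj (Ln (1 + exp (base_arg N (cnj x) j))) = Ln (cnj (1 + exp (base_arg N (cnj x) j)))"
    using one_plus_exp_notin_nonpos[OF base_arg_in_strip[OF assms(1), of "cnj x"]] assms(2)
    by (intro cnj_Ln) simp
  ultimately show ?thesis by (simp add: log_term_def exp_cnj)
qed

text \<open>Conjugation reverses the order of the points \<open>base_arg\<close>, and reversing j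
  sends each residue r to N - 1 - r, so the shift changes sign. This is the limiting form of 1 /
  D_b(x, k) being the conjugate of D_b(x, -k).\<close>

lemma phi_bar_eq:
  assumes N: "N > 0" and x: "x \<in> level_strip N" and k: "k < N"
  shows "phi_bar N x k = exp (\<Sum>j<N. of_real (arg_shift N (int k) j / (2 * pi)) * log_term N x j)"
proof -
  have "phi_bar N x k = exp (- (\<Sum>j<N. of_real (arg_shift N (- int k) j / (2 * pi)) * cnj (log_term N (cnj x) j)))"
    unfolding phi_bar_def using phi_eq[OF N _ k, of "cnj x"] x by (simp add: exp_cnj)
  also have "(\<Sum>j<N. of_real (arg_shift N (- int k) j / (2 * pi)) * cnj (log_term N (cnj x) j))
     = (\<Sum>j<N. of_real (arg_shift N (- int k) (N - Suc j) / (2 * pi)) * cnj (log_term N (cnj x) (N - Suc j)))"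
    by (rule sum.nat_diff_reindex[symmetric])
  also have "\<dots> = (\<Sum>j<N. - (of_real (arg_shift N (int k) j / (2 * pi)) * log_term N x j))"
  proof (rule sum.cong[OF refl])
    fix j assume "j \<in> {..<N}"
    hence j: "j < N" by simp
    have "N - Suc (N - Suc j) = j" using j by simp
    thus "of_real (arg_shift N (- int k) (N - Suc j) / (2 * pi)) * cnj (log_term N (cnj x) (N - Suc j)) =
      - (of_real (arg_shift N (int k) j / (2 * pi)) * log_term N x j)"
      using cnj_log_term[of "N - Suc j" N x] x j arg_shift_reflect[OF j, of "int k"] by simp
  qed
  finally show ?thesis by (simp add: sum_negf)
qed

text \<open>The part of \<open>log_integrand\<close> of order b^0: each shift i b^2 s multiplies the
  derivative - Ln (1 + exp z) / (2 pi i b^2) of the leading term.\<close>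

definition log_amplitude :: "nat \<Rightarrow> int \<Rightarrow> complex \<Rightarrow> complex" where
  "log_amplitude N k x = (\<Sum>j<N. of_real (arg_shift N k j / (2 * pi)) * log_term N x j)
     - (\<Sum>j<N. of_real (arg_shift N (- k) j / (2 * pi)) * log_term N (- x) j)"

lemma exp_log_amplitude:
  assumes "N > 0" "x \<in> level_strip N" "k < N"
  shows "exp (log_amplitude N (int k) x) = phi N (- x) k * phi_bar N x k"
  using assms unfolding log_amplitude_def by (simp add: phi_eq phi_bar_eq exp_diff exp_minus field_simps)

lemma sum_phi_nonzero:
  assumes N: "N > 0" and x: "x \<in> level_strip N" and "Re x = 0"
  shows "(\<Sum>k<N. phi N (- x) k * phi_bar N x k) \<noteq> 0"
proof -
  have "cnj x = - x" using assms by (simp add: complex_eq_iff)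
  hence "(\<Sum>k<N. phi N (- x) k * phi_bar N x k) = of_real (\<Sum>k<N. (norm (phi N (- x) k))\<^sup>2)"
    by (simp only: phi_bar_def complex_norm_square of_real_sum)
  moreover have "(\<Sum>k<N. (norm (phi N (- x) k))\<^sup>2) > 0"
    using N x by (intro sum_pos) (auto simp: phi_eq)
  ultimately show ?thesis by (metis less_irrefl of_real_eq_0_iff)
qed

subsection \<open>Semiclassical expansion of the integrand\<close>

text \<open>With r = exp (Re z) the square is 1 + 2 r cos (Im z) + r^2. The cosine stays above some
  c > -1, and 2 r \<le> 1 + r^2; the minimum with 0 gives c the sign needed to combine the
  two.\<close>

lemma one_plus_exp_lower_bound:
  assumes "v < pi"
  shows "\<exists>m>0. \<forall>z. \<bar>Im z\<bar> \<le> v \<longrightarrow> (norm (1 + exp z))\<^sup>2 \<ge> m * (1 + exp (2 * Re z))"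
proof (rule exI[of _ "1 + min (cos (max v 0)) 0"], intro conjI allI impI)
  have "cos pi < cos (max v 0)" using assms by (intro cos_monotone_0_pi) auto
  thus "0 < 1 + min (cos (max v 0)) 0" by (auto simp: min_def)
  fix z :: complex assume z: "\<bar>Im z\<bar> \<le> v"
  define r c where "r = exp (Re z)" and "c = min (cos (max v 0)) 0"
  have r: "r > 0" by (simp add: r_def)
  have "cos (max v 0) \<le> cos \<bar>Im z\<bar>" using z assms by (intro cos_monotone_0_pi_le) auto
  hence c: "c \<le> cos (Im z)" "c \<le> 0" by (auto simp: c_def)
  have "(norm (1 + exp z))\<^sup>2 = (1 + r * cos (Im z))\<^sup>2 + (r * sin (Im z))\<^sup>2"
    by (simp add: cmod_power2 Re_exp Im_exp r_def)
  also have "\<dots> = 1 + 2 * r * cos (Im z) + r\<^sup>2 * ((cos (Im z))\<^sup>2 + (sin (Im z))\<^sup>2)"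
  proof -
    have "(1 + r * p)\<^sup>2 + (r * q)\<^sup>2 = 1 + 2 * r * p + r\<^sup>2 * (p\<^sup>2 + q\<^sup>2)" for p q
      by (simp add: power2_eq_square algebra_simps)
    thus ?thesis .
  qed
  also have "\<dots> = 1 + (2 * r) * cos (Im z) + r\<^sup>2" by (simp only: sin_cos_squared_add2)
  finally have eq: "(norm (1 + exp z))\<^sup>2 = 1 + (2 * r) * cos (Im z) + r\<^sup>2" .
  have "(1 + r\<^sup>2) * c \<le> (2 * r) * c"
  proof (rule mult_right_mono_neg)
    have "0 \<le> (1 - r)\<^sup>2" by simp
    thus "2 * r \<le> 1 + r\<^sup>2" by (simp add: power2_eq_square algebra_simps)
  qed (use c in auto)
  also have "\<dots> \<le> (2 * r) * cos (Im z)" using c r by (intro mult_left_mono) auto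
  finally have "(1 + c) * (1 + r\<^sup>2) \<le> (norm (1 + exp z))\<^sup>2" unfolding eq by (simp add: algebra_simps)
  moreover have "r\<^sup>2 = exp (2 * Re z)" by (simp add: r_def exp_double)
  ultimately show "(1 + min (cos (max v 0)) 0) * (1 + exp (2 * Re z)) \<le> (norm (1 + exp z))\<^sup>2" by (simp add: c_def)
qed

text \<open>The quotient is minus the second derivative of \<open>dilog_exp\<close>; its bound makes
  the Taylor remainder uniform in Re z.\<close>

lemma logistic_bound:
  assumes "v < pi"
  shows "\<exists>B\<ge>0. \<forall>z. \<bar>Im z\<bar> \<le> v \<longrightarrow> norm (exp z / (1 + exp z)) \<le> B"
proof -
  obtain m where m: "m > 0" "\<And>z. \<bar>Im z\<bar> \<le> v \<Longrightarrow> (norm (1 + exp z))\<^sup>2 \<ge> m * (1 + exp (2 * Re z))"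
    using one_plus_exp_lower_bound[OF assms] by blast
  show ?thesis
  proof (intro exI[of _ "sqrt (1 / m)"] conjI allI impI)
    show "0 \<le> sqrt (1 / m)" using m by simp
    fix z assume z: "\<bar>Im z\<bar> \<le> v"
    have "m * exp (2 * Re z) \<le> m * (1 + exp (2 * Re z))" using m by simp
    also have "\<dots> \<le> (norm (1 + exp z))\<^sup>2" by (rule m(2)[OF z])
    finally have "m * exp (2 * Re z) \<le> (norm (1 + exp z))\<^sup>2" .
    moreover have "0 < m * exp (2 * Re z)" using m by simp
    ultimately have "exp (2 * Re z) / (norm (1 + exp z))\<^sup>2 \<le> 1 / m"
      using m by (simp add: divide_le_eq le_divide_eq mult.commute)
    moreover have "(norm (exp z / (1 + exp z)))\<^sup>2 = exp (2 * Re z) / (norm (1 + exp z))\<^sup>2"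
      by (simp add: norm_divide power_divide exp_double)
    ultimately have "(norm (exp z / (1 + exp z)))\<^sup>2 \<le> 1 / m" by simp
    thus "norm (exp z / (1 + exp z)) \<le> sqrt (1 / m)" by (rule real_le_rsqrt)
  qed
qed

lemma Ln_one_plus_exp_bound:
  assumes "v < pi"
  shows "\<exists>B\<ge>0. \<forall>z. \<bar>Im z\<bar> \<le> v \<longrightarrow> norm (Ln (1 + exp z)) \<le> B + \<bar>Re z\<bar>"
proof -
  obtain m where m: "m > 0" "\<And>z. \<bar>Im z\<bar> \<le> v \<Longrightarrow> (norm (1 + exp z))\<^sup>2 \<ge> m * (1 + exp (2 * Re z))"
    using one_plus_exp_lower_bound[OF assms] by blast
  show ?thesis
  proof (intro exI[of _ "\<bar>ln m\<bar> + ln 2 + pi"] conjI allI impI)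
    show "0 \<le> \<bar>ln m\<bar> + ln 2 + pi" by simp
    fix z assume z: "\<bar>Im z\<bar> \<le> v"
    define w where "w = 1 + exp z"
    have w0: "w \<noteq> 0" unfolding w_def using z assms by (intro one_plus_exp_nonzero) (auto simp: strip_pi_def)
    have "norm w \<le> 1 + exp (Re z)" unfolding w_def by (rule order.trans[OF norm_triangle_ineq]) simp
    also have "\<dots> \<le> exp \<bar>Re z\<bar> + exp \<bar>Re z\<bar>" by (intro add_mono) auto
    finally have "norm w \<le> 2 * exp \<bar>Re z\<bar>" by simp
    hence "ln (norm w) \<le> ln (2 * exp \<bar>Re z\<bar>)" using w0 by (subst ln_le_cancel_iff) auto
    hence up: "ln (norm w) \<le> ln 2 + \<bar>Re z\<bar>" by (simp add: ln_mult)
    have "m * 1 \<le> m * (1 + exp (2 * Re z))" using m by (intro mult_left_mono) auto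
    also have "\<dots> \<le> (norm w)\<^sup>2" unfolding w_def by (rule m(2)[OF z])
    finally have "ln m \<le> ln ((norm w)\<^sup>2)" using m w0 by (subst ln_le_cancel_iff) auto
    also have "ln ((norm w)\<^sup>2) = 2 * ln (norm w)" using w0 by (simp add: ln_realpow)
    finally have lo: "ln m / 2 \<le> ln (norm w)" by simp
    have "\<bar>ln (norm w)\<bar> \<le> \<bar>ln m\<bar> + ln 2 + \<bar>Re z\<bar>" using up lo by (simp add: abs_le_iff) linarith
    moreover have "norm (Ln w) \<le> \<bar>Re (Ln w)\<bar> + \<bar>Im (Ln w)\<bar>" by (rule cmod_le)
    moreover have "\<bar>Im (Ln w)\<bar> \<le> pi" using Im_Ln_le_pi[OF w0] mpi_less_Im_Ln[OF w0] by (simp add: abs_le_iff)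
    moreover have "Re (Ln w) = ln (norm w)" using w0 by (rule Re_Ln)
    ultimately show "norm (Ln (1 + exp z)) \<le> \<bar>ln m\<bar> + ln 2 + pi + \<bar>Re z\<bar>" by (simp add: w_def)
  qed
qed

lemma dilog_exp_Taylor:
  assumes v: "v < pi"
  shows "\<exists>B\<ge>0. \<forall>z w. \<bar>Im z\<bar> \<le> v \<and> \<bar>Im w\<bar> \<le> v \<longrightarrow>
     norm (dilog_exp w - (dilog_exp z - Ln (1 + exp z) * (w - z))) \<le> B * (norm (w - z))\<^sup>2"
proof -
  obtain B where B: "B \<ge> 0" "\<And>z. \<bar>Im z\<bar> \<le> v \<Longrightarrow> norm (exp z / (1 + exp z)) \<le> B"
    using logistic_bound[OF v] by blast
  define S where "S = {z. \<bar>Im z\<bar> \<le> v}"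
  have sub: "S \<subseteq> strip_pi" using v by (auto simp: S_def strip_pi_def)
  have convex: "convex S"
  proof -
    have "S = {z. Im z \<le> v} \<inter> {z. Im z \<ge> - v}" by (auto simp: S_def abs_le_iff)
    thus ?thesis by (metis convex_Int convex_halfspace_Im_le convex_halfspace_Im_ge)
  qed
  define f where "f i = (if i = 0 then dilog_exp else if i = 1 then (\<lambda>z. - Ln (1 + exp z)) else (\<lambda>z. - (exp z / (1 + exp z))))" for i :: nat
  have d: "(f i has_field_derivative f (Suc i) x) (at x within S)" if "x \<in> S" "i \<le> 1" for i x
  proof -
    have x: "x \<in> strip_pi" using that sub by auto
    consider "i = 0" | "i = 1" using \<open>i \<le> 1\<close> by linarith
    thus ?thesis
    proof cases
      case 1 thus ?thesis using dilog_exp_derivative[OF x] by (auto simp: f_def intro: has_field_derivative_at_within)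
    next
      case 2 thus ?thesis using DERIV_minus[OF Ln_one_plus_exp_derivative[OF x]]
        by (auto simp: f_def intro: has_field_derivative_at_within)
    qed
  qed
  show ?thesis
  proof (intro exI[of _ B] conjI B(1) allI impI, elim conjE)
    fix z w assume zw: "\<bar>Im z\<bar> \<le> v" "\<bar>Im w\<bar> \<le> v"
    have "norm (f 0 w - (\<Sum>i\<le>1. f i z * (w - z) ^ i / fact i)) \<le> B * norm (w - z) ^ Suc 1 / fact 1"
    proof (rule complex_Taylor[where f = f and n = 1, OF convex d])
      show "norm (f (Suc 1) x) \<le> B" if "x \<in> S" for x
        using B(2)[of x] that by (simp add: f_def S_def)
    qed (use zw in \<open>auto simp: S_def\<close>)
    thus "norm (dilog_exp w - (dilog_exp z - Ln (1 + exp z) * (w - z))) \<le> B * (norm (w - z))\<^sup>2"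
      by (simp add: f_def power2_eq_square)
  qed
qed

lemma h_4_1_eq: "h_4_1 N x = dilog_exp (of_real (sqrt (real N)) * (- x)) - dilog_exp (of_real (sqrt (real N)) * x)"
  by (simp add: h_4_1_def dilog_exp_def)

text \<open>Each factor is compared twice: \<open>faddeev_log\<close> with its leading term at the
  shifted argument, and that term with its first-order Taylor polynomial at \<open>base_arg\<close>.
  The second error has order (b^2)^2 / b^2. The distribution relation collects the leading terms
  into h.\<close>

lemma log_integrand_semiclassical:
  assumes N: "N > 0" and d: "0 \<le> d" "d < pi / sqrt (real N)"
  shows "\<exists>K b\<^sub>0. K \<ge> 0 \<and> 0 < b\<^sub>0 \<and> b\<^sub>0 < 1 \<and> (\<forall>b k x. 0 < b \<and> b < b\<^sub>0 \<and> \<bar>Im x\<bar> \<le> d \<longrightarrow>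
     norm (log_integrand N b k x - (h_4_1 N x / (2 * of_real pi * \<i> * of_nat N * of_real (b\<^sup>2)) + log_amplitude N k x))
       \<le> K * b\<^sup>2 * (1 + \<bar>Re x\<bar>))"
proof -
  \<comment> \<open>The points \<open>base_arg\<close> keep distance at least e from the boundary of
    the strip |Im z| < pi. For b below \<open>b\<^sub>0\<close> the shifts are at most e / 2, so all
    arguments stay in |Im z| \<le> pi - e / 2.\<close>
  define e where "e = pi / real N - d / sqrt (real N)"
  have e: "e > 0" using level_strip_bound[OF N, of d] d by (simp add: e_def)
  define v where "v = pi - e / 2"
  have v: "v < pi" using e by (simp add: v_def)
  define b\<^sub>0 where "b\<^sub>0 = min (1/2) (sqrt (e / (2 * pi)))"
  have b0: "0 < b\<^sub>0" "b\<^sub>0 < 1" using e by (auto simp: b\<^sub>0_def)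
  obtain C where C: "C \<ge> 0" "\<And>b z. 0 < b \<Longrightarrow> b < 1 \<Longrightarrow> \<bar>Im z\<bar> \<le> v \<Longrightarrow>
     norm (faddeev_log b z - dilog_exp z / (2 * of_real pi * \<i> * of_real (b\<^sup>2))) \<le> C * b\<^sup>2 * (1 + \<bar>Re z\<bar>)"
    using faddeev_log_semiclassical[OF v] by blast
  obtain B where B: "B \<ge> 0" "\<And>z w. \<bar>Im z\<bar> \<le> v \<Longrightarrow> \<bar>Im w\<bar> \<le> v \<Longrightarrow>
     norm (dilog_exp w - (dilog_exp z - Ln (1 + exp z) * (w - z))) \<le> B * (norm (w - z))\<^sup>2"
    using dilog_exp_Taylor[OF v] by blast
  define K0 where "K0 = C + B * pi\<^sup>2 / (2 * pi)"
  have K0: "K0 \<ge> 0" using C B by (simp add: K0_def)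
  have term_bound: "norm (faddeev_log b (level_arg N b x n j) - (dilog_exp (base_arg N x j) / (2 * of_real pi * \<i> * of_real (b\<^sup>2))
       - of_real (arg_shift N n j / (2 * pi)) * log_term N x j)) \<le> K0 * b\<^sup>2 * (1 + \<bar>Re x\<bar>)"
    if b: "0 < b" "b < b\<^sub>0" and x: "\<bar>Im x\<bar> \<le> d" and j: "j < N" for b x n j
  proof -
    let ?w = "level_arg N b x n j" and ?z = "base_arg N x j"
    let ?c = "2 * of_real pi * \<i> * of_real (b\<^sup>2) :: complex"
    have b1: "b < 1" using b b0 by simp
    have b2: "b\<^sup>2 \<le> e / (2 * pi)"
    proof -
      have "b \<le> sqrt (e / (2 * pi))" using b by (simp add: b\<^sub>0_def)
      hence "b\<^sup>2 \<le> (sqrt (e / (2 * pi)))\<^sup>2" using b by (intro power_mono) auto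
      thus ?thesis using e by simp
    qed
    have dx: "\<bar>Im x\<bar> / sqrt (real N) \<le> d / sqrt (real N)" using x by (intro divide_right_mono) auto
    have pe: "pi * (1 - 1 / real N) + d / sqrt (real N) = pi - e" by (simp add: e_def algebra_simps)
    have z: "\<bar>Im ?z\<bar> \<le> v"
      using abs_Im_base_arg_le[OF j, of x] dx pe e by (simp add: v_def)
    have w: "\<bar>Im ?w\<bar> \<le> v"
    proof -
      have "pi * (1 - 1 / real N) * b\<^sup>2 \<le> pi * 1 * (e / (2 * pi))"
        using b2 N by (intro mult_mono) auto
      moreover have "pi * (1 - 1 / real N) * (1 + b\<^sup>2) = pi * (1 - 1 / real N) + pi * (1 - 1 / real N) * b\<^sup>2"
        by (simp add: algebra_simps)
      moreover have "pi * 1 * (e / (2 * pi)) = e / 2" by simp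
      ultimately show ?thesis
        using abs_Im_level_arg_le[OF j, of b x n] dx pe unfolding v_def by linarith
    qed
    have wz: "?w - ?z = \<i> * of_real (b\<^sup>2 * arg_shift N n j)" by (simp add: level_arg_def)
    have "\<bar>arg_shift N n j\<bar> \<le> pi * 1"
      by (rule order.trans[OF abs_arg_shift_le[OF N]]) (use N in \<open>intro mult_left_mono; simp\<close>)
    hence "b\<^sup>2 * \<bar>arg_shift N n j\<bar> \<le> b\<^sup>2 * pi" by (intro mult_left_mono) auto
    hence nwz: "norm (?w - ?z) \<le> b\<^sup>2 * pi" unfolding wz by (simp add: norm_mult norm_power abs_mult)
    have t1: "norm (faddeev_log b ?w - dilog_exp ?w / ?c) \<le> C * b\<^sup>2 * (1 + \<bar>Re x\<bar>)"
    proof -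
      have "norm (faddeev_log b ?w - dilog_exp ?w / ?c) \<le> C * b\<^sup>2 * (1 + \<bar>Re ?w\<bar>)"
        by (rule C(2)[OF b(1) b1 w])
      also have "\<bar>Re ?w\<bar> \<le> \<bar>Re x\<bar>"
        using N by (simp add: Re_level_arg divide_le_eq mult_le_cancel_left1)
      hence "C * b\<^sup>2 * (1 + \<bar>Re ?w\<bar>) \<le> C * b\<^sup>2 * (1 + \<bar>Re x\<bar>)" using C(1) by (intro mult_left_mono) auto
      finally show ?thesis .
    qed
    have t2: "norm ((dilog_exp ?w - (dilog_exp ?z - Ln (1 + exp ?z) * (?w - ?z))) / ?c) \<le> B * pi\<^sup>2 / (2 * pi) * b\<^sup>2 * (1 + \<bar>Re x\<bar>)"
    proof -
      have "norm (dilog_exp ?w - (dilog_exp ?z - Ln (1 + exp ?z) * (?w - ?z))) \<le> B * (b\<^sup>2 * pi)\<^sup>2"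
        by (rule order.trans[OF B(2)[OF z w]]) (use B(1) nwz in \<open>intro mult_left_mono power_mono; simp\<close>)
      moreover have "norm ?c = 2 * pi * b\<^sup>2" by (simp add: norm_mult norm_power)
      ultimately have "norm ((dilog_exp ?w - (dilog_exp ?z - Ln (1 + exp ?z) * (?w - ?z))) / ?c) \<le> B * (b\<^sup>2 * pi)\<^sup>2 / (2 * pi * b\<^sup>2)"
        unfolding norm_divide by (simp only:) (intro divide_right_mono; simp)
      also have "\<dots> = B * pi\<^sup>2 / (2 * pi) * b\<^sup>2 * 1" using b by (simp add: power2_eq_square)
      also have "\<dots> \<le> B * pi\<^sup>2 / (2 * pi) * b\<^sup>2 * (1 + \<bar>Re x\<bar>)" using B(1) by (intro mult_left_mono) auto
      finally show ?thesis .
    qed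
    have "Ln (1 + exp ?z) * (?w - ?z) / ?c = of_real (arg_shift N n j / (2 * pi)) * log_term N x j"
      unfolding wz log_term_def using b by (simp add: field_simps)
    hence "faddeev_log b ?w - (dilog_exp ?z / ?c - of_real (arg_shift N n j / (2 * pi)) * log_term N x j)
        = (faddeev_log b ?w - dilog_exp ?w / ?c) + (dilog_exp ?w - (dilog_exp ?z - Ln (1 + exp ?z) * (?w - ?z))) / ?c"
      by (simp only: diff_divide_distrib) simp
    also have "norm \<dots> \<le> C * b\<^sup>2 * (1 + \<bar>Re x\<bar>) + B * pi\<^sup>2 / (2 * pi) * b\<^sup>2 * (1 + \<bar>Re x\<bar>)"
      by (rule order.trans[OF norm_triangle_ineq add_mono[OF t1 t2]])
    finally show ?thesis by (simp add: K0_def algebra_simps)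
  qed
  show ?thesis
  proof (rule exI[of _ "2 * real N * K0"], rule exI[of _ b\<^sub>0], intro conjI allI impI b0, goal_cases)
    case 1 thus ?case using K0 by simp
  next
    case (2 b k x)
    hence b: "0 < b" "b < b\<^sub>0" and x: "\<bar>Im x\<bar> \<le> d" "\<bar>Im (- x)\<bar> \<le> d" by auto
    let ?c = "2 * of_real pi * \<i> * of_real (b\<^sup>2) :: complex"
    define T where "T x n j = faddeev_log b (level_arg N b x n j) - (dilog_exp (base_arg N x j) / ?c - of_real (arg_shift N n j / (2 * pi)) * log_term N x j)" for x n j
    have sumT: "norm (\<Sum>j<N. T x n j) \<le> real N * (K0 * b\<^sup>2 * (1 + \<bar>Re x\<bar>))" if "\<bar>Im x\<bar> \<le> d" for x n
    proof -
      have "norm (\<Sum>j<N. T x n j) \<le> (\<Sum>j<N. K0 * b\<^sup>2 * (1 + \<bar>Re x\<bar>))"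
        unfolding T_def by (intro sum_norm_le term_bound b that) auto
      thus ?thesis by simp
    qed
    have xs: "x \<in> level_strip N" "- x \<in> level_strip N" using x d by (auto simp: level_strip_def)
    have sumD: "(\<Sum>j<N. dilog_exp (base_arg N x j) / ?c) = dilog_exp (of_real (sqrt (real N)) * x) / (2 * of_real pi * \<i> * of_nat N * of_real (b\<^sup>2))"
      if "x \<in> level_strip N" for x
      unfolding sum_divide_distrib[symmetric] dilog_exp_distribution[OF N that] by (simp add: mult_ac)
    have "log_integrand N b k x - (h_4_1 N x / (2 * of_real pi * \<i> * of_nat N * of_real (b\<^sup>2)) + log_amplitude N k x)
        = (\<Sum>j<N. T (- x) (- k) j) - (\<Sum>j<N. T x k j)"
      unfolding log_integrand_def log_amplitude_def h_4_1_eq T_def sum_subtractf diff_divide_distrib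
        sumD[OF xs(1)] sumD[OF xs(2)] by simp
    also have "norm \<dots> \<le> real N * (K0 * b\<^sup>2 * (1 + \<bar>Re (- x)\<bar>)) + real N * (K0 * b\<^sup>2 * (1 + \<bar>Re x\<bar>))"
      by (rule order.trans[OF norm_triangle_ineq4 add_mono[OF sumT[OF x(2)] sumT[OF x(1)]]])
    finally show ?case by (simp add: algebra_simps)
  qed
qed

subsection \<open>The saddle point\<close>

lemma holomorphic_Taylor_bound:
  assumes "f holomorphic_on S" "open S" "z \<in> S"
  shows "\<exists>C \<eta>. 0 \<le> C \<and> 0 < \<eta> \<and> (\<forall>w. norm (w - z) \<le> \<eta> \<longrightarrow>
     norm (f w - (\<Sum>i\<le>n. (deriv ^^ i) f z * (w - z) ^ i / fact i)) \<le> C * norm (w - z) ^ Suc n)"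
proof -
  obtain \<eta> where eta: "\<eta> > 0" "cball z \<eta> \<subseteq> S"
    using assms(2,3) by (meson open_contains_cball)
  have holo: "(deriv ^^ i) f holomorphic_on S" for i
    by (rule holomorphic_higher_deriv[OF assms(1,2)])
  have "continuous_on (cball z \<eta>) ((deriv ^^ Suc n) f)"
    by (rule holomorphic_on_imp_continuous_on[OF holomorphic_on_subset[OF holo eta(2)]])
  hence "bounded ((deriv ^^ Suc n) f ` cball z \<eta>)"
    by (intro compact_imp_bounded compact_continuous_image) auto
  then obtain C where C: "\<And>w. w \<in> cball z \<eta> \<Longrightarrow> norm ((deriv ^^ Suc n) f w) \<le> C"
    unfolding bounded_iff by blast
  have C0: "C \<ge> 0" using order.trans[OF norm_ge_zero C[of z]] eta by simp
  show ?thesis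
  proof (rule exI[of _ C], rule exI[of _ \<eta>], intro conjI allI impI C0 eta(1))
    fix w assume w: "norm (w - z) \<le> \<eta>"
    have "norm ((deriv ^^ 0) f w - (\<Sum>i\<le>n. (deriv ^^ i) f z * (w - z) ^ i / fact i)) \<le> C * norm (w - z) ^ Suc n / fact n"
    proof (rule complex_Taylor[where f = "\<lambda>i. (deriv ^^ i) f" and S = "cball z \<eta>"])
      fix i x assume "x \<in> cball z \<eta>"
      hence "((deriv ^^ i) f has_field_derivative deriv ((deriv ^^ i) f) x) (at x)"
        using eta by (intro holomorphic_derivI[OF holo assms(2)]) auto
      thus "((deriv ^^ i) f has_field_derivative (deriv ^^ Suc i) f x) (at x within cball z \<eta>)"
        by (simp add: has_field_derivative_at_within)
    qed (use C w eta in \<open>auto simp: dist_norm norm_minus_commute\<close>)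
    also have "\<dots> \<le> C * norm (w - z) ^ Suc n / 1"
      using C0 by (intro divide_left_mono) (auto intro: fact_ge_1)
    finally show "norm (f w - (\<Sum>i\<le>n. (deriv ^^ i) f z * (w - z) ^ i / fact i)) \<le> C * norm (w - z) ^ Suc n" by simp
  qed
qed

text \<open>The second derivative of the phase dies out at infinity, so no purely quadratic bound
  can hold there. The function t^2 / (1 + t) = t - 1 + 1 / (1 + t) is quadratic at 0 and linear at
  infinity; its derivative is at most 2 t and at most 1, which matches f' \<le> - m t on [0, 1] and
  f' \<le> - m beyond.\<close>

lemma concave_quadratic_bound_nonneg:
  fixes f f' f'' :: "real \<Rightarrow> real"
  assumes m: "m \<ge> 0" and f: "\<And>t. (f has_real_derivative f' t) (at t)" and f': "\<And>t. (f' has_real_derivative f'' t) (at t)"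
    and zero: "f 0 = 0" "f' 0 = 0"
    and neg: "\<And>t. f'' t \<le> 0" and negm: "\<And>t. \<bar>t\<bar> \<le> 1 \<Longrightarrow> f'' t \<le> - m" and t: "t \<ge> 0"
  shows "f t \<le> - (m / 2) * t\<^sup>2 / (1 + t)"
proof -
  have small: "f' s \<le> - m * s" if "0 \<le> s" "s \<le> 1" for s
  proof -
    have "f' s + m * s \<le> f' 0 + m * 0"
    proof (rule DERIV_nonpos_imp_nonincreasing[OF that(1)])
      fix x assume "0 \<le> x" "x \<le> s"
      hence "f'' x + m \<le> 0" using negm[of x] that by simp
      moreover have "((\<lambda>x. f' x + m * x) has_real_derivative f'' x + m) (at x)"
        by (auto intro!: derivative_eq_intros f')
      ultimately show "\<exists>y. ((\<lambda>x. f' x + m * x) has_real_derivative y) (at x) \<and> y \<le> 0" by blast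
    qed
    thus ?thesis using zero by simp
  qed
  have big: "f' s \<le> - m" if "1 \<le> s" for s
  proof -
    have "f' s \<le> f' 1" by (rule DERIV_nonpos_imp_nonincreasing[OF that]) (use f' neg in blast)
    thus ?thesis using small[of 1] by simp
  qed
  have key: "f' s + (m / 2) * (1 - 1 / (1 + s)\<^sup>2) \<le> 0" if s: "0 \<le> s" for s
  proof (cases "s \<le> 1")
    case True
    have "1 - 1 / (1 + s)\<^sup>2 \<le> 2 * s"
    proof -
      have "(1 - 2 * s) * (1 + s)\<^sup>2 = 1 - s\<^sup>2 * (3 + 2 * s)" by (simp add: power2_eq_square algebra_simps)
      also have "\<dots> \<le> 1" using s by simp
      finally have "1 - 2 * s \<le> 1 / (1 + s)\<^sup>2" using s by (simp add: le_divide_eq)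
      thus ?thesis by simp
    qed
    hence "(m / 2) * (1 - 1 / (1 + s)\<^sup>2) \<le> (m / 2) * (2 * s)" using m by (intro mult_left_mono) auto
    moreover have "(m / 2) * (2 * s) = m * s" by simp
    ultimately show ?thesis using small[OF s True] by linarith
  next
    case False
    have "(m / 2) * (1 - 1 / (1 + s)\<^sup>2) \<le> (m / 2) * 1" using m by (intro mult_left_mono) auto
    thus ?thesis using big[of s] False m by linarith
  qed
  have "f t + (m / 2) * (t - 1 + 1 / (1 + t)) \<le> f 0 + (m / 2) * (0 - 1 + 1 / (1 + 0))"
  proof (rule DERIV_nonpos_imp_nonincreasing[OF t])
    fix x assume x: "0 \<le> x" "x \<le> t"
    have "((\<lambda>t. f t + (m / 2) * (t - 1 + 1 / (1 + t))) has_real_derivative f' x + (m / 2) * (1 - 1 / (1 + x)\<^sup>2)) (at x)"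
      using x by (auto intro!: derivative_eq_intros f simp: power2_eq_square)
    thus "\<exists>y. ((\<lambda>t. f t + (m / 2) * (t - 1 + 1 / (1 + t))) has_real_derivative y) (at x) \<and> y \<le> 0"
      using key[OF x(1)] by blast
  qed
  moreover have "t - 1 + 1 / (1 + t) = t\<^sup>2 / (1 + t)" using t by (simp add: field_simps power2_eq_square)
  ultimately show ?thesis using zero by simp
qed

lemma concave_quadratic_bound:
  fixes f f' f'' :: "real \<Rightarrow> real"
  assumes m: "m \<ge> 0" and f: "\<And>t. (f has_real_derivative f' t) (at t)" and f': "\<And>t. (f' has_real_derivative f'' t) (at t)"
    and zero: "f 0 = 0" "f' 0 = 0"
    and neg: "\<And>t. f'' t \<le> 0" and negm: "\<And>t. \<bar>t\<bar> \<le> 1 \<Longrightarrow> f'' t \<le> - m"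
  shows "f t \<le> - (m / 2) * t\<^sup>2 / (1 + \<bar>t\<bar>)"
proof (cases "t \<ge> 0")
  case True
  thus ?thesis using concave_quadratic_bound_nonneg[OF assms, of t] by simp
next
  case False
  have d1: "((\<lambda>t. f (- t)) has_real_derivative - f' (- t)) (at t)" for t
    using DERIV_chain2[OF f DERIV_minus[OF DERIV_ident], of t] by simp
  have d2: "((\<lambda>t. - f' (- t)) has_real_derivative f'' (- t)) (at t)" for t
    using DERIV_minus[OF DERIV_chain2[OF f' DERIV_minus[OF DERIV_ident], of t]] by simp
  have "f (- (- t)) \<le> - (m / 2) * (- t)\<^sup>2 / (1 + - t)"
    by (rule concave_quadratic_bound_nonneg[OF m d1 d2]) (use zero neg negm False in auto)
  thus ?thesis using False by simp
qed

lemma has_real_derivative_Re_horizontal: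
  assumes "(F has_field_derivative D) (at (Complex t y))"
  shows "((\<lambda>t. Re (F (Complex t y))) has_real_derivative Re D) (at t)"
proof -
  have "((\<lambda>t. Complex t y) has_vector_derivative 1) (at t)"
    unfolding Complex_eq by (auto intro!: derivative_eq_intros)
  from field_vector_diff_chain_at[OF this assms]
  have "((\<lambda>t. F (Complex t y)) has_vector_derivative D) (at t)" by (simp add: o_def)
  from bounded_linear.has_vector_derivative[OF bounded_linear_Re this]
  show ?thesis by (simp add: has_real_derivative_iff_has_vector_derivative)
qed

lemma Re_divide_ii: "Re (z / (2 * of_real pi * \<i> * of_nat N)) = Im z / (2 * pi * real N)"
proof -
  have "z / (2 * of_real pi * \<i> * of_nat N) = (- \<i> * z) / of_real (2 * pi * real N)"
    by (cases "N = 0") (auto simp: field_simps)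
  thus ?thesis by (simp only: Re_divide_of_real) simp
qed

section \<open>Derivatives of h\<close>

definition h_deriv :: "nat \<Rightarrow> complex \<Rightarrow> complex" where
  "h_deriv N x = of_real (sqrt (real N)) * (Ln (1 + exp (of_real (sqrt (real N)) * (- x))) + Ln (1 + exp (of_real (sqrt (real N)) * x)))"

text \<open>This is N tanh (sqrt N x / 2).\<close>

definition h_deriv2 :: "nat \<Rightarrow> complex \<Rightarrow> complex" where
  "h_deriv2 N x = of_nat N * ((exp (of_real (sqrt (real N)) * x) - 1) / (1 + exp (of_real (sqrt (real N)) * x)))"

lemma h_4_1_derivative:
  assumes N: "N > 0" and x: "x \<in> level_strip N"
  shows "(h_4_1 N has_field_derivative h_deriv N x) (at x)"
proof -
  let ?r = "of_real (sqrt (real N)) :: complex"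
  have "- x \<in> level_strip N" using x by simp
  hence s: "?r * (- x) \<in> strip_pi" "?r * x \<in> strip_pi" using scaled_arg_in_strip[OF N] x by blast+
  have "((\<lambda>x. dilog_exp (?r * (- x))) has_field_derivative - Ln (1 + exp (?r * (- x))) * (?r * (- 1))) (at x)"
    by (rule DERIV_chain2[where f = dilog_exp and g = "\<lambda>x. ?r * (- x)", OF dilog_exp_derivative[OF s(1)]])
       (auto intro!: derivative_eq_intros)
  moreover have "((\<lambda>x. dilog_exp (?r * x)) has_field_derivative - Ln (1 + exp (?r * x)) * ?r) (at x)"
    by (rule DERIV_chain2[where f = dilog_exp and g = "\<lambda>x. ?r * x", OF dilog_exp_derivative[OF s(2)]])
       (auto intro!: derivative_eq_intros)
  ultimately have "((\<lambda>x. dilog_exp (?r * (- x)) - dilog_exp (?r * x)) has_field_derivative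
      - Ln (1 + exp (?r * (- x))) * (?r * (- 1)) - - Ln (1 + exp (?r * x)) * ?r) (at x)"
    by (rule DERIV_diff)
  moreover have "h_4_1 N = (\<lambda>x. dilog_exp (?r * (- x)) - dilog_exp (?r * x))" by (simp add: h_4_1_eq fun_eq_iff)
  ultimately show ?thesis by (simp add: h_deriv_def algebra_simps)
qed

lemma h_deriv_derivative:
  assumes N: "N > 0" and x: "x \<in> level_strip N"
  shows "(h_deriv N has_field_derivative h_deriv2 N x) (at x)"
proof -
  let ?r = "of_real (sqrt (real N)) :: complex"
  let ?L = "\<lambda>z. Ln (1 + exp z)"
  have r2: "?r * ?r = of_nat N"
    by (metis of_real_mult of_real_of_nat_eq of_nat_0_le_iff real_sqrt_mult_self abs_of_nonneg)
  have "- x \<in> level_strip N" using x by simp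
  hence s: "?r * (- x) \<in> strip_pi" "?r * x \<in> strip_pi" using scaled_arg_in_strip[OF N] x by blast+
  define e where "e = exp (?r * x)"
  have e: "e \<noteq> 0" "1 + e \<noteq> 0" using one_plus_exp_nonzero[OF s(2)] by (auto simp: e_def)
  have em: "exp (?r * (- x)) = 1 / e" by (simp add: e_def exp_minus inverse_eq_divide)
  have "((\<lambda>x. ?L (?r * (- x))) has_field_derivative exp (?r * (- x)) / (1 + exp (?r * (- x))) * (?r * (- 1))) (at x)"
    by (rule DERIV_chain2[where f = ?L and g = "\<lambda>x. ?r * (- x)", OF Ln_one_plus_exp_derivative[OF s(1)]])
       (auto intro!: derivative_eq_intros)
  moreover have "((\<lambda>x. ?L (?r * x)) has_field_derivative exp (?r * x) / (1 + exp (?r * x)) * ?r) (at x)"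
    by (rule DERIV_chain2[where f = ?L and g = "\<lambda>x. ?r * x", OF Ln_one_plus_exp_derivative[OF s(2)]])
       (auto intro!: derivative_eq_intros)
  ultimately have "((\<lambda>x. ?r * (?L (?r * (- x)) + ?L (?r * x))) has_field_derivative
      ?r * (exp (?r * (- x)) / (1 + exp (?r * (- x))) * (?r * (- 1)) + exp (?r * x) / (1 + exp (?r * x)) * ?r)) (at x)"
    by (intro DERIV_cmult DERIV_add)
  also have "?r * (exp (?r * (- x)) / (1 + exp (?r * (- x))) * (?r * (- 1)) + exp (?r * x) / (1 + exp (?r * x)) * ?r)
     = (?r * ?r) * (e / (1 + e) - (1 / e) / (1 + 1 / e))"
    unfolding em e_def[symmetric] by (simp add: algebra_simps)
  also have "(1 / e) / (1 + 1 / e) = 1 / (1 + e)" using e by (simp add: field_simps)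
  also have "e / (1 + e) - 1 / (1 + e) = (e - 1) / (1 + e)" by (simp add: diff_divide_distrib)
  finally show ?thesis by (simp add: h_deriv_def[abs_def] h_deriv2_def e_def r2)
qed

lemma deriv_deriv_h_4_1:
  assumes N: "N > 0" and x: "x \<in> level_strip N"
  shows "deriv (h_4_1 N) x = h_deriv N x" "deriv (deriv (h_4_1 N)) x = h_deriv2 N x"
proof -
  have d: "deriv (h_4_1 N) y = h_deriv N y" if "y \<in> level_strip N" for y
    by (rule DERIV_imp_deriv[OF h_4_1_derivative[OF N that]])
  show "deriv (h_4_1 N) x = h_deriv N x" by (rule d[OF x])
  have "deriv (deriv (h_4_1 N)) x = deriv (h_deriv N) x"
    by (rule deriv_cong_ev) (use d open_level_strip x in \<open>auto simp: eventually_nhds\<close>)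
  also have "\<dots> = h_deriv2 N x" by (rule DERIV_imp_deriv[OF h_deriv_derivative[OF N x]])
  finally show "deriv (deriv (h_4_1 N)) x = h_deriv2 N x" .
qed

section \<open>The horizontal line through the saddle point\<close>

definition saddle_height :: "nat \<Rightarrow> real" where "saddle_height N = 2 * pi / (3 * sqrt (real N))"

lemma saddle_height:
  assumes "N > 0"
  shows "0 < saddle_height N" "saddle_height N < pi / sqrt (real N)" "x_0 N = Complex 0 (- saddle_height N)"
    "Complex t (- saddle_height N) \<in> level_strip N"
proof -
  show 1: "0 < saddle_height N" using assms by (simp add: saddle_height_def)
  have "2 * pi / (3 * sqrt (real N)) < (3 * pi) / (3 * sqrt (real N))"
    using assms by (intro divide_strict_right_mono) auto
  thus 2: "saddle_height N < pi / sqrt (real N)" by (simp add: saddle_height_def)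
  show "x_0 N = Complex 0 (- saddle_height N)"
    by (simp add: x_0_def saddle_height_def complex_eq_iff)
  show "Complex t (- saddle_height N) \<in> level_strip N"
    using 1 2 by (simp add: level_strip_def)
qed

lemma cos_sin_120: "cos (2 * pi / 3) = - (1 / 2)" "sin (2 * pi / 3) = sqrt 3 / 2"
proof -
  have e: "2 * pi / 3 = pi - pi / 3" by simp
  show "cos (2 * pi / 3) = - (1 / 2)" unfolding e by (simp only: cos_pi_minus cos_60)
  show "sin (2 * pi / 3) = sqrt 3 / 2" unfolding e by (simp only: sin_pi_minus sin_60)
qed

lemma exp_saddle_line:
  assumes "N > 0"
  shows "exp (of_real (sqrt (real N)) * Complex t (- saddle_height N)) =
     Complex (- exp (sqrt (real N) * t) / 2) (- exp (sqrt (real N) * t) * sqrt 3 / 2)"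
proof -
  have "of_real (sqrt (real N)) * Complex t (- saddle_height N) = Complex (sqrt (real N) * t) (- (2 * pi / 3))"
    using assms by (simp add: complex_eq_iff saddle_height_def)
  thus ?thesis by (simp only:) (simp add: complex_eq_iff Re_exp Im_exp cos_sin_120)
qed

text \<open>On this line exp (sqrt N x) = \<rho> exp (- 2 pi i / 3) with \<rho> > 0, and 1 plus it
  has squared modulus 1 - \<rho> + \<rho>^2. The negative value expresses the concavity; it decays
  exponentially in both directions.\<close>

lemma Im_h_deriv2_saddle_line:
  assumes "N > 0"
  shows "Im (h_deriv2 N (Complex t (- saddle_height N))) =
     - (real N * sqrt 3 * exp (sqrt (real N) * t) / (1 - exp (sqrt (real N) * t) + (exp (sqrt (real N) * t))\<^sup>2))"
proof -
  define \<rho> where "\<rho> = exp (sqrt (real N) * t)"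
  define u where "u = Complex (- \<rho> / 2) (- \<rho> * sqrt 3 / 2)"
  have "h_deriv2 N (Complex t (- saddle_height N)) = of_real (real N) * ((u - 1) / (1 + u))"
    unfolding h_deriv2_def exp_saddle_line[OF assms] \<rho>_def[symmetric] u_def[symmetric] by simp
  moreover have "Im (of_real a * z) = a * Im z" for a z by simp
  ultimately have "Im (h_deriv2 N (Complex t (- saddle_height N))) = real N * Im ((u - 1) / (1 + u))" by (simp only:)
  also have "Im ((u - 1) / (1 + u)) = - (\<rho> * sqrt 3) / ((1 - \<rho> / 2)\<^sup>2 + (\<rho> * sqrt 3 / 2)\<^sup>2)"
    by (simp add: Im_divide u_def field_simps)
  also have "(1 - \<rho> / 2)\<^sup>2 + (\<rho> * sqrt 3 / 2)\<^sup>2 = 1 - \<rho> + \<rho>\<^sup>2"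
    by (simp add: power2_eq_square field_simps)
  finally show ?thesis by (simp add: \<rho>_def mult_ac)
qed

text \<open>At the saddle 1 + exp (sqrt N x) = exp (- i pi / 3) has modulus 1. Its logarithm is
  purely imaginary and cancels against that of the conjugate, which belongs to - x.\<close>

lemma h_at_saddle:
  assumes N: "N > 0"
  shows "h_deriv N (x_0 N) = 0" "h_deriv2 N (x_0 N) = - \<i> * of_real (sqrt 3) * of_nat N"
proof -
  let ?r = "of_real (sqrt (real N)) :: complex"
  define u where "u = Complex (- 1 / 2) (- sqrt 3 / 2)"
  have e: "exp (?r * x_0 N) = u"
    using exp_saddle_line[OF N, of 0] by (simp add: u_def saddle_height(3)[OF N])
  have "- (?r * x_0 N) = cnj (?r * x_0 N)" by (simp add: saddle_height(3)[OF N] complex_eq_iff)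
  hence e': "exp (?r * (- x_0 N)) = cnj u" using e by (simp add: exp_cnj flip: e)
  have "norm (1 + u) = 1" by (simp add: cmod_def u_def power2_eq_square)
  hence ln0: "Re (Ln (1 + u)) = 0" by (subst Re_Ln) auto
  have "Ln (1 + cnj u) = cnj (Ln (1 + u))"
    using cnj_Ln[of "1 + u"] by (simp add: u_def complex_nonpos_Reals_iff)
  hence "Ln (1 + cnj u) + Ln (1 + u) = 0" using ln0 by (simp add: complex_eq_iff)
  thus "h_deriv N (x_0 N) = 0" by (simp only: h_deriv_def e e') simp
  have "(u - 1) / (1 + u) = - \<i> * of_real (sqrt 3)"
  proof -
    have "1 + u \<noteq> 0" by (simp add: u_def complex_eq_iff)
    moreover have "u - 1 = - \<i> * of_real (sqrt 3) * (1 + u)" by (simp add: u_def complex_eq_iff)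
    ultimately show ?thesis by (simp add: divide_eq_eq)
  qed
  thus "h_deriv2 N (x_0 N) = - \<i> * of_real (sqrt 3) * of_nat N" by (simp add: h_deriv2_def e)
qed

text \<open>b^2 times the exponent of the leading factor, relative to the saddle; its real part is
  the increment of Im h over 2 pi N.\<close>

definition saddle_phase :: "nat \<Rightarrow> real \<Rightarrow> complex" where
  "saddle_phase N t = (h_4_1 N (Complex t (- saddle_height N)) - h_4_1 N (x_0 N)) / (2 * of_real pi * \<i> * of_nat N)"

lemma saddle_phase_Re_bound:
  assumes N: "N > 0"
  shows "\<exists>\<kappa>>0. \<forall>t. Re (saddle_phase N t) \<le> - \<kappa> * t\<^sup>2 / (1 + \<bar>t\<bar>)"
proof -
  let ?X = "\<lambda>t. Complex t (- saddle_height N)"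
  let ?c = "2 * of_real pi * \<i> * of_nat N :: complex"
  define f f' f'' where "f t = Re (saddle_phase N t)" and "f' t = Re (h_deriv N (?X t) / ?c)"
    and "f'' t = Re (h_deriv2 N (?X t) / ?c)" for t
  define R where "R = exp (sqrt (real N))"
  have R: "R > 0" by (simp add: R_def)
  \<comment> \<open>For |t| \<le> 1 the number \<rho> = exp (sqrt N t) lies between 1 / R and R, so
    \<rho> / (1 - \<rho> + \<rho>^2) is at least (1 / R) / (1 + R^2).\<close>
  define m where "m = sqrt 3 / (R * (1 + R\<^sup>2)) / (2 * pi)"
  have f''_eq: "f'' t = - (sqrt 3 * exp (sqrt (real N) * t) / (1 - exp (sqrt (real N) * t) + (exp (sqrt (real N) * t))\<^sup>2)) / (2 * pi)" for t
  proof -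
    have "real N * sqrt 3 * e / D = real N * (sqrt 3 * e / D)" for e D by simp
    moreover have "- (real N * a) / (2 * pi * real N) = - a / (2 * pi)" for a using N by simp
    ultimately show ?thesis unfolding f''_def Re_divide_ii Im_h_deriv2_saddle_line[OF N] by (simp only:)
  qed
  have pos: "1 - \<rho> + \<rho>\<^sup>2 > 0" for \<rho> :: real
  proof -
    have "1 - \<rho> + \<rho>\<^sup>2 = (\<rho> - 1 / 2)\<^sup>2 + 3 / 4" by (simp add: power2_eq_square field_simps)
    moreover have "(\<rho> - 1 / 2)\<^sup>2 \<ge> 0" by simp
    ultimately show ?thesis by linarith
  qed
  have "f t \<le> - (m / 2) * t\<^sup>2 / (1 + \<bar>t\<bar>)" for t
  proof (rule concave_quadratic_bound)
    show "0 \<le> m" using R by (simp add: m_def)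
    show "(f has_real_derivative f' t) (at t)" for t
      unfolding f_def f'_def saddle_phase_def
      by (rule has_real_derivative_Re_horizontal) (use N in \<open>auto intro!: derivative_eq_intros h_4_1_derivative saddle_height\<close>)
    show "(f' has_real_derivative f'' t) (at t)" for t
      unfolding f'_def f''_def
      by (rule has_real_derivative_Re_horizontal) (auto intro!: DERIV_cdivide h_deriv_derivative N saddle_height)
    show "f 0 = 0" by (simp add: f_def saddle_phase_def saddle_height(3)[OF N])
    show "f' 0 = 0" using h_at_saddle(1)[OF N] by (simp add: f'_def saddle_height(3)[OF N])
    show "f'' t \<le> 0" for t
      unfolding f''_eq using pos[of "exp (sqrt (real N) * t)"] by (simp add: divide_nonneg_pos)
    show "f'' t \<le> - m" if t: "\<bar>t\<bar> \<le> 1" for t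
    proof -
      define \<rho> where "\<rho> = exp (sqrt (real N) * t)"
      have "sqrt (real N) * t \<le> sqrt (real N) * 1" "sqrt (real N) * (- 1) \<le> sqrt (real N) * t"
        using t by (intro mult_left_mono; simp)+
      hence "exp (sqrt (real N) * t) \<le> exp (sqrt (real N))" "exp (- sqrt (real N)) \<le> exp (sqrt (real N) * t)" by simp_all
      hence rho: "\<rho> \<le> R" "1 / R \<le> \<rho>" unfolding exp_minus inverse_eq_divide by (simp_all only: \<rho>_def R_def)
      have rho0: "\<rho> > 0" by (simp add: \<rho>_def)
      have "1 - \<rho> + \<rho>\<^sup>2 \<le> 1 + R\<^sup>2" using rho0 power_mono[OF rho(1), of 2] by simp
      hence "(1 / R) / (1 + R\<^sup>2) \<le> \<rho> / (1 - \<rho> + \<rho>\<^sup>2)"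
        using rho rho0 pos[of \<rho>] R by (intro frac_le) auto
      hence "sqrt 3 * ((1 / R) / (1 + R\<^sup>2)) / (2 * pi) \<le> sqrt 3 * (\<rho> / (1 - \<rho> + \<rho>\<^sup>2)) / (2 * pi)"
        by (intro divide_right_mono mult_left_mono) auto
      thus ?thesis unfolding f''_eq \<rho>_def[symmetric] m_def by simp
    qed
  qed
  moreover have "m > 0" unfolding m_def using R by (intro divide_pos_pos mult_pos_pos add_pos_nonneg) auto
  ultimately show ?thesis by (intro exI[of _ "m / 2"]) (auto simp: f_def)
qed

section \<open>Regularity and growth of the amplitude\<close>

lemma log_amplitude_holomorphic:
  assumes N: "N > 0"
  shows "log_amplitude N k holomorphic_on level_strip N"
proof -
  have h: "(\<lambda>x. log_term N (f x) j) holomorphic_on level_strip N" if "j < N" "f = (\<lambda>x. x) \<or> f = uminus" for f :: "complex \<Rightarrow> complex" and j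
    unfolding log_term_def base_arg_def
  proof (intro holomorphic_intros)
    show "f holomorphic_on level_strip N" using that by (auto intro: holomorphic_intros)
    fix x assume "x \<in> level_strip N"
    thus "1 + exp (f x / of_real (sqrt (real N)) + \<i> * of_real (pi * (1 - (2 * real j + 1) / real N))) \<notin> \<real>\<^sub>\<le>\<^sub>0"
      using that one_plus_exp_notin_nonpos[OF base_arg_in_strip[OF that(1), of "f x"]] by (auto simp: base_arg_def)
  qed (use N in auto)
  show ?thesis unfolding log_amplitude_def
    using h[where f = "\<lambda>x. x"] h[where f = uminus] by (intro holomorphic_intros) auto
qed

text \<open>The coefficients of the 2 N logarithms are at most 1 / 2 in modulus, whence the factor
  N. Exponentiated, the linear bound is the growth exp (C |t|) that Laplace's method
  tolerates.\<close>

lemma log_amplitude_bound: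
  assumes N: "N > 0" and d: "d < pi / sqrt (real N)" "0 \<le> d"
  shows "\<exists>B\<ge>0. \<forall>k x. \<bar>Im x\<bar> \<le> d \<longrightarrow> norm (log_amplitude N k x) \<le> real N * (B + \<bar>Re x\<bar>)"
proof -
  define v where "v = d / sqrt (real N) + pi * (1 - 1 / real N)"
  have "d / sqrt (real N) < pi / real N" using level_strip_bound[OF N, of d] d by simp
  hence v: "v < pi" by (simp add: v_def algebra_simps)
  obtain B where B: "B \<ge> 0" "\<And>z. \<bar>Im z\<bar> \<le> v \<Longrightarrow> norm (Ln (1 + exp z)) \<le> B + \<bar>Re z\<bar>"
    using Ln_one_plus_exp_bound[OF v] by blast
  have t: "norm (of_real (arg_shift N n j / (2 * pi)) * log_term N x j) \<le> (1 / 2) * (B + \<bar>Re x\<bar>)"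
    if x: "\<bar>Im x\<bar> \<le> d" and j: "j < N" for n x j
  proof -
    have "\<bar>arg_shift N n j\<bar> \<le> pi * 1"
      by (rule order.trans[OF abs_arg_shift_le[OF N]]) (intro mult_left_mono; simp)
    hence 1: "norm (of_real (arg_shift N n j / (2 * pi)) :: complex) \<le> 1 / 2" unfolding norm_of_real by simp
    have "\<bar>Im (base_arg N x j)\<bar> \<le> v"
      using abs_Im_base_arg_le[OF j, of x] divide_right_mono[OF x, of "sqrt (real N)"] by (simp add: v_def)
    hence "norm (log_term N x j) \<le> B + \<bar>Re (base_arg N x j)\<bar>" unfolding log_term_def by (rule B(2))
    also have "\<bar>Re (base_arg N x j)\<bar> \<le> \<bar>Re x\<bar>"
      using N by (simp add: Re_base_arg divide_le_eq mult_le_cancel_left1)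
    finally have 2: "norm (log_term N x j) \<le> B + \<bar>Re x\<bar>" by simp
    show ?thesis unfolding norm_mult using 1 2 by (intro mult_mono) auto
  qed
  have s: "norm (\<Sum>j<N. of_real (arg_shift N n j / (2 * pi)) * log_term N x j) \<le> real N * ((1 / 2) * (B + \<bar>Re x\<bar>))"
    if "\<bar>Im x\<bar> \<le> d" for n x
  proof -
    have "norm (\<Sum>j<N. of_real (arg_shift N n j / (2 * pi)) * log_term N x j) \<le> (\<Sum>j<N. (1 / 2) * (B + \<bar>Re x\<bar>))"
      by (rule sum_norm_le) (use t[OF that] in auto)
    thus ?thesis by simp
  qed
  show ?thesis
  proof (intro exI[of _ B] conjI B(1) allI impI)
    fix k x assume x: "\<bar>Im x\<bar> \<le> d"
    hence x': "\<bar>Im (- x)\<bar> \<le> d" by simp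
    have "norm (log_amplitude N k x) \<le> real N * ((1 / 2) * (B + \<bar>Re x\<bar>)) + real N * ((1 / 2) * (B + \<bar>Re (- x)\<bar>))"
      unfolding log_amplitude_def by (rule order.trans[OF norm_triangle_ineq4 add_mono[OF s[OF x] s[OF x']]])
    thus "norm (log_amplitude N k x) \<le> real N * (B + \<bar>Re x\<bar>)" by (simp add: field_simps)
  qed
qed

subsection \<open>Assembling the asymptotics\<close>

text \<open>With the value at the saddle divided out, the integral is of order b; the exponential is
  restored at the end.\<close>

definition saddle_integrand :: "nat \<Rightarrow> int \<Rightarrow> real \<Rightarrow> real \<Rightarrow> complex" where
  "saddle_integrand N k b t = exp (log_integrand N b k (Complex t (- saddle_height N))
     - h_4_1 N (x_0 N) / (2 * of_real pi * \<i> * of_nat N * of_real (b\<^sup>2)))"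

lemma Complex_saddle_height:
  assumes "N > 0"
  shows "Complex t (- saddle_height N) - x_0 N = of_real t"
  using assms by (simp add: saddle_height(3) complex_eq_iff)

text \<open>The coefficient sqrt 3 / (4 pi) is minus h''(x_0) / 2 divided by 2 pi i N; being real
  and positive, it gives a genuine Gaussian. The expansion goes to order three because the cubic
  term enters the correction of order b that cancels by oddness.\<close>

lemma saddle_phase_Taylor:
  assumes N: "N > 0"
  shows "\<exists>C \<eta> \<beta>. 0 \<le> C \<and> 0 < \<eta> \<and> (\<forall>t. \<bar>t\<bar> \<le> \<eta> \<longrightarrow>
     norm (saddle_phase N t + of_real (sqrt 3 / (4 * pi) * t\<^sup>2) - \<beta> * of_real (t ^ 3)) \<le> C * t ^ 4)"
proof -
  let ?c = "2 * of_real pi * \<i> * of_nat N :: complex"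
  let ?h = "h_4_1 N" and ?x = "x_0 N"
  have c0: "?c \<noteq> 0" using N by simp
  have xs: "?x \<in> level_strip N" using saddle_height(4)[OF N, of 0] saddle_height(3)[OF N] by simp
  have holo: "?h holomorphic_on level_strip N"
    using h_4_1_derivative[OF N] open_level_strip by (auto simp: holomorphic_on_open)
  obtain C \<eta> where C: "0 \<le> C" "0 < \<eta>" "\<And>w. norm (w - ?x) \<le> \<eta> \<Longrightarrow>
     norm (?h w - (\<Sum>i\<le>3. (deriv ^^ i) ?h ?x * (w - ?x) ^ i / fact i)) \<le> C * norm (w - ?x) ^ Suc 3"
    using holomorphic_Taylor_bound[OF holo open_level_strip xs, of 3] by blast
  define \<beta> where "\<beta> = (deriv ^^ 3) ?h ?x / 6 / ?c"
  have d1: "deriv ?h ?x = 0" using deriv_deriv_h_4_1(1)[OF N xs] h_at_saddle(1)[OF N] by simp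
  have d2: "deriv (deriv ?h) ?x = - \<i> * of_real (sqrt 3) * of_nat N"
    using deriv_deriv_h_4_1(2)[OF N xs] h_at_saddle(2)[OF N] by simp
  show ?thesis
  proof (rule exI[of _ "C / norm ?c"], rule exI[of _ \<eta>], rule exI[of _ \<beta>], intro conjI allI impI C(2))
    show "0 \<le> C / norm ?c" using C(1) by simp
    fix t :: real assume t: "\<bar>t\<bar> \<le> \<eta>"
    let ?w = "Complex t (- saddle_height N)"
    have wx: "?w - ?x = of_real t" by (rule Complex_saddle_height[OF N])
    have sum: "(\<Sum>i\<le>3. (deriv ^^ i) ?h ?x * (?w - ?x) ^ i / fact i) =
       ?h ?x - \<i> * of_real (sqrt 3) * of_nat N * of_real t ^ 2 / 2 + (deriv ^^ 3) ?h ?x * of_real t ^ 3 / 6"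
      unfolding wx by (simp add: eval_nat_numeral fact_numeral d1 d2[unfolded eval_nat_numeral])
    have "saddle_phase N t + of_real (sqrt 3 / (4 * pi) * t\<^sup>2) - \<beta> * of_real (t ^ 3)
        = (?h ?w - (\<Sum>i\<le>3. (deriv ^^ i) ?h ?x * (?w - ?x) ^ i / fact i)) / ?c"
    proof -
      have "of_real (sqrt 3 / (4 * pi) * t\<^sup>2) = \<i> * of_real (sqrt 3) * of_nat N * of_real t ^ 2 / 2 / ?c"
        using N by (simp add: field_simps)
      thus ?thesis unfolding sum saddle_phase_def \<beta>_def
        by (simp add: diff_divide_distrib add_divide_distrib)
    qed
    also have "norm \<dots> \<le> (C * norm (?w - ?x) ^ Suc 3) / norm ?c"
      unfolding norm_divide by (intro divide_right_mono C(3)) (use t wx in auto)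
    finally show "norm (saddle_phase N t + of_real (sqrt 3 / (4 * pi) * t\<^sup>2) - \<beta> * of_real (t ^ 3)) \<le> C / norm ?c * t ^ 4"
      unfolding wx by simp
  qed
qed

lemma saddle_amplitude_Taylor:
  assumes N: "N > 0"
  shows "\<exists>C \<eta> q1. 0 \<le> C \<and> 0 < \<eta> \<and> (\<forall>t. \<bar>t\<bar> \<le> \<eta> \<longrightarrow>
     norm (exp (log_amplitude N k (Complex t (- saddle_height N))) - exp (log_amplitude N k (x_0 N)) - q1 * of_real t) \<le> C * t\<^sup>2)"
proof -
  let ?x = "x_0 N" and ?q = "\<lambda>x. exp (log_amplitude N k x)"
  have xs: "?x \<in> level_strip N" using saddle_height(4)[OF N, of 0] saddle_height(3)[OF N] by simp
  have holo: "?q holomorphic_on level_strip N"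
    by (intro holomorphic_intros log_amplitude_holomorphic N)
  obtain C \<eta> where C: "0 \<le> C" "0 < \<eta>" "\<And>w. norm (w - ?x) \<le> \<eta> \<Longrightarrow>
     norm (?q w - (\<Sum>i\<le>1. (deriv ^^ i) ?q ?x * (w - ?x) ^ i / fact i)) \<le> C * norm (w - ?x) ^ Suc 1"
    using holomorphic_Taylor_bound[OF holo open_level_strip xs, of 1] by blast
  show ?thesis
  proof (rule exI[of _ C], rule exI[of _ \<eta>], rule exI[of _ "deriv ?q ?x"], intro conjI allI impI C(1,2))
    fix t :: real assume t: "\<bar>t\<bar> \<le> \<eta>"
    have wx: "Complex t (- saddle_height N) - ?x = of_real t" by (rule Complex_saddle_height[OF N])
    from C(3)[of "Complex t (- saddle_height N)"] t
    show "norm (?q (Complex t (- saddle_height N)) - ?q ?x - deriv ?q ?x * of_real t) \<le> C * t\<^sup>2"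
      unfolding wx by (simp add: diff_diff_eq power2_eq_square)
  qed
qed

lemma saddle_integral_asymptotics:
  assumes N: "N > 0"
  shows "\<exists>K b\<^sub>1. 0 < b\<^sub>1 \<and> (\<forall>b. 0 < b \<and> b < b\<^sub>1 \<longrightarrow>
     norm ((LBINT t. saddle_integrand N k b t) - of_real (b * sqrt (pi / (sqrt 3 / (4 * pi)))) * exp (log_amplitude N k (x_0 N))) \<le> K * b ^ 3)"
proof -
  let ?d = "saddle_height N"
  let ?X = "\<lambda>t. Complex t (- ?d)"
  let ?c = "2 * of_real pi * \<i> * of_nat N :: complex"
  have d: "0 \<le> ?d" "?d < pi / sqrt (real N)" using saddle_height[OF N] by auto
  obtain \<kappa> where kappa: "\<kappa> > 0" "\<And>t. Re (saddle_phase N t) \<le> - \<kappa> * t\<^sup>2 / (1 + \<bar>t\<bar>)"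
    using saddle_phase_Re_bound[OF N] by blast
  obtain C1 \<eta>1 \<beta> where C1: "0 \<le> C1" "0 < \<eta>1" "\<And>t. \<bar>t\<bar> \<le> \<eta>1 \<Longrightarrow>
     norm (saddle_phase N t + of_real (sqrt 3 / (4 * pi) * t\<^sup>2) - \<beta> * of_real (t ^ 3)) \<le> C1 * t ^ 4"
    using saddle_phase_Taylor[OF N] by blast
  obtain C2 \<eta>2 q1 where C2: "0 \<le> C2" "0 < \<eta>2" "\<And>t. \<bar>t\<bar> \<le> \<eta>2 \<Longrightarrow>
     norm (exp (log_amplitude N k (?X t)) - exp (log_amplitude N k (x_0 N)) - q1 * of_real t) \<le> C2 * t\<^sup>2"
    using saddle_amplitude_Taylor[OF N] by blast
  obtain B where B: "B \<ge> 0" "\<And>x. \<bar>Im x\<bar> \<le> ?d \<Longrightarrow> norm (log_amplitude N k x) \<le> real N * (B + \<bar>Re x\<bar>)"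
    using log_amplitude_bound[OF N d(2,1)] by blast
  obtain K b\<^sub>0 where K: "K \<ge> 0" "0 < b\<^sub>0" "b\<^sub>0 < 1" "\<And>b x. 0 < b \<Longrightarrow> b < b\<^sub>0 \<Longrightarrow> \<bar>Im x\<bar> \<le> ?d \<Longrightarrow>
     norm (log_integrand N b k x - (h_4_1 N x / (?c * of_real (b\<^sup>2)) + log_amplitude N k x)) \<le> K * b\<^sup>2 * (1 + \<bar>Re x\<bar>)"
    using log_integrand_semiclassical[OF N d] by blast
  define q where "q t = exp (log_amplitude N k (?X t))" for t
  \<comment> \<open>r is the exact amplitude, namely the integrand with exp (phase / b^2) split off.
    It equals q times exp E with E of order b^2 (1 + |t|).\<close>
  define r where "r b t = exp (log_integrand N b k (?X t) - h_4_1 N (?X t) / (?c * of_real (b\<^sup>2)))" for b t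
  have factor: "exp (saddle_phase N t / of_real (b\<^sup>2)) * r b t = saddle_integrand N k b t" for b t
    unfolding r_def saddle_integrand_def saddle_phase_def exp_add[symmetric]
    by (rule arg_cong[where f = exp]) (simp add: diff_divide_distrib)
  have imX: "\<bar>Im (?X t)\<bar> \<le> ?d" for t using d by simp
  have q_bound: "norm (q t) \<le> exp (real N * B) * exp (real N * \<bar>t\<bar>)" for t
  proof -
    have "norm (q t) \<le> exp (norm (log_amplitude N k (?X t)))" unfolding q_def by (rule norm_exp)
    also have "\<dots> \<le> exp (real N * (B + \<bar>t\<bar>))" using B(2)[OF imX[of t]] by simp
    finally show ?thesis by (simp add: exp_add algebra_simps)
  qed
  have r_bound: "norm (r b t - q t) \<le> (exp (real N * B) * K * exp K) * b\<^sup>2 * exp ((real N + 1 + K) * \<bar>t\<bar>)"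
    if b: "0 < b" "b < b\<^sub>0" for b t
  proof -
    define E where "E = log_integrand N b k (?X t) - (h_4_1 N (?X t) / (?c * of_real (b\<^sup>2)) + log_amplitude N k (?X t))"
    have E: "norm E \<le> K * b\<^sup>2 * (1 + \<bar>t\<bar>)" unfolding E_def using K(4)[OF b imX[of t]] by simp
    have "b\<^sup>2 \<le> 1" using b K(3) by (simp add: power_le_one)
    hence "K * b\<^sup>2 * (1 + \<bar>t\<bar>) \<le> K * 1 * (1 + \<bar>t\<bar>)" using K(1) by (intro mult_right_mono mult_left_mono) auto
    hence E': "norm E \<le> K + K * \<bar>t\<bar>" using E by (simp add: algebra_simps)
    have "r b t = q t * exp E" unfolding r_def q_def E_def exp_add[symmetric] by simp
    hence "norm (r b t - q t) = norm (q t) * norm (exp E - 1)"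
      by (simp add: norm_mult[symmetric] algebra_simps)
    also have "\<dots> \<le> (exp (real N * B) * exp (real N * \<bar>t\<bar>)) * ((K * b\<^sup>2 * exp \<bar>t\<bar>) * exp (K + K * \<bar>t\<bar>))"
    proof (intro mult_mono q_bound)
      have "norm (exp E - 1) \<le> norm E * exp (norm E)" by (rule norm_exp_minus_one_le)
      also have "\<dots> \<le> (K * b\<^sup>2 * exp \<bar>t\<bar>) * exp (K + K * \<bar>t\<bar>)"
      proof (intro mult_mono)
        have "K * b\<^sup>2 * (1 + \<bar>t\<bar>) \<le> K * b\<^sup>2 * exp \<bar>t\<bar>" using K(1) by (intro mult_left_mono) auto
        thus "norm E \<le> K * b\<^sup>2 * exp \<bar>t\<bar>" using E by simp
      qed (use E' K(1) in auto)
      finally show "norm (exp E - 1) \<le> (K * b\<^sup>2 * exp \<bar>t\<bar>) * exp (K + K * \<bar>t\<bar>)" .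
    qed auto
    also have "\<dots> = (exp (real N * B) * K * exp K) * b\<^sup>2 * exp ((real N + 1 + K) * \<bar>t\<bar>)"
    proof -
      have e: "exp (real N * \<bar>t\<bar>) * (exp \<bar>t\<bar> * exp (K + K * \<bar>t\<bar>)) = exp K * exp ((real N + 1 + K) * \<bar>t\<bar>)"
        unfolding exp_add[symmetric] by (simp add: algebra_simps)
      have "(exp (real N * B) * exp (real N * \<bar>t\<bar>)) * ((K * b\<^sup>2 * exp \<bar>t\<bar>) * exp (K + K * \<bar>t\<bar>))
          = exp (real N * B) * K * b\<^sup>2 * (exp (real N * \<bar>t\<bar>) * (exp \<bar>t\<bar> * exp (K + K * \<bar>t\<bar>)))"
        by (simp only: mult_ac)
      also have "\<dots> = exp (real N * B) * K * b\<^sup>2 * (exp K * exp ((real N + 1 + K) * \<bar>t\<bar>))" unfolding e ..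
      finally show ?thesis by (simp only: mult_ac)
    qed
    finally show ?thesis .
  qed
  \<comment> \<open>One constant has to serve all bounds in \<open>laplace_asymptotics\<close>,
    hence the sum.\<close>
  define C where "C = C1 + C2 + exp (real N * B) + exp (real N * B) * K * exp K + (real N + 1 + K)"
  have C: "C \<ge> 0" "C1 \<le> C" "C2 \<le> C" "exp (real N * B) \<le> C" "exp (real N * B) * K * exp K \<le> C"
    "real N \<le> C" "real N + 1 + K \<le> C"
    using C1(1) C2(1) K(1) by (simp_all add: C_def add_nonneg_nonneg add_increasing add_increasing2)
  have "\<exists>K b\<^sub>1. 0 < b\<^sub>1 \<and> (\<forall>b. 0 < b \<and> b < b\<^sub>1 \<longrightarrow>
           norm ((LBINT t. exp (saddle_phase N t / of_real (b\<^sup>2)) * r b t) - of_real (b * sqrt (pi / (sqrt 3 / (4 * pi)))) * exp (log_amplitude N k (x_0 N))) \<le> K * b ^ 3)"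
  proof (rule laplace_asymptotics[where q = q and C = C and \<kappa> = \<kappa> and \<beta> = \<beta> and ?q1.0 = q1 and ?\<eta>\<^sub>0 = "min \<eta>1 \<eta>2" and ?b\<^sub>0 = b\<^sub>0])
    show "0 < sqrt 3 / (4 * pi)" by simp
    show "0 < min \<eta>1 \<eta>2" using C1 C2 by simp
    show "Re (saddle_phase N t) \<le> - \<kappa> * t\<^sup>2 / (1 + \<bar>t\<bar>)" for t by (rule kappa)
    show "norm (saddle_phase N t + of_real (sqrt 3 / (4 * pi) * t\<^sup>2) - \<beta> * of_real (t ^ 3)) \<le> C * t ^ 4"
      if "\<bar>t\<bar> \<le> min \<eta>1 \<eta>2" for t
      using C1(3)[of t] that mult_right_mono[OF C(2), of "t ^ 4"] by simp
    show "norm (q t - exp (log_amplitude N k (x_0 N)) - q1 * of_real t) \<le> C * t\<^sup>2"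
      if "\<bar>t\<bar> \<le> min \<eta>1 \<eta>2" for t
      using C2(3)[of t] that mult_right_mono[OF C(3), of "t\<^sup>2"] by (simp add: q_def)
    show "norm (q t) \<le> C * exp (C * \<bar>t\<bar>)" for t
      by (rule order.trans[OF q_bound mult_mono]) (use C in \<open>auto intro: mult_right_mono\<close>)
    show "norm (r b t - q t) \<le> C * b\<^sup>2 * exp (C * \<bar>t\<bar>)" if b: "0 < b" "b < b\<^sub>0" for b t
      by (rule order.trans[OF r_bound[OF b] mult_mono]) (use C in \<open>auto intro: mult_right_mono\<close>)
    show "(\<lambda>t. exp (saddle_phase N t / of_real (b\<^sup>2)) * r b t) \<in> borel_measurable borel" if b: "0 < b" "b < b\<^sub>0" for b
    proof -
      have b1: "b < 1" using b K(3) by simp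
      have "continuous_on UNIV (\<lambda>t. log_integrand N b k (?X t))"
        by (rule continuous_on_compose2[OF holomorphic_on_imp_continuous_on[OF log_integrand_holomorphic[OF b(1) b1, of N k]]])
           (use saddle_height(4)[OF N] in \<open>auto simp: Complex_eq intro!: continuous_intros\<close>)
      thus ?thesis unfolding factor saddle_integrand_def
        by (intro borel_measurable_continuous_onI continuous_intros)
    qed
  qed (use C kappa K in auto)
  thus ?thesis unfolding factor .
qed

text \<open>One error function serves all heights \<open>d\<close>, because the integral has the
  same value for every admissible height.\<close>

theorem mainTheorem3:
  fixes N :: nat
  assumes "N > 0" and "odd N"
  shows "\<exists>E :: real \<Rightarrow> complex.
           E \<in> O[at_right 0](\<lambda>b. of_real (b ^ 2)) \<and>
           (\<forall>\<^sub>F b in at_right 0. \<forall>d. 0 < d \<and> d < pi / sqrt (real N) \<longrightarrow>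
              chi_4_1 N b d =
                exp (h_4_1 N (x_0 N) / (2 * of_real pi * \<i> * of_real (b ^ 2) * of_nat N)) *
                (g_4_1 N (x_0 N) / csqrt (\<i> * (1 / of_nat N) * deriv (deriv (h_4_1 N)) (x_0 N))) *
                (1 + E b))"
proof -
  have N: "N > 0" by fact
  have xs: "x_0 N \<in> level_strip N" using saddle_height(4)[OF N, of 0] saddle_height(3)[OF N] by simp
  define J where "J k b = (LBINT t. saddle_integrand N (int k) b t)" for k b
  define q where "q k = exp (log_amplitude N (int k) (x_0 N))" for k
  define w where "w = sqrt (pi / (sqrt 3 / (4 * pi)))"
  define A where "A = g_4_1 N (x_0 N) / csqrt (\<i> * (1 / of_nat N) * deriv (deriv (h_4_1 N)) (x_0 N))"
  have sumq: "(\<Sum>k<N. q k) = (\<Sum>k<N. phi N (- x_0 N) k * phi_bar N (x_0 N) k)"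
    unfolding q_def by (intro sum.cong refl exp_log_amplitude N xs) auto
  have sumq0: "(\<Sum>k<N. q k) \<noteq> 0"
    unfolding sumq by (rule sum_phi_nonzero[OF N xs]) (simp add: saddle_height(3)[OF N])
  \<comment> \<open>Since i h''(x_0) / N = sqrt 3 is positive, the principal root is 3^(1/4); and w
    = 2 pi / 3^(1/4), whose 2 pi cancels that of the normalisation.\<close>
  have A_eq: "A = of_real (w / (2 * pi * sqrt (real N))) * (\<Sum>k<N. q k)"
  proof -
    have "\<i> * (1 / of_nat N) * deriv (deriv (h_4_1 N)) (x_0 N) = of_real (sqrt 3)"
      unfolding deriv_deriv_h_4_1(2)[OF N xs] h_at_saddle(2)[OF N] using N by (simp add: field_simps)
    hence c: "csqrt (\<i> * (1 / of_nat N) * deriv (deriv (h_4_1 N)) (x_0 N)) = of_real (sqrt (sqrt 3))"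
      by (simp only: csqrt_of_real_nonneg real_sqrt_ge_zero of_nat_0_le_iff) (simp add: csqrt_of_real_nonneg)
    have "w = 2 * pi / sqrt (sqrt 3)"
    proof -
      have "pi / (sqrt 3 / (4 * pi)) = (2 * pi)\<^sup>2 / sqrt 3" by (simp add: power2_eq_square)
      thus ?thesis unfolding w_def by (simp only: real_sqrt_divide real_sqrt_abs) simp
    qed
    thus ?thesis unfolding A_def c g_4_1_def sumq by simp
  qed
  have A0: "A \<noteq> 0" unfolding A_eq using sumq0 N by (simp add: w_def)
  define D where "D b = (\<Sum>k<N. J k b - of_real (b * w) * q k)" for b
  have "D \<in> O[at_right 0](\<lambda>b. of_real (b ^ 3))"
    unfolding D_def
  proof (rule big_sum_in_bigo)
    fix k assume "k \<in> {..<N}"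
    obtain K b\<^sub>1 where K: "0 < b\<^sub>1" "\<And>b. 0 < b \<Longrightarrow> b < b\<^sub>1 \<Longrightarrow> norm (J k b - of_real (b * w) * q k) \<le> K * b ^ 3"
      using saddle_integral_asymptotics[OF N, of "int k"] unfolding J_def q_def w_def by blast
    show "(\<lambda>b. J k b - of_real (b * w) * q k) \<in> O[at_right 0](\<lambda>b. of_real (b ^ 3))"
    proof (rule bigoI[where c = K])
      show "\<forall>\<^sub>F b in at_right 0. norm (J k b - of_real (b * w) * q k) \<le> K * norm (of_real (b ^ 3) :: complex)"
        unfolding eventually_at_right_field using K by (auto intro!: exI[of _ b\<^sub>1] simp: norm_power)
    qed
  qed
  then obtain K where K: "\<forall>\<^sub>F b in at_right 0. norm (D b) \<le> K * norm (of_real (b ^ 3) :: complex)"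
    by (auto elim!: landau_o.bigE)
  \<comment> \<open>The main term of the sum of the J k b is 2 pi b sqrt N A. Dividing by it, which
    needs A \<noteq> 0, turns the absolute error of order b^3 into a relative one of order
    b^2.\<close>
  define E where "E b = D b / (of_real (2 * pi * b * sqrt (real N)) * A)" for b
  have E_bigo: "E \<in> O[at_right 0](\<lambda>b. of_real (b ^ 2))"
  proof (rule bigoI[where c = "K / (2 * pi * sqrt (real N) * norm A)"])
    show "\<forall>\<^sub>F b in at_right 0. norm (E b) \<le> K / (2 * pi * sqrt (real N) * norm A) * norm (of_real (b ^ 2) :: complex)"
      using K eventually_at_right_less[of 0]
    proof eventually_elim
      case (elim b)
      have "norm (E b) = norm (D b) / (2 * pi * b * sqrt (real N) * norm A)"
        using elim by (simp add: E_def norm_divide norm_mult)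
      also have "\<dots> \<le> (K * b ^ 3) / (2 * pi * b * sqrt (real N) * norm A)"
        using elim by (intro divide_right_mono) (auto simp: norm_power)
      also have "\<dots> = K / (2 * pi * sqrt (real N) * norm A) * b ^ 2"
        using elim by (simp add: power3_eq_cube power2_eq_square)
      finally show ?case by (simp add: norm_power)
    qed
  qed
  \<comment> \<open>The identity is exact for every b in (0, 1), since E is the normalised
    remainder; the limit b -> 0 enters only through the estimate of E.\<close>
  have chi: "chi_4_1 N b d = exp (h_4_1 N (x_0 N) / (2 * of_real pi * \<i> * of_real (b ^ 2) * of_nat N)) * A * (1 + E b)"
    if b: "0 < b" "b < 1" and d: "0 < d" "d < pi / sqrt (real N)" for b d
  proof -
    let ?H = "h_4_1 N (x_0 N) / (2 * of_real pi * \<i> * of_nat N * of_real (b\<^sup>2))"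
    let ?p = "of_real (2 * pi * b * sqrt (real N)) :: complex"
    have p0: "?p \<noteq> 0" using b N by simp
    have "exp (log_integrand N b (int k) (Complex t (- saddle_height N))) = exp ?H * saddle_integrand N (int k) b t" for k t
      unfolding saddle_integrand_def exp_add[symmetric] by simp
    hence "(LBINT t. exp (log_integrand N b (int k) (Complex t (- saddle_height N)))) = exp ?H * J k b" for k
      unfolding J_def by (simp only: integral_mult_right_zero)
    hence "chi_4_1 N b d = 1 / ?p * (\<Sum>k<N. exp ?H * J k b)"
      using chi_4_1_eq[OF N b d saddle_height(1,2)[OF N]] by simp
    also have "\<dots> = exp ?H * ((\<Sum>k<N. J k b) / ?p)" unfolding sum_distrib_left[symmetric] by simp
    also have "(\<Sum>k<N. J k b) = of_real (b * w) * (\<Sum>k<N. q k) + D b"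
      by (simp add: D_def sum_subtractf sum_distrib_left)
    also have "of_real (b * w) * (\<Sum>k<N. q k) = ?p * A" unfolding A_eq using b N by simp
    also have "(?p * A + D b) / ?p = A * (1 + E b)"
      using p0 A0 by (simp add: E_def field_simps)
    also have "?H = h_4_1 N (x_0 N) / (2 * of_real pi * \<i> * of_real (b ^ 2) * of_nat N)" by (simp add: mult_ac)
    finally show ?thesis by (simp only: mult.assoc)
  qed
  have "\<forall>\<^sub>F b::real in at_right 0. 0 < b \<and> b < 1"
    unfolding eventually_at_right_field by (intro exI[of _ 1]) auto
  hence "\<forall>\<^sub>F b in at_right 0. \<forall>d. 0 < d \<and> d < pi / sqrt (real N) \<longrightarrow>
      chi_4_1 N b d = exp (h_4_1 N (x_0 N) / (2 * of_real pi * \<i> * of_real (b ^ 2) * of_nat N)) * A * (1 + E b)"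
    by eventually_elim (use chi in blast)
  with E_bigo show ?thesis unfolding A_def by blast
qed

end
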